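(* Let $n\ge 2$ and let $\Gamma$ be a lattice in $\mathrm{Isom}(\mathbb{H}^n)$. Let $\mu$ be a probability distribution on $\Gamma$ with finite first $\mathbb{H}^n$-moment such that the support of $\mu$ generates a subgroup that contains a pair of loxodromic elements with distinct axes. Then, with respect to the harmonic measure $\nu$ defined by the $\mu$-random walk on $\Gamma$, the space $\mathbb{H}^n$ with the hyperbolic metric $d$ is statistically hyperbolic; that is, for every base-point $y\in\mathbb{H}^n$, with $\nu_r$ the probability measure induced by $\nu$ on the sphere $S_r(y)$ of radius $r$ centred at $y$, the following limit exists and $$\lim_{r\to\infty} \frac1r \int_{S_r(y)\times S_r(y)} d(x',x'')\, d\nu_r(x')\, d\nu_r(x'') = 2.$$
   Context: $\mathbb{H}^n$ is hyperbolic $n$-space with its hyperbolic metric $d$, and $S_r(y)=\{x'\in\mathbb{H}^n : d(y,x')=r\}$. The lattice $\Gamma$ may be uniform or non-uniform. $\mu$ has finite first $\mathbb{H}^n$-moment if $\sum_{g\in\Gamma}\mu(g)\, d(x,gx)<\infty$ for a (equivalently any) $x\in\mathbb{H}^n$. Harmonic measure: let $g_1,g_2,\dots$ be independent with law $\mu$ and $w_m=g_1g_2\cdots g_m$. Under the hypothesis on the support of $\mu$, for any $x\in\mathbb{H}^n$ the sequence $w_m x$ converges almost surely to a point of the sphere at infinity $\partial\mathbb{H}^n$; the harmonic measure $\nu$ on $\partial\mathbb{H}^n$ is the law of this limit. For a base-point $y$ and $r>0$, $\nu_r$ is the image of $\nu$ on $S_r(y)$ under the map sending $\lambda\in\partial\mathbb{H}^n$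 to the point at distance $r$ from $y$ on the geodesic ray from $y$ to $\lambda$. *)

theory Defs
  imports
    "HOL-Probability.Probability"
    "HOL-Algebra.Bij"
    "HOL-Algebra.Coset"
    "HOL-Algebra.Generated_Groups"
begin

section \<open>Hyperbolic space\<close>

text \<open>The Poincare ball model, of curvature \<open>-1\<close> and dimension \<open>CARD('n)\<close>. The sphere at
  infinity is the Euclidean unit sphere, and convergence of points of hyperbolic space to points
  at infinity is Euclidean convergence in the closed unit ball.\<close>

definition hyp_space :: "(real ^ 'n) set" where
  "hyp_space = ball 0 1"

definition hyp_boundary :: "(real ^ 'n) set" where
  "hyp_boundary = sphere 0 1"

definition hdist :: "real ^ 'n \<Rightarrow> real ^ 'n \<Rightarrow> real" where
  "hdist x y = arcosh (1 + 2 * (norm (x - y))\<^sup>2 / ((1 - (norm x)\<^sup>2) * (1 - (norm y)\<^sup>2)))"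

definition hyp_sphere :: "real ^ 'n \<Rightarrow> real \<Rightarrow> (real ^ 'n) set" where
  "hyp_sphere y r = {x \<in> hyp_space. hdist y x = r}"

definition unit_speed_geodesic_on :: "real set \<Rightarrow> (real \<Rightarrow> real ^ 'n) \<Rightarrow> bool" where
  "unit_speed_geodesic_on I \<gamma> \<longleftrightarrow>
     \<gamma> ` I \<subseteq> hyp_space \<and> (\<forall>s\<in>I. \<forall>t\<in>I. hdist (\<gamma> s) (\<gamma> t) = \<bar>s - t\<bar>)"

definition geodesic_ray_to :: "real ^ 'n \<Rightarrow> real ^ 'n \<Rightarrow> (real \<Rightarrow> real ^ 'n) \<Rightarrow> bool" where
  "geodesic_ray_to y \<xi> \<gamma> \<longleftrightarrow>
     unit_speed_geodesic_on {0..} \<gamma> \<and> \<gamma> 0 = y \<and> (\<gamma> \<longlongrightarrow> \<xi>) at_top"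

definition ray_point :: "real ^ 'n \<Rightarrow> real \<Rightarrow> real ^ 'n \<Rightarrow> real ^ 'n" where
  "ray_point y r \<xi> = (THE x. \<exists>\<gamma>. geodesic_ray_to y \<xi> \<gamma> \<and> x = \<gamma> r)"


section \<open>Isometries\<close>

text \<open>As in \<^const>\<open>BijGroup\<close>, an isometry is represented by a function that is
  \<^const>\<open>undefined\<close> outside of \<^const>\<open>hyp_space\<close>.\<close>

definition hyp_isom :: "(real ^ 'n \<Rightarrow> real ^ 'n) monoid" where
  "hyp_isom = (BijGroup hyp_space)
     \<lparr>carrier := {g \<in> Bij hyp_space.
        \<forall>x\<in>hyp_space. \<forall>y\<in>hyp_space. hdist (g x) (g y) = hdist x y}\<rparr>"

text \<open>The topology of pointwise convergence; on a group of isometries it agrees with the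
  compact-open topology.\<close>

definition hyp_isom_topology :: "(real ^ 'n \<Rightarrow> real ^ 'n) topology" where
  "hyp_isom_topology =
     subtopology (product_topology (\<lambda>_. euclidean) hyp_space) (carrier hyp_isom)"

definition translates_along ::
    "(real ^ 'n \<Rightarrow> real ^ 'n) \<Rightarrow> (real ^ 'n) set \<Rightarrow> bool" where
  "translates_along g A \<longleftrightarrow>
     (\<exists>\<gamma> \<tau>. unit_speed_geodesic_on UNIV \<gamma> \<and> A = range \<gamma> \<and> \<tau> > 0 \<and> (\<forall>t. g (\<gamma> t) = \<gamma> (t + \<tau>)))"

text \<open>A loxodromic isometry may also rotate about its axis.\<close>

definition loxodromic :: "(real ^ 'n \<Rightarrow> real ^ 'n) \<Rightarrow> bool" where
  "loxodromic g \<longleftrightarrow> g \<in> carrier hyp_isom \<and> (\<exists>A. translates_along g A)"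

definition lox_axis :: "(real ^ 'n \<Rightarrow> real ^ 'n) \<Rightarrow> (real ^ 'n) set" where
  "lox_axis g = (THE A. translates_along g A)"


section \<open>Lattices\<close>

text \<open>A lattice in a topological group is a discrete subgroup \<open>\<Gamma>\<close> such that the quotient by \<open>\<Gamma>\<close>
  carries a nonzero finite invariant Borel measure. The quotient is the space of right cosets
  \<open>\<Gamma> #> g\<close>, on which the group acts from the right. The union of a set of cosets is its preimage
  under the projection, so the sets in the generator below are the open sets of the quotient
  topology.\<close>

definition finite_covolume :: "'a monoid \<Rightarrow> 'a topology \<Rightarrow> 'a set \<Rightarrow> bool" where
  "finite_covolume G T \<Gamma> \<longleftrightarrow>
     (\<exists>M. finite_measure M \<and>
          space M = rcosets\<^bsub>G\<^esub> \<Gamma> \<and>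
          sets M = sigma_sets (rcosets\<^bsub>G\<^esub> \<Gamma>) {U. U \<subseteq> rcosets\<^bsub>G\<^esub> \<Gamma> \<and> openin T (\<Union>U)} \<and>
          emeasure M (space M) \<noteq> 0 \<and>
          (\<forall>g\<in>carrier G. \<forall>A\<in>sets M. emeasure M ((\<lambda>C. C #>\<^bsub>G\<^esub> g) ` A) = emeasure M A))"

definition lattice_in :: "'a monoid \<Rightarrow> 'a topology \<Rightarrow> 'a set \<Rightarrow> bool" where
  "lattice_in G T \<Gamma> \<longleftrightarrow>
     subgroup \<Gamma> G \<and> subtopology T \<Gamma> = discrete_topology \<Gamma> \<and> finite_covolume G T \<Gamma>"


section \<open>Random walks and harmonic measure\<close>

definition finite_first_moment ::
    "(real ^ 'n \<Rightarrow> real ^ 'n) set \<Rightarrow> (real ^ 'n \<Rightarrow> real ^ 'n) pmf \<Rightarrow> bool" where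
  "finite_first_moment \<Gamma> \<mu> \<longleftrightarrow>
     (\<exists>x\<in>hyp_space. (\<lambda>g. pmf \<mu> g * hdist x (g x)) summable_on \<Gamma>)"

text \<open>The space of independent increments with law \<open>\<mu>\<close>. Each factor is restricted to the
  (countable) support of \<open>\<mu>\<close>: on the full product over the uncountable type of functions, the
  position of the walk would not be measurable.\<close>

definition increments :: "'a pmf \<Rightarrow> (nat \<Rightarrow> 'a) measure" where
  "increments \<mu> = PiM UNIV (\<lambda>_. restrict_space (measure_pmf \<mu>) (set_pmf \<mu>))"

text \<open>The increment \<open>g\<^sub>m\<close> is \<open>\<omega> (m - 1)\<close>.\<close>

primrec walk ::
    "(nat \<Rightarrow> real ^ 'n \<Rightarrow> real ^ 'n) \<Rightarrow> nat \<Rightarrow> real ^ 'n \<Rightarrow> real ^ 'n" where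
  "walk \<omega> 0 = \<one>\<^bsub>hyp_isom\<^esub>"
| "walk \<omega> (Suc m) = walk \<omega> m \<otimes>\<^bsub>hyp_isom\<^esub> \<omega> m"

text \<open>The limit at infinity of a sequence, with an arbitrary value on \<^const>\<open>hyp_boundary\<close> if the
  sequence does not converge to a point at infinity. For the random walks under consideration
  this happens with probability zero.\<close>

definition boundary_lim :: "(nat \<Rightarrow> real ^ 'n) \<Rightarrow> real ^ 'n" where
  "boundary_lim X =
     (if \<exists>\<xi>\<in>hyp_boundary. X \<longlonglongrightarrow> \<xi> then lim X else (SOME \<xi>. \<xi> \<in> hyp_boundary))"

text \<open>The law of the limit of \<open>w\<^sub>m x\<close>; it does not depend on \<open>x\<close>.\<close>

definition harmonic_measure ::
    "(real ^ 'n \<Rightarrow> real ^ 'n) pmf \<Rightarrow> real ^ 'n \<Rightarrow> (real ^ 'n) measure" where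
  "harmonic_measure \<mu> x =
     distr (increments \<mu>) (restrict_space borel hyp_boundary)
       (\<lambda>\<omega>. boundary_lim (\<lambda>m. walk \<omega> m x))"


section \<open>Statistical hyperbolicity\<close>

definition sphere_measure ::
    "(real ^ 'n) measure \<Rightarrow> real ^ 'n \<Rightarrow> real \<Rightarrow> (real ^ 'n) measure" where
  "sphere_measure \<nu> y r = distr \<nu> (restrict_space borel (hyp_sphere y r)) (ray_point y r)"

definition statistically_hyperbolic :: "(real ^ 'n) measure \<Rightarrow> bool" where
  "statistically_hyperbolic \<nu> \<longleftrightarrow>
     (\<forall>y\<in>hyp_space.
        ((\<lambda>r. 1 / r * (\<integral>p. hdist (fst p) (snd p)
                         \<partial>(sphere_measure \<nu> y r \<Otimes>\<^sub>M sphere_measure \<nu> y r)))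
         \<longlongrightarrow> 2) at_top)"

end

theory Submission
  imports Defs
begin

text \<open>
  The theorem reduces to a single property of the harmonic measure: it has no atoms. Let \<open>\<xi>\<close> and \<open>\<eta>\<close> be
  points at infinity. The points at distance \<open>r\<close> from \<open>y\<close> on the rays to \<open>\<xi>\<close> and \<open>\<eta>\<close> have distance at most
  \<open>2 r\<close>, and if \<open>\<xi> \<noteq> \<eta>\<close> at least \<open>2 r\<close> minus a constant. Hence the distance divided by \<open>r\<close> is bounded by
  \<open>2\<close> and tends to \<open>2\<close> off the diagonal. If the measure has no atoms, the diagonal is a null set of
  the product measure, and dominated convergence gives the limit (\<open>nonatomic_statistically_hyperbolic\<close>).

  That the walk converges to the boundary, and that its limit law has no atoms, both follow from a
  spectral gap. The isometry group acts on the closed ball; regard the closed ball as a discrete set, and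
  on its square-summable functions consider the operator that averages the translates of a function
  with weights \<open>\<mu>\<close>. High powers of two loxodromic elements whose axes have four distinct endpoints play
  ping-pong with four disjoint half-spaces (\<open>ping_pong\<close>). A nonzero function that is almost invariant under
  one of the two powers has almost all of its mass on the two half-spaces of that power, and it cannot do so for
  both. So no such function is almost invariant under the support of \<open>\<mu>\<close>, and the lazy averaging operator
  is a strict contraction (\<open>spectral_gap\<close>).

  The masses of the atoms of the harmonic measure form a square-summable function that is fixed by
  averaging. A strict contraction has no such fixed point except zero (\<open>harmonic_nonatomic\<close>).

  The law of the walk at time \<open>m\<close> is the \<open>m\<close>-th iterate of averaging applied to a point mass, so every point
  carries exponentially small mass (\<open>density_decay\<close>). An orbit of a discrete group has only exponentially many
  points in a ball of radius \<open>R\<close> (\<open>orbit_growth\<close>). By the Borel-Cantelli lemma the walk escapes at linear speed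
  (\<open>linear_escape\<close>), whereas the first moment condition makes its steps sublinear (\<open>sublinear_steps\<close>). Seen
  from the origin, successive positions therefore have large Gromov product, which means that their
  Euclidean distance decays geometrically, and the walk converges (\<open>converges_to_boundary\<close>).

  Discreteness enters twice: in the growth of orbits, and in the fact that distinct axes have no common
  endpoint (\<open>common_endpoint_common_axis\<close>). All geometry is done by linear algebra in the hyperboloid
  model, and isometries extend to the closed ball because they are Lipschitz for the Euclidean metric.
\<close>

section \<open>The hyperboloid model and the triangle inequality\<close>

text \<open>The Lorentz form, with the sign for which points of hyperbolic space are unit vectors.\<close>

definition mink :: "real \<times> (real ^ 'n) \<Rightarrow> real \<times> (real ^ 'n) \<Rightarrow> real" where
  "mink a b = fst a * fst b - snd a \<bullet> snd b"

text \<open>The point of the upper sheet of the hyperboloid that corresponds to a point of the ball under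
  stereographic projection; the projection itself is \<open>hproj\<close>. In these coordinates \<open>cosh\<close> of the distance
  is bilinear, and geodesics and horofunctions have linear formulas.\<close>

definition hlift :: "real ^ 'n \<Rightarrow> real \<times> (real ^ 'n)" where
  "hlift p = ((1 + (norm p)\<^sup>2) / (1 - (norm p)\<^sup>2), (2 / (1 - (norm p)\<^sup>2)) *\<^sub>R p)"

definition hproj :: "real \<times> (real ^ 'n) \<Rightarrow> real ^ 'n" where
  "hproj Z = (1 / (1 + fst Z)) *\<^sub>R snd Z"

lemma mink_simps:
  "mink (a + b) c = mink a c + mink b c" "mink a (b + c) = mink a b + mink a c"
  "mink (a - b) c = mink a c - mink b c" "mink a (b - c) = mink a b - mink a c"
  "mink (s *\<^sub>R a) c = s * mink a c" "mink a (s *\<^sub>R c) = s * mink a c"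
  by (simp_all add: mink_def inner_simps algebra_simps)

lemma mink_commute: "mink a b = mink b a"
  by (simp add: mink_def inner_commute)

lemma hyp_space_iff: "p \<in> hyp_space \<longleftrightarrow> norm p < 1"
  by (simp add: hyp_space_def)

lemma hyp_spaceD: "p \<in> hyp_space \<Longrightarrow> (norm p)\<^sup>2 < 1"
  by (simp add: hyp_space_iff power_less_one_iff)

lemma zero_in_hyp_space [simp]: "0 \<in> hyp_space"
  by (simp add: hyp_space_def)

lemma norm_diff_square: "(norm (p - q))\<^sup>2 = (norm p)\<^sup>2 + (norm q)\<^sup>2 - 2 * (p \<bullet> q)"
  for p q :: "real ^ 'n"
  by (simp add: power2_norm_eq_inner inner_simps inner_commute)

lemma mink_hlift:
  assumes "p \<in> hyp_space" "q \<in> hyp_space"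
  shows "mink (hlift p) (hlift q) = 1 + 2 * (norm (p - q))\<^sup>2 / ((1 - (norm p)\<^sup>2) * (1 - (norm q)\<^sup>2))"
proof -
  define a b c where "a = (norm p)\<^sup>2" "b = (norm q)\<^sup>2" "c = p \<bullet> q"
  have ne: "1 - a \<noteq> 0" "1 - b \<noteq> 0"
    using assms[THEN hyp_spaceD] by (auto simp: a_b_c_def)
  have "mink (hlift p) (hlift q) = ((1 + a) * (1 + b) - 4 * c) / ((1 - a) * (1 - b))"
    by (simp add: mink_def hlift_def a_b_c_def diff_divide_distrib)
  also have "(1 + a) * (1 + b) - 4 * c = (1 - a) * (1 - b) + 2 * (a + b - 2 * c)"
    by (simp add: algebra_simps)
  also have "\<dots> / ((1 - a) * (1 - b)) = 1 + 2 * (a + b - 2 * c) / ((1 - a) * (1 - b))"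
    using ne by (simp add: add_divide_distrib)
  finally show ?thesis by (simp add: norm_diff_square a_b_c_def)
qed

lemma cosh_arg_nonneg:
  assumes "p \<in> hyp_space" "q \<in> hyp_space"
  shows "2 * (norm (p - q))\<^sup>2 / ((1 - (norm p)\<^sup>2) * (1 - (norm q)\<^sup>2)) \<ge> 0"
  using assms[THEN hyp_spaceD] by simp

lemma cosh_hdist:
  assumes "p \<in> hyp_space" "q \<in> hyp_space"
  shows "cosh (hdist p q) = mink (hlift p) (hlift q)"
  using cosh_arg_nonneg[OF assms] by (simp add: hdist_def mink_hlift[OF assms])

lemma hdist_nonneg: "p \<in> hyp_space \<Longrightarrow> q \<in> hyp_space \<Longrightarrow> 0 \<le> hdist p q"
  using cosh_arg_nonneg[of p q] by (simp add: hdist_def)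

lemma hdist_commute: "hdist p q = hdist q p"
  by (simp add: hdist_def norm_minus_commute mult.commute)

lemma hdist_self [simp]: "hdist p p = 0"
  by (simp add: hdist_def)

lemma hdist_eqI:
  assumes "p \<in> hyp_space" "q \<in> hyp_space" "0 \<le> d" "mink (hlift p) (hlift q) = cosh d"
  shows "hdist p q = d"
  using cosh_hdist[OF assms(1,2)] assms hdist_nonneg[OF assms(1,2)] by simp

lemma mink_hlift_eq_1:
  assumes "p \<in> hyp_space" "q \<in> hyp_space" "mink (hlift p) (hlift q) = 1"
  shows "p = q"
  using assms(3) assms(1,2)[THEN hyp_spaceD] unfolding mink_hlift[OF assms(1,2)] by auto

lemma hdist_eq_0:
  assumes "p \<in> hyp_space" "q \<in> hyp_space" "hdist p q = 0"
  shows "p = q"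
  using mink_hlift_eq_1[OF assms(1,2)] cosh_hdist[OF assms(1,2)] assms(3) by simp

text \<open>The orthogonal complement of a unit timelike vector is negative definite. The difference of the two
  sides is a quadratic polynomial in the time coordinate of \<open>W\<close>; the ordinary Cauchy-Schwarz inequality
  for the space coordinates bounds its discriminant.\<close>

lemma mink_reversed_CS:
  assumes "mink Q Q = 1"
  shows "mink W W \<le> (mink W Q)\<^sup>2"
proof -
  obtain t v where Q: "Q = (t, v)" by force
  obtain T V where W: "W = (T, V)" by force
  have t: "t\<^sup>2 = 1 + v \<bullet> v" using assms by (simp add: Q mink_def power2_eq_square)
  have cs: "(V \<bullet> v)\<^sup>2 \<le> (V \<bullet> V) * (v \<bullet> v)" by (rule Cauchy_Schwarz_ineq)
  define a b c where "a = V \<bullet> v" "b = V \<bullet> V" "c = v \<bullet> v"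
  have b0: "b \<ge> 0" "c \<ge> 0" by (auto simp: a_b_c_def)
  have cs': "a\<^sup>2 \<le> b * c" and t': "t\<^sup>2 = 1 + c" using cs t by (auto simp: a_b_c_def)
  have "0 \<le> c * T\<^sup>2 - 2 * t * T * a + a\<^sup>2 + b"
  proof (cases "c = 0")
    case True
    hence "a = 0" using cs' by simp
    thus ?thesis using True b0 by simp
  next
    case False
    \<comment> \<open>Completing the square in \<open>T\<close>.\<close>
    have "c * (c * T\<^sup>2 - 2 * t * T * a + a\<^sup>2 + b) = (c * T - t * a)\<^sup>2 + (b * c - a\<^sup>2)"
    proof -
      have "(c * T - t * a)\<^sup>2 = c\<^sup>2 * T\<^sup>2 - 2 * c * T * t * a + (1 + c) * a\<^sup>2"
        unfolding t'[symmetric] by (simp add: power2_eq_square algebra_simps)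
      thus ?thesis by (simp add: power2_eq_square algebra_simps)
    qed
    also have "\<dots> \<ge> 0" using cs' by simp
    finally show ?thesis using False b0 by (simp add: zero_le_mult_iff)
  qed
  moreover have "(mink W Q)\<^sup>2 - mink W W = c * T\<^sup>2 - 2 * t * T * a + a\<^sup>2 + b"
  proof -
    have "(mink W Q)\<^sup>2 = T\<^sup>2 * t\<^sup>2 - 2 * t * T * a + a\<^sup>2"
      by (simp add: mink_def Q W a_b_c_def power2_eq_square algebra_simps)
    thus ?thesis unfolding t' by (simp add: mink_def Q W a_b_c_def power2_eq_square algebra_simps)
  qed
  ultimately show ?thesis by simp
qed

text \<open>Cauchy-Schwarz on the orthogonal complement of \<open>Q\<close>, where the negative of the form is positive
  semidefinite, applied to the components of \<open>P\<close> and \<open>R\<close> there.\<close>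

lemma mink_CS_orthogonal:
  assumes "mink Q Q = 1"
  shows "(mink P Q * mink R Q - mink P R)\<^sup>2 \<le> ((mink P Q)\<^sup>2 - mink P P) * ((mink R Q)\<^sup>2 - mink R R)"
proof -
  define A B C where "A = (mink P Q)\<^sup>2 - mink P P" and "B = mink P Q * mink R Q - mink P R"
    and "C = (mink R Q)\<^sup>2 - mink R R"
  have pos: "0 \<le> s\<^sup>2 * A - 2 * s * B * u + u\<^sup>2 * C" for s u
  proof -
    have "s\<^sup>2 * A - 2 * s * B * u + u\<^sup>2 * C
      = (mink (s *\<^sub>R P - u *\<^sub>R R) Q)\<^sup>2 - mink (s *\<^sub>R P - u *\<^sub>R R) (s *\<^sub>R P - u *\<^sub>R R)"
      by (simp add: A_def B_def C_def mink_simps mink_commute[of R P] power2_eq_square algebra_simps)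
    thus ?thesis using mink_reversed_CS[OF assms] by simp
  qed
  have A: "A \<ge> 0" "C \<ge> 0" using pos[of 1 0] pos[of 0 1] by auto
  have "B\<^sup>2 \<le> A * C"
  proof (cases "A = 0")
    case True
    show ?thesis
    proof (cases "B = 0")
      case False
      \<comment> \<open>The polynomial is affine in \<open>s\<close> here; this value of \<open>s\<close> makes it negative.\<close>
      have "0 \<le> - 2 * ((C + 1) / B) * B + C"
        using pos[of "(C+1)/B" 1] unfolding True
          by (simp only: mult_zero_right mult_1_right power_one mult_1_left diff_0 minus_mult_left)
      also have "\<dots> = - C - 2" using False by (simp add: field_simps)
      finally show ?thesis using A by simp
    qed (use True in auto)
  next
    case False
    have "0 \<le> B\<^sup>2 * A - 2 * B * B * A + A\<^sup>2 * C" by (rule pos)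
    also have "\<dots> = A * (A * C - B\<^sup>2)" by (simp add: power2_eq_square algebra_simps)
    finally show ?thesis using False A by (simp add: zero_le_mult_iff)
  qed
  thus ?thesis by (simp add: A_def B_def C_def)
qed

lemma mink_hlift_self: "p \<in> hyp_space \<Longrightarrow> mink (hlift p) (hlift p) = 1"
  by (simp add: mink_hlift)

text \<open>Subtract from the lifts of \<open>p\<close> and \<open>r\<close> their components along the lift of \<open>q\<close>. The remainders have
  length \<open>sinh\<close> of the distance to \<open>q\<close>, so Cauchy-Schwarz gives the addition formula for \<open>cosh\<close>
  as an upper bound.\<close>

lemma hdist_triangle:
  assumes "p \<in> hyp_space" "q \<in> hyp_space" "r \<in> hyp_space"
  shows "hdist p r \<le> hdist p q + hdist q r"
proof -
  let ?a = "hdist p q" and ?b = "hdist q r" and ?c = "hdist p r"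
  have n: "?a \<ge> 0" "?b \<ge> 0" "?c \<ge> 0" using assms hdist_nonneg by auto
  have "(cosh ?a * cosh ?b - cosh ?c)\<^sup>2 \<le> ((cosh ?a)\<^sup>2 - 1) * ((cosh ?b)\<^sup>2 - 1)"
    using mink_CS_orthogonal[OF mink_hlift_self[OF assms(2)], of "hlift p" "hlift r"] assms
    by (simp add: cosh_hdist mink_hlift_self mink_commute[of "hlift q" "hlift r"])
  also have "\<dots> = (sinh ?a * sinh ?b)\<^sup>2"
    by (simp add: cosh_square_eq power_mult_distrib)
  finally have "\<bar>cosh ?a * cosh ?b - cosh ?c\<bar> \<le> \<bar>sinh ?a * sinh ?b\<bar>"
    by (rule abs_le_square_iff[THEN iffD2])
  hence "cosh ?c \<le> cosh ?a * cosh ?b + sinh ?a * sinh ?b" using n by (simp add: abs_le_iff)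
  also have "\<dots> = cosh (?a + ?b)" by (simp add: cosh_add)
  finally show ?thesis using n by (simp add: cosh_real_nonneg_le_iff)
qed

section \<open>Comparison of the hyperbolic and the Euclidean metric\<close>

lemma norm_diff_hdist:
  assumes "p \<in> hyp_space" "q \<in> hyp_space"
  shows "(norm (p - q))\<^sup>2 = (cosh (hdist p q) - 1) / 2 * ((1 - (norm p)\<^sup>2) * (1 - (norm q)\<^sup>2))"
  using assms(1,2)[THEN hyp_spaceD] by (simp add: cosh_hdist[OF assms] mink_hlift[OF assms])

lemma hdist_0_cosh: "p \<in> hyp_space \<Longrightarrow> cosh (hdist 0 p) = (1 + (norm p)\<^sup>2) / (1 - (norm p)\<^sup>2)"
  by (simp add: cosh_hdist mink_def hlift_def)

lemma cosh_bounds: "exp d / 2 \<le> cosh d" "d \<ge> 0 \<Longrightarrow> cosh d \<le> exp d" for d :: real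
  by (simp_all add: cosh_field_def)

lemma one_minus_norm_sq_le:
  assumes "p \<in> hyp_space" shows "1 - (norm p)\<^sup>2 \<le> 4 * exp (- hdist 0 p)"
proof -
  let ?s = "1 - (norm p)\<^sup>2"
  have s: "?s > 0" using hyp_spaceD[OF assms] by simp
  have "exp (hdist 0 p) / 2 * ?s \<le> cosh (hdist 0 p) * ?s"
    using cosh_bounds(1) s by (intro mult_right_mono) auto
  also have "\<dots> = 1 + (norm p)\<^sup>2" using s by (simp add: hdist_0_cosh[OF assms])
  also have "\<dots> \<le> 2" using s by simp
  finally show ?thesis by (simp add: exp_minus field_simps)
qed

lemma one_minus_norm_sq_ge:
  assumes "p \<in> hyp_space" shows "exp (- hdist 0 p) \<le> 1 - (norm p)\<^sup>2"
proof -
  let ?s = "1 - (norm p)\<^sup>2"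
  have s: "?s > 0" using hyp_spaceD[OF assms] by simp
  have "1 \<le> 1 + (norm p)\<^sup>2" by simp
  also have "1 + (norm p)\<^sup>2 = cosh (hdist 0 p) * ?s" using s by (simp add: hdist_0_cosh[OF assms])
  also have "\<dots> \<le> exp (hdist 0 p) * ?s"
    using cosh_bounds(2) hdist_nonneg[OF _ assms] s by (intro mult_right_mono) auto
  finally show ?thesis by (simp add: exp_minus field_simps)
qed

text \<open>The exponent is minus twice the Gromov product of \<open>p\<close> and \<open>q\<close> at the origin. This estimate turns
  hyperbolic statements about distances into Euclidean convergence at the boundary.\<close>

lemma norm_diff_le_hdist:
  assumes "p \<in> hyp_space" "q \<in> hyp_space"
  shows "(norm (p - q))\<^sup>2 \<le> 16 * exp (hdist p q - hdist 0 p - hdist 0 q)"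
proof -
  have s: "1 - (norm p)\<^sup>2 > 0" "1 - (norm q)\<^sup>2 > 0" using assms[THEN hyp_spaceD] by auto
  have "cosh (hdist p q) \<le> exp (hdist p q)" using cosh_bounds(2) hdist_nonneg[OF assms] by simp
  hence c: "(cosh (hdist p q) - 1) / 2 \<le> exp (hdist p q)"
    using exp_gt_zero[of "hdist p q"] by argo
  have "(norm (p - q))\<^sup>2 \<le> exp (hdist p q) * ((4 * exp (- hdist 0 p)) * (4 * exp (- hdist 0 q)))"
    unfolding norm_diff_hdist[OF assms]
    using c s one_minus_norm_sq_le[OF assms(1)] one_minus_norm_sq_le[OF assms(2)]
    by (intro mult_mono) auto
  thus ?thesis by (simp add: exp_diff exp_minus exp_add field_simps)
qed

lemma norm_diff_ge_hdist:
  assumes "p \<in> hyp_space" "q \<in> hyp_space"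
  shows "(cosh (hdist p q) - 1) / 2 * exp (- hdist 0 p - hdist 0 q) \<le> (norm (p - q))\<^sup>2"
proof -
  have "(cosh (hdist p q) - 1) / 2 * (exp (- hdist 0 p) * exp (- hdist 0 q)) \<le> (norm (p - q))\<^sup>2"
    unfolding norm_diff_hdist[OF assms]
    using one_minus_norm_sq_ge[OF assms(1)] one_minus_norm_sq_ge[OF assms(2)] assms[THEN hyp_spaceD]
    by (intro mult_left_mono mult_mono) (auto simp: cosh_real_ge_1)
  thus ?thesis by (simp add: exp_diff exp_minus exp_add field_simps)
qed

lemma exp_hdist_le:
  assumes "p \<in> hyp_space" "q \<in> hyp_space"
  shows "exp (hdist p q) \<le> 2 + 4 * (norm (p - q))\<^sup>2 * exp (hdist 0 p + hdist 0 q)"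
proof -
  have "(exp (hdist p q) / 2 - 1) / 2 * exp (- hdist 0 p - hdist 0 q)
      \<le> (cosh (hdist p q) - 1) / 2 * exp (- hdist 0 p - hdist 0 q)"
    using cosh_bounds(1) by (intro mult_right_mono) auto
  also have "\<dots> \<le> (norm (p - q))\<^sup>2" by (rule norm_diff_ge_hdist[OF assms])
  finally show ?thesis by (simp add: exp_diff exp_minus exp_add field_simps)
qed

lemma tendsto_hyp_boundary:
  assumes "\<And>i. X i \<in> hyp_space" "filterlim (\<lambda>i. hdist 0 (X i)) at_top F" "(X \<longlongrightarrow> \<xi>) F" "F \<noteq> bot"
  shows "norm \<xi> = 1"
proof -
  have a: "((\<lambda>i. 4 * exp (- hdist 0 (X i))) \<longlongrightarrow> 4 * 0) F"
    using assms(2) by (intro tendsto_mult tendsto_const filterlim_compose[OF exp_at_bot])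
       (simp add: filterlim_uminus_at_bot)
  have "((\<lambda>i. 1 - (norm (X i))\<^sup>2) \<longlongrightarrow> 0) F"
  proof (rule tendsto_sandwich[OF _ _ tendsto_const])
    show "((\<lambda>i. 4 * exp (- hdist 0 (X i))) \<longlongrightarrow> 0) F" using a by simp
    show "\<forall>\<^sub>F i in F. 0 \<le> 1 - (norm (X i))\<^sup>2"
      using assms(1)[THEN hyp_spaceD] by (auto intro!: always_eventually less_imp_le)
    show "\<forall>\<^sub>F i in F. 1 - (norm (X i))\<^sup>2 \<le> 4 * exp (- hdist 0 (X i))"
      using assms(1)[THEN one_minus_norm_sq_le] by (auto intro!: always_eventually)
  qed
  moreover have "((\<lambda>i. 1 - (norm (X i))\<^sup>2) \<longlongrightarrow> 1 - (norm \<xi>)\<^sup>2) F"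
    using assms(3) by (intro tendsto_intros)
  ultimately have "1 - (norm \<xi>)\<^sup>2 = 0" using tendsto_unique assms(4) by blast
  thus ?thesis by (simp add: power2_eq_1_iff) (smt (verit) norm_ge_zero)
qed

text \<open>Every future unit timelike vector comes from a point of the ball.\<close>

lemma hlift_hproj:
  assumes "mink Z Z = 1" "fst Z > 0"
  shows "hproj Z \<in> hyp_space" "hlift (hproj Z) = Z"
proof -
  obtain t v where Z: "Z = (t, v)" by force
  have t: "(norm v)\<^sup>2 = t\<^sup>2 - 1" "t > 0" using assms
    by (auto simp: Z mink_def power2_eq_square power2_norm_eq_inner[unfolded power2_eq_square])
  have n: "(norm (hproj Z))\<^sup>2 = (t - 1) / (t + 1)"
  proof -
    have "(norm (hproj Z))\<^sup>2 = (t\<^sup>2 - 1) / (1 + t)\<^sup>2"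
      using t by (simp add: hproj_def Z power_divide)
    also have "\<dots> = (t - 1) / (t + 1)" using t
      by (simp add: power2_eq_square divide_simps) (simp add: algebra_simps)
    finally show ?thesis .
  qed
  have "(norm (hproj Z))\<^sup>2 < 1" using n t by simp
  thus "hproj Z \<in> hyp_space" by (simp add: hyp_space_iff power_less_one_iff abs_square_less_1)
  have a: "1 - (norm (hproj Z))\<^sup>2 = 2 / (t + 1)" "1 + (norm (hproj Z))\<^sup>2 = 2 * t / (t + 1)"
    unfolding n using t by (auto simp: field_simps)
  show "hlift (hproj Z) = Z"
    unfolding hlift_def a using t by (simp add: hproj_def Z field_simps)
qed

lemma hproj_hlift: "p \<in> hyp_space \<Longrightarrow> hproj (hlift p) = p"
  using hyp_spaceD[of p] by (simp add: hproj_def hlift_def field_simps)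

lemma fst_hlift_pos: "p \<in> hyp_space \<Longrightarrow> fst (hlift p) > 0"
  using hyp_spaceD[of p] by (simp add: hlift_def add_pos_nonneg)

section \<open>Isometries and their extension to the closed ball\<close>

lemma hyp_isom_simps:
  "carrier hyp_isom = {g \<in> Bij hyp_space. \<forall>x\<in>hyp_space. \<forall>y\<in>hyp_space. hdist (g x) (g y) = hdist x y}"
  "\<one>\<^bsub>hyp_isom\<^esub> = (\<lambda>z\<in>hyp_space. z)"
  "mult hyp_isom = mult (BijGroup hyp_space)"
  by (auto simp: hyp_isom_def BijGroup_def)

lemma hyp_isom_bij: "g \<in> carrier hyp_isom \<Longrightarrow> bij_betw g hyp_space hyp_space"
  by (auto simp: hyp_isom_simps Bij_def)

lemma hyp_isom_closed: "g \<in> carrier hyp_isom \<Longrightarrow> z \<in> hyp_space \<Longrightarrow> g z \<in> hyp_space"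
  using hyp_isom_bij bij_betwE by blast

lemma hdist_isom: "g \<in> carrier hyp_isom \<Longrightarrow> z \<in> hyp_space \<Longrightarrow> w \<in> hyp_space \<Longrightarrow> hdist (g z) (g w) = hdist z w"
  by (auto simp: hyp_isom_simps)

lemma group_hyp_isom: "group (hyp_isom :: (real ^ 'n \<Rightarrow> real ^ 'n) monoid)"
proof -
  have "subgroup (carrier hyp_isom) (BijGroup (hyp_space :: (real ^ 'n) set))"
  proof (rule group.subgroupI[OF group_BijGroup])
    show "carrier hyp_isom \<subseteq> carrier (BijGroup (hyp_space :: (real ^ 'n) set))"
      by (auto simp: hyp_isom_simps BijGroup_def)
    have "\<one>\<^bsub>hyp_isom\<^esub> \<in> carrier (hyp_isom :: (real ^ 'n \<Rightarrow> real ^ 'n) monoid)"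
      by (auto simp: hyp_isom_simps id_Bij)
    thus "carrier (hyp_isom :: (real ^ 'n \<Rightarrow> real ^ 'n) monoid) \<noteq> {}" by auto
  next
    fix g :: "real ^ 'n \<Rightarrow> real ^ 'n" assume g: "g \<in> carrier hyp_isom"
    have gB: "g \<in> Bij hyp_space" using g by (simp add: hyp_isom_simps)
    have b: "bij_betw g hyp_space hyp_space" by (rule hyp_isom_bij[OF g])
    have "restrict (inv_into hyp_space g) hyp_space \<in> carrier hyp_isom"
      unfolding hyp_isom_simps
    proof (intro CollectI conjI ballI)
      fix z w :: "real ^ 'n" assume zw: "z \<in> hyp_space" "w \<in> hyp_space"
      have "inv_into hyp_space g z \<in> hyp_space" "inv_into hyp_space g w \<in> hyp_space"
        using b zw by (metis bij_betw_def inv_into_into)+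
      from hdist_isom[OF g this]
      show "hdist (restrict (inv_into hyp_space g) hyp_space z) (restrict (inv_into hyp_space g) hyp_space w)
        = hdist z w"
        using zw by (simp add: bij_betw_inv_into_right[OF b])
    qed (rule restrict_inv_into_Bij[OF gB])
    moreover have "inv\<^bsub>BijGroup hyp_space\<^esub> g = restrict (inv_into hyp_space g) hyp_space"
      using inv_BijGroup[OF gB] .
    ultimately show "inv\<^bsub>BijGroup hyp_space\<^esub> g \<in> carrier hyp_isom" by simp
  next
    fix g h :: "real ^ 'n \<Rightarrow> real ^ 'n" assume g: "g \<in> carrier hyp_isom" and h: "h \<in> carrier hyp_isom"
    have "compose hyp_space g h \<in> carrier hyp_isom"
      using g h hyp_isom_closed[OF h]
      by (auto simp: hyp_isom_simps compose_Bij compose_eq)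
    thus "g \<otimes>\<^bsub>BijGroup hyp_space\<^esub> h \<in> carrier hyp_isom"
      using g h by (simp add: BijGroup_def hyp_isom_simps)
  qed
  from subgroup.subgroup_is_group[OF this group_BijGroup]
  show ?thesis by (simp add: hyp_isom_def)
qed

lemma hyp_isom_mult_apply:
  "g \<in> carrier hyp_isom \<Longrightarrow> h \<in> carrier hyp_isom \<Longrightarrow> z \<in> hyp_space \<Longrightarrow> (g \<otimes>\<^bsub>hyp_isom\<^esub> h) z = g (h z)"
  by (simp add: hyp_isom_simps BijGroup_def compose_eq)

lemma hyp_isom_one_apply: "z \<in> hyp_space \<Longrightarrow> \<one>\<^bsub>hyp_isom\<^esub> z = z"
  by (simp add: hyp_isom_simps)

lemma hyp_isom_inv_apply:
  assumes "g \<in> carrier hyp_isom" "z \<in> hyp_space"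
  shows "(inv\<^bsub>hyp_isom\<^esub> g) (g z) = z" "g ((inv\<^bsub>hyp_isom\<^esub> g) z) = z"
proof -
  interpret group hyp_isom by (rule group_hyp_isom)
  show "(inv\<^bsub>hyp_isom\<^esub> g) (g z) = z" "g ((inv\<^bsub>hyp_isom\<^esub> g) z) = z"
    using assms hyp_isom_mult_apply[of "inv\<^bsub>hyp_isom\<^esub> g" g z] hyp_isom_mult_apply[of g "inv\<^bsub>hyp_isom\<^esub> g" z]
    by (auto simp: hyp_isom_one_apply)
qed

text \<open>The continuous extension of an isometry to the closed ball, computed along radii; outside the closed
  ball it is the identity, so that it becomes a permutation of the whole space.\<close>

definition bext :: "(real ^ 'n \<Rightarrow> real ^ 'n) \<Rightarrow> real ^ 'n \<Rightarrow> real ^ 'n" where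
  "bext g p = (if p \<in> cball 0 1 then lim (\<lambda>k. g ((1 - 1 / (real k + 2)) *\<^sub>R p)) else p)"

lemma radial_approx:
  fixes p :: "real ^ 'n"
  assumes "p \<in> cball 0 1"
  shows "(1 - 1 / (real k + 2)) *\<^sub>R p \<in> hyp_space"
    and "(\<lambda>k. (1 - 1 / (real k + 2)) *\<^sub>R p) \<longlonglongrightarrow> p"
proof -
  have "\<bar>1 - 1 / (real k + 2)\<bar> < 1" by (auto simp: field_simps)
  moreover have "\<bar>1 - 1 / (real k + 2)\<bar> * norm p \<le> \<bar>1 - 1 / (real k + 2)\<bar> * 1"
    using assms by (intro mult_left_mono) auto
  ultimately have "\<bar>1 - 1 / (real k + 2)\<bar> * norm p < 1" unfolding mult_1_right by (rule le_less_trans[rotated])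
  thus "(1 - 1 / (real k + 2)) *\<^sub>R p \<in> hyp_space" by (simp add: hyp_space_iff del: abs_divide)
  have "(\<lambda>k. 1 - 1 / (real k + 2)) \<longlonglongrightarrow> 1" by real_asymp
  from tendsto_scaleR[OF this tendsto_const, of p]
  show "(\<lambda>k. (1 - 1 / (real k + 2)) *\<^sub>R p) \<longlonglongrightarrow> p" by simp
qed

text \<open>An isometry changes the distance to the origin by at most a constant, hence \<open>1 - |p|\<^sup>2\<close> by at most a
  constant factor. By \<open>norm_diff_hdist\<close> the Euclidean distance then changes by at most that factor.
  This is what makes the extension to the boundary possible.\<close>

lemma isom_lipschitz:
  fixes g :: "real ^ 'n \<Rightarrow> real ^ 'n"
  assumes g: "g \<in> carrier hyp_isom"
  obtains K where "K \<ge> 0" "\<And>p q. p \<in> hyp_space \<Longrightarrow> q \<in> hyp_space \<Longrightarrow> norm (g p - g q) \<le> K * norm (p - q)"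
proof -
  \<comment> \<open>The factor \<open>4\<close> is the quotient of the constants in \<open>one_minus_norm_sq_le\<close> and \<open>one_minus_norm_sq_ge\<close>.\<close>
  define M where "M = 4 * exp (hdist 0 (g 0))"
  have M: "M > 0" by (simp add: M_def)
  have le: "1 - (norm (g p))\<^sup>2 \<le> M * (1 - (norm p)\<^sup>2)" if p: "p \<in> hyp_space" for p
  proof -
    note gp = hyp_isom_closed[OF g p] hyp_isom_closed[OF g zero_in_hyp_space]
    have "hdist 0 p = hdist (g 0) (g p)" using hdist_isom[OF g _ p] by simp
    also have "\<dots> \<le> hdist 0 (g 0) + hdist 0 (g p)"
      using hdist_triangle[of "g 0" 0 "g p"] gp by (simp add: hdist_commute[of "g 0" 0])
    finally have d: "- hdist 0 (g p) \<le> hdist 0 (g 0) - hdist 0 p" by simp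
    have "1 - (norm (g p))\<^sup>2 \<le> 4 * exp (- hdist 0 (g p))" by (rule one_minus_norm_sq_le[OF gp(1)])
    also have "\<dots> \<le> 4 * exp (hdist 0 (g 0) - hdist 0 p)" using d by simp
    also have "\<dots> = M * exp (- hdist 0 p)" by (simp add: M_def exp_diff exp_minus field_simps)
    also have "\<dots> \<le> M * (1 - (norm p)\<^sup>2)" using M one_minus_norm_sq_ge[OF p] by (intro mult_left_mono) auto
    finally show ?thesis .
  qed
  show ?thesis
  proof
    fix p q :: "real ^ 'n" assume p: "p \<in> hyp_space" and q: "q \<in> hyp_space"
    note gp = hyp_isom_closed[OF g p] hyp_isom_closed[OF g q]
    have "(norm (g p - g q))\<^sup>2 = (cosh (hdist p q) - 1) / 2 * ((1 - (norm (g p))\<^sup>2) * (1 - (norm (g q))\<^sup>2))"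
      using norm_diff_hdist[OF gp] hdist_isom[OF g p q] by simp
    also have "\<dots> \<le> (cosh (hdist p q) - 1) / 2 * ((M * (1 - (norm p)\<^sup>2)) * (M * (1 - (norm q)\<^sup>2)))"
      using le[OF p] le[OF q] hyp_spaceD[OF gp(1)] hyp_spaceD[OF gp(2)] hyp_spaceD[OF p] hyp_spaceD[OF q] M
      by (intro mult_left_mono mult_mono) (auto simp: cosh_real_ge_1)
    also have "\<dots> = (M * norm (p - q))\<^sup>2"
      unfolding power_mult_distrib norm_diff_hdist[OF p q] by (simp add: power2_eq_square)
    finally show "norm (g p - g q) \<le> M * norm (p - q)"
      by (rule power2_le_imp_le) (use M in simp)
  qed (use M in simp)
qed

lemma bext_lipschitz:
  fixes g :: "real ^ 'n \<Rightarrow> real ^ 'n"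
  assumes g: "g \<in> carrier hyp_isom"
  obtains K where "K \<ge> 0" "\<And>p q. p \<in> cball 0 1 \<Longrightarrow> q \<in> hyp_space \<Longrightarrow> norm (g q - bext g p) \<le> K * norm (q - p)"
proof -
  obtain K where K: "K \<ge> 0" "\<And>p q. p \<in> hyp_space \<Longrightarrow> q \<in> hyp_space \<Longrightarrow> norm (g p - g q) \<le> K * norm (p - q)"
    using isom_lipschitz[OF g] by blast
  show ?thesis
  proof (rule that[OF K(1)])
    fix p q :: "real ^ 'n" assume p: "p \<in> cball 0 1" and q: "q \<in> hyp_space"
    define X where "X = (\<lambda>k. (1 - 1 / (real k + 2)) *\<^sub>R p)"
    have X: "X k \<in> hyp_space" "X \<longlonglongrightarrow> p" for k
      using radial_approx[OF p] by (auto simp: X_def)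
    have "Cauchy (\<lambda>k. g (X k))"
    proof (rule metric_CauchyI)
      fix e :: real assume e: "e > 0"
      have "Cauchy X" using X(2) by (rule LIMSEQ_imp_Cauchy)
      then obtain N where N: "\<And>m n. m \<ge> N \<Longrightarrow> n \<ge> N \<Longrightarrow> dist (X m) (X n) < e / (K + 1)"
        using e K(1) metric_CauchyD[of X "e / (K + 1)"] by (metis divide_pos_pos add_nonneg_pos zero_less_one)
      have "dist (g (X m)) (g (X n)) < e" if "m \<ge> N" "n \<ge> N" for m n
      proof -
        have "dist (g (X m)) (g (X n)) \<le> K * dist (X m) (X n)" using K(2)[OF X(1) X(1)] by (simp add: dist_norm)
        also have "\<dots> \<le> (K + 1) * dist (X m) (X n)" by (intro mult_right_mono) auto
        also have "\<dots> < (K + 1) * (e / (K + 1))" using N[OF that] K(1) by (intro mult_strict_left_mono) auto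
        finally show ?thesis using K(1) by simp
      qed
      thus "\<exists>M. \<forall>m\<ge>M. \<forall>n\<ge>M. dist (g (X m)) (g (X n)) < e" by blast
    qed
    hence "(\<lambda>k. g (X k)) \<longlonglongrightarrow> bext g p"
      using p by (simp add: Cauchy_convergent_iff convergent_LIMSEQ_iff bext_def X_def)
    hence "(\<lambda>k. norm (g q - g (X k))) \<longlonglongrightarrow> norm (g q - bext g p)" by (intro tendsto_intros)
    moreover have "(\<lambda>k. K * norm (q - X k)) \<longlonglongrightarrow> K * norm (q - p)" using X(2) by (intro tendsto_intros)
    ultimately show "norm (g q - bext g p) \<le> K * norm (q - p)"
      using K(2)[OF q X(1)] by (intro LIMSEQ_le) auto
  qed
qed

lemma bext_tendsto:
  assumes g: "g \<in> carrier hyp_isom" and X: "\<And>i. X i \<in> hyp_space" "(X \<longlongrightarrow> p) F" and p: "p \<in> cball 0 1"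
  shows "((\<lambda>i. g (X i)) \<longlongrightarrow> bext g p) F"
proof -
  obtain K where K: "K \<ge> 0" "\<And>p q. p \<in> cball 0 1 \<Longrightarrow> q \<in> hyp_space \<Longrightarrow> norm (g q - bext g p) \<le> K * norm (q - p)"
    using bext_lipschitz[OF g] by blast
  have "((\<lambda>i. X i - p) \<longlongrightarrow> 0) F" by (rule LIM_zero[OF X(2)])
  hence "((\<lambda>i. K * norm (X i - p)) \<longlongrightarrow> 0) F"
    by (intro tendsto_mult_right_zero tendsto_norm_zero)
  hence "((\<lambda>i. g (X i) - bext g p) \<longlongrightarrow> 0) F"
    by (rule Lim_null_comparison[rotated]) (use K(2)[OF p X(1)] in auto)
  thus ?thesis by (rule LIM_zero_cancel)
qed

lemma hyp_space_subset_cball: "p \<in> hyp_space \<Longrightarrow> p \<in> cball 0 1"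
  by (simp add: hyp_space_def)

lemma bext_hyp_space:
  assumes g: "g \<in> carrier hyp_isom" and p: "p \<in> hyp_space"
  shows "bext g p = g p"
  using LIMSEQ_unique[OF tendsto_const bext_tendsto[OF g, of "\<lambda>_. p" p]] p hyp_space_subset_cball[OF p]
  by simp

lemma bext_cball:
  assumes g: "g \<in> carrier hyp_isom" and p: "p \<in> cball 0 1"
  shows "bext g p \<in> cball 0 1"
proof (rule closed_sequentially[OF closed_cball])
  show "(\<lambda>k. g ((1 - 1 / (real k + 2)) *\<^sub>R p)) \<longlonglongrightarrow> bext g p"
    by (intro bext_tendsto g radial_approx p)
  show "\<And>k. g ((1 - 1 / (real k + 2)) *\<^sub>R p) \<in> cball 0 1"
    using hyp_isom_closed[OF g radial_approx(1)[OF p]] hyp_space_subset_cball by blast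
qed

lemma bext_outside: "p \<notin> cball 0 1 \<Longrightarrow> bext g p = p"
  by (simp add: bext_def)

lemma bext_mult:
  assumes g: "g \<in> carrier hyp_isom" and h: "h \<in> carrier hyp_isom"
  shows "bext (g \<otimes>\<^bsub>hyp_isom\<^esub> h) p = bext g (bext h p)"
proof (cases "p \<in> cball 0 1")
  case True
  interpret group hyp_isom by (rule group_hyp_isom)
  define X where "X = (\<lambda>k. (1 - 1 / (real k + 2)) *\<^sub>R p)"
  have X: "X k \<in> hyp_space" "X \<longlonglongrightarrow> p" for k
    using radial_approx[OF True] by (auto simp: X_def)
  have "(\<lambda>k. (g \<otimes>\<^bsub>hyp_isom\<^esub> h) (X k)) \<longlonglongrightarrow> bext (g \<otimes>\<^bsub>hyp_isom\<^esub> h) p"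
    by (intro bext_tendsto X True) (use g h in auto)
  moreover have "(\<lambda>k. g (h (X k))) \<longlonglongrightarrow> bext g (bext h p)"
    by (rule bext_tendsto[OF g hyp_isom_closed[OF h X(1)] bext_tendsto[OF h X True] bext_cball[OF h True]])
  ultimately show ?thesis
    using LIMSEQ_unique by (simp add: hyp_isom_mult_apply[OF g h X(1)])
qed (simp add: bext_outside)

lemma bext_one: "bext \<one>\<^bsub>hyp_isom\<^esub> p = p"
proof (cases "p \<in> cball 0 1")
  case True
  interpret group hyp_isom by (rule group_hyp_isom)
  show ?thesis
    using LIMSEQ_unique[OF bext_tendsto[OF one_closed radial_approx[OF True] True, unfolded
      hyp_isom_one_apply[OF radial_approx(1)[OF True]]] radial_approx(2)[OF True]] .
qed (simp add: bext_outside)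

lemma bext_inv:
  assumes g: "g \<in> carrier hyp_isom"
  shows "bext (inv\<^bsub>hyp_isom\<^esub> g) (bext g p) = p" "bext g (bext (inv\<^bsub>hyp_isom\<^esub> g) p) = p"
proof -
  interpret group hyp_isom by (rule group_hyp_isom)
  show "bext (inv\<^bsub>hyp_isom\<^esub> g) (bext g p) = p" "bext g (bext (inv\<^bsub>hyp_isom\<^esub> g) p) = p"
    using g by (simp_all add: bext_mult[symmetric] bext_one)
qed

lemma bext_hyp_space_iff:
  assumes g: "g \<in> carrier hyp_isom"
  shows "bext g p \<in> hyp_space \<longleftrightarrow> p \<in> hyp_space"
proof -
  interpret group hyp_isom by (rule group_hyp_isom)
  have i: "inv\<^bsub>hyp_isom\<^esub> g \<in> carrier hyp_isom" using g by simp
  show ?thesis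
  proof
    assume "bext g p \<in> hyp_space"
    from hyp_isom_closed[OF i this] show "p \<in> hyp_space"
      unfolding bext_hyp_space[OF i \<open>bext g p \<in> hyp_space\<close>, symmetric] bext_inv(1)[OF g] .
  qed (simp add: bext_hyp_space[OF g] hyp_isom_closed[OF g])
qed

lemma bext_cball_iff:
  assumes g: "g \<in> carrier hyp_isom"
  shows "bext g p \<in> cball 0 1 \<longleftrightarrow> p \<in> cball 0 1"
  using bext_cball[OF g, of p] bext_outside[of p g] by (cases "p \<in> cball 0 1") simp_all

lemma hyp_boundary_iff: "p \<in> hyp_boundary \<longleftrightarrow> p \<in> cball 0 1 \<and> p \<notin> hyp_space"
  by (auto simp: hyp_boundary_def hyp_space_def)

lemma bext_hyp_boundary_iff:
  assumes g: "g \<in> carrier hyp_isom"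
  shows "bext g p \<in> hyp_boundary \<longleftrightarrow> p \<in> hyp_boundary"
  unfolding hyp_boundary_iff bext_hyp_space_iff[OF g] bext_cball_iff[OF g] ..

text \<open>The form in which the extension is used: an isometry moves the limit of a sequence by its extension.\<close>

lemma bext_tendsto_iff:
  assumes g: "g \<in> carrier hyp_isom" and X: "\<And>i. X i \<in> hyp_space" and p: "p \<in> cball 0 1"
  shows "((\<lambda>i. g (X i)) \<longlongrightarrow> bext g p) F \<longleftrightarrow> (X \<longlongrightarrow> p) F"
proof
  interpret group hyp_isom by (rule group_hyp_isom)
  assume "((\<lambda>i. g (X i)) \<longlongrightarrow> bext g p) F"
  hence "((\<lambda>i. (inv\<^bsub>hyp_isom\<^esub> g) (g (X i))) \<longlongrightarrow> bext (inv\<^bsub>hyp_isom\<^esub> g) (bext g p)) F"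
    by (rule bext_tendsto[rotated 2]) (use g X p hyp_isom_closed[OF g] bext_cball[OF g p] in \<open>auto simp del:
      mem_cball_0\<close>)
  thus "(X \<longlongrightarrow> p) F" using hyp_isom_inv_apply(1)[OF g X] by (simp add: bext_inv[OF g])
qed (intro bext_tendsto g X p)

text \<open>A substitute for the distance from \<open>a\<close> to \<open>p\<close> that still makes sense for \<open>p\<close> on the boundary. Inside
  the ball it is \<open>(cosh d(a,p) - 1) / 2\<close> times the factor \<open>1 - |p|\<^sup>2\<close>, which does not depend on \<open>a\<close>,
  so comparing two values for the same \<open>p\<close> compares distances.\<close>

definition hnear :: "real ^ 'n \<Rightarrow> real ^ 'n \<Rightarrow> real" where
  "hnear a p = (norm (p - a))\<^sup>2 / (1 - (norm a)\<^sup>2)"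

lemma hnear_cosh:
  assumes "a \<in> hyp_space" "p \<in> hyp_space"
  shows "2 * hnear a p = (cosh (hdist a p) - 1) * (1 - (norm p)\<^sup>2)"
  using norm_diff_hdist[OF assms] hyp_spaceD[OF assms(1)]
  by (simp add: hnear_def norm_minus_commute field_simps)

text \<open>Ratios of \<open>hnear\<close> are ratios of functions of distances, hence invariant inside the ball; the boundary
  case follows by continuity. The products avoid division by zero.\<close>

lemma hnear_isom:
  assumes g: "g \<in> carrier hyp_isom" and a: "a \<in> hyp_space" and b: "b \<in> hyp_space" and p: "p \<in> cball 0 1"
  shows "hnear (g a) (bext g p) * hnear b p = hnear a p * hnear (g b) (bext g p)"
proof -
  define X where "X = (\<lambda>k. (1 - 1 / (real k + 2)) *\<^sub>R p)"
  have X: "X k \<in> hyp_space" "X \<longlonglongrightarrow> p" for k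
    using radial_approx[OF p] by (auto simp: X_def)
  have gX: "(\<lambda>k. g (X k)) \<longlonglongrightarrow> bext g p" by (intro bext_tendsto g X p)
  have eq: "hnear (g a) (g (X k)) * hnear b (X k) = hnear a (X k) * hnear (g b) (g (X k))" for k
  proof -
    note c = hnear_cosh[OF hyp_isom_closed[OF g a] hyp_isom_closed[OF g X(1)]]
      hnear_cosh[OF hyp_isom_closed[OF g b] hyp_isom_closed[OF g X(1)]]
      hnear_cosh[OF a X(1)] hnear_cosh[OF b X(1)]
    have "(2 * hnear (g a) (g (X k))) * (2 * hnear b (X k)) = (2 * hnear a (X k)) * (2 * hnear (g b) (g (X k)))"
      unfolding c hdist_isom[OF g a X(1)] hdist_isom[OF g b X(1)] by (simp add: mult_ac)
    thus ?thesis by simp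
  qed
  have lim: "(\<lambda>k. hnear c (Y k)) \<longlonglongrightarrow> hnear c y" if "Y \<longlonglongrightarrow> y" "c \<in> hyp_space" for c y :: "real ^ 'n" and Y
    unfolding hnear_def using that hyp_spaceD[OF that(2)] by (intro tendsto_intros) auto
  have "(\<lambda>k. hnear (g a) (g (X k)) * hnear b (X k)) \<longlonglongrightarrow> hnear (g a) (bext g p) * hnear b p"
    by (rule tendsto_mult[OF lim[OF gX hyp_isom_closed[OF g a]] lim[OF X(2) b]])
  moreover have "(\<lambda>k. hnear a (X k) * hnear (g b) (g (X k))) \<longlonglongrightarrow> hnear a p * hnear (g b) (bext g p)"
    by (rule tendsto_mult[OF lim[OF X(2) a] lim[OF gX hyp_isom_closed[OF g b]]])
  ultimately show ?thesis unfolding eq by (rule LIMSEQ_unique)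
qed

lemma hnear_nonneg: "a \<in> hyp_space \<Longrightarrow> hnear a p \<ge> 0"
  using hyp_spaceD[of a] by (simp add: hnear_def)

text \<open>The strict hypothesis makes \<open>hnear b p\<close> positive, so that \<open>hnear_isom\<close> determines the ratio on the
  other side.\<close>

lemma hnear_isom_le:
  assumes g: "g \<in> carrier hyp_isom" and a: "a \<in> hyp_space" and b: "b \<in> hyp_space" and p: "p \<in> cball 0 1"
    and less: "hnear a p < hnear b p"
  shows "hnear (g a) (bext g p) \<le> hnear (g b) (bext g p)"
proof (rule ccontr)
  assume "\<not> ?thesis"
  hence "hnear (g b) (bext g p) < hnear (g a) (bext g p)" by simp
  with less have "hnear a p * hnear (g b) (bext g p) < hnear b p * hnear (g a) (bext g p)"
    using hnear_nonneg[OF a] hnear_nonneg[OF hyp_isom_closed[OF g b]]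
    by (intro mult_strict_mono) (auto intro: le_less_trans)
  with hnear_isom[OF g a b p] show False by (simp add: mult.commute)
qed

section \<open>Geodesic rays\<close>

text \<open>Lightlike vectors represent boundary points.\<close>

abbreviation null_vec :: "real ^ 'n \<Rightarrow> real \<times> (real ^ 'n)" where
  "null_vec \<xi> \<equiv> (1, \<xi>)"

text \<open>The exponential of the Busemann function of \<open>\<xi>\<close>.\<close>

abbreviation horo :: "real ^ 'n \<Rightarrow> real ^ 'n \<Rightarrow> real" where
  "horo \<xi> p \<equiv> mink (hlift p) (null_vec \<xi>)"

lemma horo_pos:
  assumes "p \<in> hyp_space" "norm \<xi> = 1" shows "horo \<xi> p > 0"
proof -
  have "horo \<xi> p = (norm (p - \<xi>))\<^sup>2 / (1 - (norm p)\<^sup>2)"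
    using hyp_spaceD[OF assms(1)] assms(2)
    by (simp add: mink_def hlift_def norm_diff_square diff_divide_distrib add_divide_distrib)
  moreover have "p \<noteq> \<xi>" using assms by (auto simp: hyp_space_iff)
  ultimately show ?thesis using hyp_spaceD[OF assms(1)] by simp
qed

lemma mink_null: "norm \<xi> = 1 \<Longrightarrow> mink (null_vec \<xi>) (null_vec \<xi>) = 0"
  by (simp add: mink_def dot_square_norm)

lemma mink_combination:
  "mink (a *\<^sub>R U + b *\<^sub>R V) (c *\<^sub>R U' + d *\<^sub>R V')
     = a * c * mink U U' + a * d * mink U V' + b * c * mink V U' + b * d * mink V V'"
  by (simp add: mink_simps algebra_simps)

text \<open>Near the boundary the lift of a point, divided by its time coordinate, approaches a lightlike vector.\<close>

lemma mink_ratio_tendsto: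
  assumes X: "\<And>i. X i \<in> hyp_space" "(X \<longlongrightarrow> \<xi>) F" and "norm \<xi> = 1"
  shows "((\<lambda>i. mink (hlift (X i)) w / fst (hlift (X i))) \<longlongrightarrow> mink (null_vec \<xi>) w) F"
proof -
  have "mink (hlift p) w / fst (hlift p) = fst w - (2 / (1 + (norm p)\<^sup>2)) * (p \<bullet> snd w)"
    if "p \<in> hyp_space" for p
  proof -
    define N where "N = (norm p)\<^sup>2"
    have N: "1 + N > 0" "1 - N > 0" using hyp_spaceD[OF that] by (auto simp: N_def add_pos_nonneg)
    have "mink (hlift p) w = ((1 + N) * fst w - 2 * (p \<bullet> snd w)) / (1 - N)"
      by (simp add: mink_def hlift_def N_def diff_divide_distrib)
    moreover have "fst (hlift p) = (1 + N) / (1 - N)" by (simp add: hlift_def N_def)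
    ultimately have "mink (hlift p) w / fst (hlift p) = ((1 + N) * fst w - 2 * (p \<bullet> snd w)) / (1 + N)"
      using N by simp
    thus ?thesis using N by (simp add: N_def[symmetric] diff_divide_distrib)
  qed
  hence eq: "(\<lambda>i. mink (hlift (X i)) w / fst (hlift (X i))) = (\<lambda>i. fst w - (2 / (1
    + (norm (X i))\<^sup>2)) * (X i \<bullet> snd w))"
    using X(1) by blast
  have "((\<lambda>i. fst w - (2 / (1 + (norm (X i))\<^sup>2)) * (X i \<bullet> snd w)) \<longlongrightarrow> fst w - (2 / (1
    + (norm \<xi>)\<^sup>2)) * (\<xi> \<bullet> snd w)) F"
    using X(2) assms(3) by (intro tendsto_intros) auto
  thus ?thesis unfolding eq using assms(3) by (simp add: mink_def)
qed

lemma unit_speedD: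
  assumes "unit_speed_geodesic_on I \<gamma>"
  shows "s \<in> I \<Longrightarrow> \<gamma> s \<in> hyp_space" "s \<in> I \<Longrightarrow> t \<in> I \<Longrightarrow> hdist (\<gamma> s) (\<gamma> t) = \<bar>s - t\<bar>"
  using assms by (auto simp: unit_speed_geodesic_on_def)

lemma unit_speed_hdist_0:
  assumes "unit_speed_geodesic_on I \<gamma>" "0 \<in> I" "s \<in> I"
  shows "hdist 0 (\<gamma> s) \<ge> \<bar>s\<bar> - hdist 0 (\<gamma> 0)"
  using hdist_triangle[of "\<gamma> 0" 0 "\<gamma> s"] unit_speedD[OF assms(1)] assms
  by (simp add: hdist_commute[of _ 0])

lemma geodesic_limit_boundary:
  assumes "unit_speed_geodesic_on I \<gamma>" "{0..} \<subseteq> I" "(\<lambda>k. \<gamma> (real k)) \<longlonglongrightarrow> \<xi>"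
  shows "norm \<xi> = 1"
proof (rule tendsto_hyp_boundary[OF _ _ assms(3)])
  have I: "real k \<in> I" "0 \<in> I" for k using assms(2) by auto
  show "\<gamma> (real k) \<in> hyp_space" for k using unit_speedD[OF assms(1)] I by auto
  have "filterlim (\<lambda>k. real k - hdist 0 (\<gamma> 0)) at_top sequentially"
    by real_asymp
  thus "filterlim (\<lambda>k. hdist 0 (\<gamma> (real k))) at_top sequentially"
    by (rule filterlim_at_top_mono) (use unit_speed_hdist_0[OF assms(1) I(2) I(1)] in \<open>auto intro!:
      always_eventually\<close>)
qed simp

text \<open>Along a ray to \<open>\<xi>\<close> the lift of \<open>\<gamma> k\<close>, rescaled by its time coordinate, tends to the lightlike vector
  of \<open>\<xi>\<close>. Pairing with the lift of \<open>\<gamma> r\<close> gives \<open>cosh (k - r)\<close> over the time coordinate, and the ratio of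
  these quantities for \<open>r\<close> and for \<open>0\<close> tends to \<open>exp (- r)\<close>.\<close>

lemma horo_geodesic:
  assumes g: "unit_speed_geodesic_on I \<gamma>" "{0..} \<subseteq> I" and l: "(\<lambda>k. \<gamma> (real k)) \<longlonglongrightarrow> \<xi>" and r: "r \<in> I"
  shows "horo \<xi> (\<gamma> r) = exp (- r) * horo \<xi> (\<gamma> 0)"
    and "(\<lambda>k. exp (real k) / fst (hlift (\<gamma> (real k)))) \<longlonglongrightarrow> 2 * horo \<xi> (\<gamma> 0)"
proof -
  have I: "real k \<in> I" "0 \<in> I" for k using g(2) by auto
  note gi = unit_speedD[OF g(1)]
  have n: "norm \<xi> = 1" by (rule geodesic_limit_boundary[OF g l])
  define T where "T k = fst (hlift (\<gamma> (real k)))" for k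
  have T: "T k > 0" for k unfolding T_def by (intro fst_hlift_pos gi I)
  have lim: "(\<lambda>k. cosh (s - real k) / T k) \<longlonglongrightarrow> horo \<xi> (\<gamma> s)" if s: "s \<in> I" for s
  proof -
    have "(\<lambda>k. mink (hlift (\<gamma> (real k))) (hlift (\<gamma> s)) / T k) \<longlonglongrightarrow> mink (null_vec \<xi>) (hlift (\<gamma> s))"
      unfolding T_def by (rule mink_ratio_tendsto[OF gi(1)[OF I(1)] l n])
    moreover have "mink (hlift (\<gamma> (real k))) (hlift (\<gamma> s)) = cosh (s - real k)" for k
      using cosh_hdist[OF gi(1)[OF I(1)] gi(1)[OF s], of k] gi(2)[OF I(1) s, of k] cosh_real_abs[of
        "real k - s"]
      by (simp add: abs_minus_commute)
    ultimately show ?thesis by (simp add: mink_commute)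
  qed
  note l0 = lim[OF I(2)] 
  have "(\<lambda>k. cosh (r - real k) / cosh (0 - real k) * (cosh (0 - real k) / T k)) \<longlonglongrightarrow> exp (- r) * horo \<xi> (\<gamma> 0)"
  proof (rule tendsto_mult[OF _ l0])
    show "(\<lambda>k. cosh (r - real k) / cosh (0 - real k)) \<longlonglongrightarrow> exp (- r)"
      unfolding cosh_field_def by (real_asymp simp: exp_minus inverse_eq_divide)
  qed
  hence "(\<lambda>k. cosh (r - real k) / T k) \<longlonglongrightarrow> exp (- r) * horo \<xi> (\<gamma> 0)" by simp
  from LIMSEQ_unique[OF lim[OF r] this] show "horo \<xi> (\<gamma> r) = exp (- r) * horo \<xi> (\<gamma> 0)" .
  have "(\<lambda>k. exp (real k) / cosh (0 - real k) * (cosh (0 - real k) / T k)) \<longlonglongrightarrow> 2 * horo \<xi> (\<gamma> 0)"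
  proof (rule tendsto_mult[OF _ l0])
    show "(\<lambda>k. exp (real k) / cosh (0 - real k)) \<longlonglongrightarrow> 2"
      unfolding cosh_field_def by real_asymp
  qed
  thus "(\<lambda>k. exp (real k) / fst (hlift (\<gamma> (real k)))) \<longlonglongrightarrow> 2 * horo \<xi> (\<gamma> 0)"
    by (simp add: T_def)
qed

text \<open>The unit-speed ray from \<open>y\<close> to \<open>\<xi>\<close> in the hyperboloid: \<open>cosh r Y + sinh r (L / a - Y)\<close>, where \<open>Y\<close> is the
  lift of \<open>y\<close>, \<open>L\<close> the lightlike vector of \<open>\<xi>\<close> and \<open>a\<close> their product; \<open>L / a - Y\<close> is the unit tangent
  vector at \<open>y\<close> that points to \<open>\<xi>\<close>.\<close>

definition ray_vec :: "real ^ 'n \<Rightarrow> real \<Rightarrow> real ^ 'n \<Rightarrow> real \<times> (real ^ 'n)" where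
  "ray_vec y r \<xi> = exp (- r) *\<^sub>R hlift y + (sinh r / horo \<xi> y) *\<^sub>R null_vec \<xi>"

lemma mink_ray_vec:
  assumes y: "y \<in> hyp_space" and n: "norm \<xi> = 1"
  shows "mink (ray_vec y r \<xi>) (ray_vec y s \<xi>) = cosh (r - s)"
proof -
  have a: "horo \<xi> y \<noteq> 0" using horo_pos[OF y n] by simp
  have "mink (ray_vec y r \<xi>) (ray_vec y s \<xi>) = exp (- r) * exp (- s) + exp (- r) * sinh s + exp (- s) * sinh r"
    using a unfolding ray_vec_def mink_combination mink_hlift_self[OF y] mink_null[OF n] mink_commute[of
      "null_vec \<xi>" "hlift y"]
    by simp
  also have "\<dots> = cosh (r - s)"
    by (simp add: cosh_field_def sinh_field_def exp_diff exp_minus field_simps)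
  finally show ?thesis .
qed

lemma fst_ray_vec: "fst (ray_vec y r \<xi>) = exp (- r) * fst (hlift y) + sinh r / horo \<xi> y"
  by (simp add: ray_vec_def)

lemma hlift_ray_vec:
  assumes y: "y \<in> hyp_space" and n: "norm \<xi> = 1" and r: "r \<ge> 0"
  shows "hproj (ray_vec y r \<xi>) \<in> hyp_space" "hlift (hproj (ray_vec y r \<xi>)) = ray_vec y r \<xi>"
proof -
  have "fst (ray_vec y r \<xi>) > 0"
    unfolding fst_ray_vec using fst_hlift_pos[OF y] horo_pos[OF y n] r by (intro add_pos_nonneg) auto
  moreover have "mink (ray_vec y r \<xi>) (ray_vec y r \<xi>) = 1" using mink_ray_vec[OF y n] by simp
  ultimately show "hproj (ray_vec y r \<xi>) \<in> hyp_space" "hlift (hproj (ray_vec y r \<xi>)) = ray_vec y r \<xi>"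
    using hlift_hproj by blast+
qed

lemma ray_vec_geodesic:
  assumes y: "y \<in> hyp_space" and n: "norm \<xi> = 1"
  shows "geodesic_ray_to y \<xi> (\<lambda>r. hproj (ray_vec y r \<xi>))"
  unfolding geodesic_ray_to_def
proof (intro conjI)
  show "unit_speed_geodesic_on {0..} (\<lambda>r. hproj (ray_vec y r \<xi>))"
    unfolding unit_speed_geodesic_on_def
    using hlift_ray_vec[OF y n] mink_ray_vec[OF y n] by (auto intro!: hdist_eqI)
  show "hproj (ray_vec y 0 \<xi>) = y" by (simp add: ray_vec_def hproj_hlift[OF y] zero_prod_def[symmetric])
  have a: "horo \<xi> y > 0" by (rule horo_pos[OF y n])
  \<comment> \<open>Both components of \<open>ray_vec\<close>, scaled by \<open>exp (-r)\<close> so that they converge.\<close>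
  define f where "f r = (exp (-r) * exp (-r)) * fst (hlift y) + exp (-r) * sinh r / horo \<xi> y" for r
  define g where "g r = (exp (-r) * exp (-r)) *\<^sub>R snd (hlift y) + (exp (-r) * sinh r / horo \<xi> y) *\<^sub>R \<xi>" for r
  have e: "((\<lambda>r. exp (-r) * exp (-r)) \<longlongrightarrow> 0) (at_top :: real filter)"
    "((\<lambda>r. exp (-r)) \<longlongrightarrow> 0) (at_top :: real filter)"
    "((\<lambda>r. exp (-r) * sinh r) \<longlongrightarrow> 1/2) (at_top :: real filter)"
    unfolding sinh_field_def by real_asymp+
  have f: "(f \<longlongrightarrow> 0 * fst (hlift y) + (1/2) / horo \<xi> y) at_top"
    unfolding f_def using a by (intro tendsto_intros e) auto
  have g: "(g \<longlongrightarrow> 0 *\<^sub>R snd (hlift y) + ((1/2) / horo \<xi> y) *\<^sub>R \<xi>) at_top"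
    unfolding g_def using a by (intro tendsto_intros e) auto
  have "((\<lambda>r. (1 / (exp (-r) + f r)) *\<^sub>R g r) \<longlongrightarrow> (1 / (0 + (0 * fst (hlift y)
    + (1/2) / horo \<xi> y))) *\<^sub>R (0 *\<^sub>R snd (hlift y) + ((1/2) / horo \<xi> y) *\<^sub>R \<xi>)) at_top"
    using a by (intro tendsto_intros e f g) auto
  hence l: "((\<lambda>r. (1 / (exp (-r) + f r)) *\<^sub>R g r) \<longlongrightarrow> \<xi>) at_top" using a by simp
  have "(1 / (exp (-r) + f r)) *\<^sub>R g r = hproj (ray_vec y r \<xi>)" for r
  proof -
    have f': "f r = exp (-r) * fst (ray_vec y r \<xi>)" and g': "g r = exp (-r) *\<^sub>R snd (ray_vec y r \<xi>)"
      by (simp_all add: f_def g_def ray_vec_def algebra_simps)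
    have "exp (-r) + f r = exp (-r) * (1 + fst (ray_vec y r \<xi>))" unfolding f' by (simp add: algebra_simps)
    thus ?thesis unfolding hproj_def g' by simp
  qed
  thus "((\<lambda>r. hproj (ray_vec y r \<xi>)) \<longlongrightarrow> \<xi>) at_top" using l by simp
qed

text \<open>The distance to \<open>y\<close> and the Busemann function determine the products of the lift of \<open>\<gamma> r\<close> with the
  lift of \<open>y\<close> and the lightlike vector of \<open>\<xi>\<close>, hence its product with \<open>ray_vec\<close>. That product is \<open>1\<close>, so the distance between the two points is \<open>0\<close>.\<close>

lemma geodesic_ray_unique:
  assumes y: "y \<in> hyp_space" and c: "geodesic_ray_to y \<xi> \<gamma>" and r: "r \<ge> 0"
  shows "\<gamma> r = hproj (ray_vec y r \<xi>)"
proof -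
  have g: "unit_speed_geodesic_on {0..} \<gamma>" and y0: "\<gamma> 0 = y" and l: "(\<gamma> \<longlongrightarrow> \<xi>) at_top"
    using c by (auto simp: geodesic_ray_to_def)
  have l': "(\<lambda>k. \<gamma> (real k)) \<longlonglongrightarrow> \<xi>" by (rule filterlim_compose[OF l filterlim_real_sequentially])
  have n: "norm \<xi> = 1" by (rule geodesic_limit_boundary[OF g _ l']) simp
  note gi = unit_speedD[OF g]
  have h: "horo \<xi> (\<gamma> r) = exp (- r) * horo \<xi> y"
    using horo_geodesic(1)[OF g _ l', of r] r y0 by simp
  have "mink (hlift (\<gamma> r)) (hlift y) = cosh r"
    using cosh_hdist[OF gi(1) y, of r] gi(2)[of r 0] r y0 by simp
  hence "mink (hlift (\<gamma> r)) (ray_vec y r \<xi>) = exp (- r) * cosh r + sinh r * exp (- r)"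
    using h horo_pos[OF y n] by (simp add: ray_vec_def mink_simps del: scaleR_Pair)
  also have "\<dots> = exp (-r) * (cosh r + sinh r)" by (simp add: algebra_simps)
  also have "\<dots> = 1" unfolding cosh_plus_sinh by (simp add: exp_minus)
  finally have "mink (hlift (\<gamma> r)) (hlift (hproj (ray_vec y r \<xi>))) = 1"
    using hlift_ray_vec[OF y n r] by simp
  from mink_hlift_eq_1[OF _ _ this] show ?thesis using gi(1) r hlift_ray_vec[OF y n r] by auto
qed

lemma ray_point_eq:
  assumes y: "y \<in> hyp_space" and n: "norm \<xi> = 1" and r: "r \<ge> 0"
  shows "ray_point y r \<xi> = hproj (ray_vec y r \<xi>)"
  unfolding ray_point_def
  by (rule the_equality) (use ray_vec_geodesic[OF y n] geodesic_ray_unique[OF y _ r] in blast)+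

text \<open>Expand the product of the two vectors. The leading term carries the product of the two lightlike
  vectors, which is positive when the endpoints differ, so the rays separate at full speed.\<close>

lemma hdist_ray_points:
  assumes y: "y \<in> hyp_space" and n: "norm \<xi> = 1" "norm \<eta> = 1" and r: "r \<ge> 0"
  shows "cosh (hdist (ray_point y r \<xi>) (ray_point y r \<eta>)) \<ge>
           (sinh r)\<^sup>2 * ((1 - \<xi> \<bullet> \<eta>) / (horo \<xi> y * horo \<eta> y))" (is ?A)
    and "hdist (ray_point y r \<xi>) (ray_point y r \<eta>) \<le> 2 * r" (is ?B)
    and "hdist y (ray_point y r \<xi>) = r" (is ?C)
proof -
  note f = hlift_ray_vec[OF y n(1) r] hlift_ray_vec[OF y n(2) r]
  note p = ray_point_eq[OF y n(1) r] ray_point_eq[OF y n(2) r]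
  have a: "horo \<xi> y > 0" "horo \<eta> y > 0" using horo_pos[OF y] n by auto
  have "cosh (hdist (ray_point y r \<xi>) (ray_point y r \<eta>)) = mink (ray_vec y r \<xi>) (ray_vec y r \<eta>)"
    unfolding p using f by (simp add: cosh_hdist)
  also have "\<dots> = exp (-r) * exp (-r) + 2 * (exp (-r) * sinh r)
    + (sinh r)\<^sup>2 * (mink (null_vec \<xi>) (null_vec \<eta>) / (horo \<xi> y * horo \<eta> y))"
    using a unfolding ray_vec_def mink_combination mink_hlift_self[OF y] mink_commute[of "null_vec \<xi>" "hlift y"]
    by (simp add: power2_eq_square)
  also have "mink (null_vec \<xi>) (null_vec \<eta>) = 1 - \<xi> \<bullet> \<eta>" by (simp add: mink_def)
  finally have "cosh (hdist (ray_point y r \<xi>) (ray_point y r \<eta>)) = exp (-r) * exp (-r) + 2 * (exp (-r) * sinh r)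
    + (sinh r)\<^sup>2 * ((1 - \<xi> \<bullet> \<eta>) / (horo \<xi> y * horo \<eta> y))" .
  moreover have "0 \<le> exp (-r) * exp (-r) + 2 * (exp (-r) * sinh r)" using r by simp
  ultimately show ?A by linarith
  have C: "hdist y (ray_point y r \<zeta>) = r" if "norm \<zeta> = 1" for \<zeta>
  proof -
    have "unit_speed_geodesic_on {0..} (\<lambda>r. hproj (ray_vec y r \<zeta>))" "hproj (ray_vec y 0 \<zeta>) = y"
      using ray_vec_geodesic[OF y that] by (auto simp: geodesic_ray_to_def)
    from unit_speedD(2)[OF this(1), of 0 r] this(2) show ?thesis
      using r by (simp add: ray_point_eq[OF y that r])
  qed
  thus ?C using n by simp
  show ?B
    using hdist_triangle[of "ray_point y r \<xi>" y "ray_point y r \<eta>"] C[OF n(1)] C[OF n(2)] y f p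
    by (simp add: hdist_commute[of _ y])
qed

section \<open>Geodesic lines\<close>

text \<open>Two points of a ray at parameters \<open>s \<le> t\<close> have Gromov product at least \<open>s\<close> up to a constant, so their
  Euclidean distance is at most a multiple of \<open>exp (- s)\<close>.\<close>

lemma geodesic_endpoint:
  fixes \<gamma> :: "real \<Rightarrow> real ^ 'n"
  assumes g: "unit_speed_geodesic_on I \<gamma>" "{0..} \<subseteq> I"
  obtains \<xi> where "norm \<xi> = 1" "\<And>s. s \<ge> 0 \<Longrightarrow> norm (\<gamma> s - \<xi>) \<le> 4 * exp (hdist 0 (\<gamma> 0)) * exp (- s)"
    "(\<lambda>k. \<gamma> (real k)) \<longlonglongrightarrow> \<xi>"
proof -
  define D where "D = hdist 0 (\<gamma> 0)"
  have I: "s \<ge> 0 \<Longrightarrow> s \<in> I" for s using g(2) by auto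
  note gi = unit_speedD[OF g(1)]
  have est: "norm (\<gamma> s - \<gamma> t) \<le> 4 * exp D * exp (- s)" if "0 \<le> s" "s \<le> t" for s t
  proof (rule power2_le_imp_le)
    have "(norm (\<gamma> s - \<gamma> t))\<^sup>2 \<le> 16 * exp (hdist (\<gamma> s) (\<gamma> t) - hdist 0 (\<gamma> s) - hdist 0 (\<gamma> t))"
      using that by (intro norm_diff_le_hdist gi I) auto
    also have "\<dots> \<le> 16 * exp (2 * D - 2 * s)"
      using that gi(2)[of s t] I unit_speed_hdist_0[OF g(1), of s] unit_speed_hdist_0[OF g(1), of t]
        by (simp add: D_def)
    also have "\<dots> = (4 * exp D * exp (- s))\<^sup>2"
      by (simp add: power_mult_distrib exp_double[symmetric] exp_diff exp_minus field_simps)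
    finally show "(norm (\<gamma> s - \<gamma> t))\<^sup>2 \<le> (4 * exp D * exp (- s))\<^sup>2" .
  qed simp
  have l0: "(\<lambda>k. 4 * exp D * exp (- real k)) \<longlonglongrightarrow> 0" by real_asymp
  have "Cauchy (\<lambda>k. \<gamma> (real k))"
  proof (rule metric_CauchyI)
    fix e :: real assume "e > 0"
    then obtain N where N: "\<And>k. k \<ge> N \<Longrightarrow> 4 * exp D * exp (- real k) < e"
      using order_tendstoD(2)[OF l0] by (auto simp: eventually_sequentially)
    have "norm (\<gamma> (real m) - \<gamma> (real n)) < e" if "m \<ge> N" "n \<ge> N" for m n
    proof (cases "m \<le> n")
      case True
      thus ?thesis using le_less_trans[OF est[of m n] N[OF that(1)]] by simp
    next
      case False
      thus ?thesis using le_less_trans[OF est[of n m] N[OF that(2)]] by (simp add: norm_minus_commute)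
    qed
    thus "\<exists>M. \<forall>m\<ge>M. \<forall>n\<ge>M. dist (\<gamma> (real m)) (\<gamma> (real n)) < e" by (auto simp: dist_norm)
  qed
  then obtain \<xi> where l: "(\<lambda>k. \<gamma> (real k)) \<longlonglongrightarrow> \<xi>" by (auto simp: Cauchy_convergent_iff convergent_def)
  show ?thesis
  proof
    show "norm \<xi> = 1" by (rule geodesic_limit_boundary[OF g l])
    fix s :: real assume s: "s \<ge> 0"
    have "(\<lambda>k. norm (\<gamma> s - \<gamma> (real k))) \<longlonglongrightarrow> norm (\<gamma> s - \<xi>)" by (intro tendsto_intros l)
    moreover have "\<forall>\<^sub>F k in sequentially. norm (\<gamma> s - \<gamma> (real k)) \<le> 4 * exp D * exp (- s)"
      using eventually_ge_at_top[of "nat \<lceil>s\<rceil>"] by eventually_elim (use est[OF s] in auto)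
    ultimately show "norm (\<gamma> s - \<xi>) \<le> 4 * exp (hdist 0 (\<gamma> 0)) * exp (- s)"
      unfolding D_def by (rule tendsto_upperbound) simp
  qed (rule l)
qed

lemma unit_speed_reverse: "unit_speed_geodesic_on UNIV \<gamma> \<Longrightarrow> unit_speed_geodesic_on UNIV (\<lambda>t. \<gamma> (- t))"
  by (fastforce simp: unit_speed_geodesic_on_def)

text \<open>A line is determined by its endpoints and by the values of their horofunctions at one point, and the
  product of these two values is determined by the endpoints. As in the uniqueness of rays, the
  right-hand side is a unit vector whose product with the lift of \<open>\<gamma> r\<close> is \<open>1\<close>.\<close>

lemma line_hlift:
  fixes \<gamma> :: "real \<Rightarrow> real ^ 'n"
  assumes g: "unit_speed_geodesic_on UNIV \<gamma>"
    and l: "(\<lambda>k. \<gamma> (real k)) \<longlonglongrightarrow> \<xi>" "(\<lambda>k. \<gamma> (- real k)) \<longlonglongrightarrow> \<eta>"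
  shows "mink (null_vec \<xi>) (null_vec \<eta>) = 2 * horo \<xi> (\<gamma> 0) * horo \<eta> (\<gamma> 0)"
    and "hlift (\<gamma> r) = (exp r / (2 * horo \<xi> (\<gamma> 0))) *\<^sub>R null_vec \<xi>
      + (exp (-r) / (2 * horo \<eta> (\<gamma> 0))) *\<^sub>R null_vec \<eta>"
proof -
  note gi = unit_speedD[OF g]
  note g' = unit_speed_reverse[OF g]
  have n: "norm \<xi> = 1" "norm \<eta> = 1"
    using geodesic_limit_boundary[OF g _ l(1)] geodesic_limit_boundary[OF g' _ l(2)] by auto
  define a b where "a = horo \<xi> (\<gamma> 0)" and "b = horo \<eta> (\<gamma> 0)"
  have ab: "a > 0" "b > 0" unfolding a_def b_def using horo_pos gi(1) n by auto
  have ha: "horo \<xi> (\<gamma> s) = exp (- s) * a" for s using horo_geodesic(1)[OF g _ l(1), of s] by (simp add: a_def)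
  have hb: "horo \<eta> (\<gamma> s) = exp s * b" for s using horo_geodesic(1)[OF g' _ l(2), of "-s"] by (simp add: b_def)
  have "(\<lambda>k. horo \<eta> (\<gamma> (real k)) / fst (hlift (\<gamma> (real k)))) \<longlonglongrightarrow> mink (null_vec \<xi>) (null_vec \<eta>)"
    by (rule mink_ratio_tendsto[OF gi(1) l(1) n(1)]) simp
  moreover have "(\<lambda>k. b * (exp (real k) / fst (hlift (\<gamma> (real k))))) \<longlonglongrightarrow> b * (2 * a)"
    unfolding a_def by (intro tendsto_mult_left horo_geodesic(2)[OF g _ l(1), of 0]) auto
  ultimately have lam: "mink (null_vec \<xi>) (null_vec \<eta>) = 2 * a * b"
    unfolding hb using LIMSEQ_unique by (fastforce simp: mult_ac)
  thus "mink (null_vec \<xi>) (null_vec \<eta>) = 2 * horo \<xi> (\<gamma> 0) * horo \<eta> (\<gamma> 0)" by (simp add: a_def b_def)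
  define Z where "Z = (exp r / (2 * a)) *\<^sub>R null_vec \<xi> + (exp (-r) / (2 * b)) *\<^sub>R null_vec \<eta>"
  have "mink Z Z = 1"
    using ab
      unfolding Z_def mink_combination mink_null[OF n(1)] mink_null[OF n(2)] mink_commute[of "null_vec \<eta>"
        "null_vec \<xi>"] lam
    by (simp add: exp_minus)
  moreover have "fst Z > 0" using ab by (simp add: Z_def add_pos_pos)
  ultimately have Z: "hproj Z \<in> hyp_space" "hlift (hproj Z) = Z" by (auto intro: hlift_hproj)
  have "mink (hlift (\<gamma> r)) Z = 1"
    using ab by (simp add: Z_def mink_simps ha hb exp_minus field_simps del: scaleR_Pair)
  hence "\<gamma> r = hproj Z" using mink_hlift_eq_1[OF gi(1) Z(1)] Z(2) by simp
  thus "hlift (\<gamma> r) = (exp r / (2 * horo \<xi> (\<gamma> 0))) *\<^sub>R null_vec \<xi>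
    + (exp (-r) / (2 * horo \<eta> (\<gamma> 0))) *\<^sub>R null_vec \<eta>"
    using Z(2) by (simp add: Z_def a_def b_def)
qed

text \<open>If the endpoints agreed, the first part of \<open>line_hlift\<close> would make a lightlike vector have positive
  square.\<close>

lemma line_endpoints_distinct:
  assumes g: "unit_speed_geodesic_on UNIV \<gamma>"
    and l: "(\<lambda>k. \<gamma> (real k)) \<longlonglongrightarrow> \<xi>" "(\<lambda>k. \<gamma> (- real k)) \<longlonglongrightarrow> \<eta>"
  shows "\<xi> \<noteq> \<eta>"
proof
  assume eq: "\<xi> = \<eta>"
  have n: "norm \<xi> = 1" using geodesic_limit_boundary[OF g _ l(1)] by auto
  show False using line_hlift(1)[OF g l] horo_pos[OF unit_speedD(1)[OF g], of 0 \<xi>] n mink_null[OF n] eq by simp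
qed

lemma bounded_lines_endpoint:
  fixes \<gamma> \<gamma>' :: "real \<Rightarrow> real ^ 'n"
  assumes g: "unit_speed_geodesic_on UNIV \<gamma>" and g': "unit_speed_geodesic_on UNIV \<gamma>'"
    and C: "\<And>t. hdist (\<gamma> t) (\<gamma>' t) \<le> C" and l: "(\<lambda>k. \<gamma> (real k)) \<longlonglongrightarrow> \<xi>"
  shows "(\<lambda>k. \<gamma>' (real k)) \<longlonglongrightarrow> \<xi>"
proof -
  note gi = unit_speedD[OF g] and gi' = unit_speedD[OF g']
  define D where "D = C + hdist 0 (\<gamma> 0) + hdist 0 (\<gamma>' 0)"
  define B where "B = 4 * exp (D / 2)"
  have "norm (\<gamma> (real k) - \<gamma>' (real k)) \<le> B * exp (- real k)" for k
  proof (rule power2_le_imp_le)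
    have "(norm (\<gamma> (real k) - \<gamma>' (real k)))\<^sup>2
      \<le> 16 * exp (hdist (\<gamma> (real k)) (\<gamma>' (real k)) - hdist 0 (\<gamma> (real k)) - hdist 0 (\<gamma>' (real k)))"
      by (intro norm_diff_le_hdist gi gi') auto
    also have "\<dots> \<le> 16 * exp (D - 2 * real k)"
      unfolding D_def
        using C[of "real k"] unit_speed_hdist_0[OF g, of "real k"] unit_speed_hdist_0[OF g', of "real k"]
          by simp
    also have "\<dots> = (B * exp (- real k))\<^sup>2"
      by (simp add: B_def power_mult_distrib exp_double[symmetric] exp_diff exp_minus exp_add field_simps)
    finally show "(norm (\<gamma> (real k) - \<gamma>' (real k)))\<^sup>2 \<le> (B * exp (- real k))\<^sup>2" .
  qed (simp add: B_def)
  moreover have "(\<lambda>k. B * exp (- real k)) \<longlonglongrightarrow> 0" by real_asymp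
  ultimately have "(\<lambda>k. \<gamma> (real k) - \<gamma>' (real k)) \<longlonglongrightarrow> 0"
    by (intro Lim_null_comparison[of "\<lambda>k. \<gamma> (real k) - \<gamma>' (real k)"]) auto
  from tendsto_diff[OF l this] show ?thesis by simp
qed

text \<open>Lines at bounded distance have the same endpoints. By \<open>line_hlift\<close> only the ratio of the two horofunction
  values can still vary, and changing it is a change of parameter.\<close>

lemma bounded_lines_shift:
  fixes \<gamma> \<gamma>' :: "real \<Rightarrow> real ^ 'n"
  assumes g: "unit_speed_geodesic_on UNIV \<gamma>" and g': "unit_speed_geodesic_on UNIV \<gamma>'"
    and C: "\<And>t. hdist (\<gamma> t) (\<gamma>' t) \<le> C"
  obtains c where "\<And>t. \<gamma>' t = \<gamma> (t + c)"
proof -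
  note r = unit_speed_reverse[OF g] and r' = unit_speed_reverse[OF g']
  note gi = unit_speedD[OF g] and gi' = unit_speedD[OF g']
  obtain \<xi> where n: "norm \<xi> = 1" and l: "(\<lambda>k. \<gamma> (real k)) \<longlonglongrightarrow> \<xi>" using geodesic_endpoint[OF g] by auto
  obtain \<eta> where m: "norm \<eta> = 1" and k: "(\<lambda>k. \<gamma> (- real k)) \<longlonglongrightarrow> \<eta>" using geodesic_endpoint[OF r] by auto
  have l': "(\<lambda>k. \<gamma>' (real k)) \<longlonglongrightarrow> \<xi>" by (rule bounded_lines_endpoint[OF g g' C l])
  have k': "(\<lambda>k. \<gamma>' (- real k)) \<longlonglongrightarrow> \<eta>" by (rule bounded_lines_endpoint[OF r r' C k])
  define a b a' b' where ab_def: "a = horo \<xi> (\<gamma> 0)" "b = horo \<eta> (\<gamma> 0)" "a' = horo \<xi> (\<gamma>' 0)" "b' = horo \<eta> (\<gamma>' 0)"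
  have pos: "a > 0" "b > 0" "a' > 0" "b' > 0" unfolding ab_def using horo_pos gi(1) gi'(1) n m by auto
  have e: "a * b = a' * b'" using line_hlift(1)[OF g l k] line_hlift(1)[OF g' l' k'] by (simp add: ab_def)
  \<comment> \<open>Shifting the parameter by \<open>c\<close> divides the horofunction of \<open>\<xi>\<close> by \<open>exp c\<close>.\<close>
  define c where "c = ln (a / a')"
  have c: "exp c = a / a'" using pos by (simp add: c_def)
  have "\<gamma>' t = \<gamma> (t + c)" for t
  proof -
    have 1: "exp (t + c) / (2 * a) = exp t / (2 * a')" using pos by (simp add: exp_add c field_simps)
    have "exp (- (t + c)) = exp (- t) * inverse (exp c)" by (simp add: exp_minus[symmetric] exp_add[symmetric])
    hence "exp (- (t + c)) / (2 * b) = exp (- t) * (a' / a) / (2 * b)" by (simp add: c)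
    also have "\<dots> = exp (- t) * (a' / (2 * (a * b)))" by simp
    also have "\<dots> = exp (- t) / (2 * b')" using pos unfolding e by simp
    finally have "hlift (\<gamma> (t + c)) = hlift (\<gamma>' t)"
      using line_hlift(2)[OF g l k, of "t + c"] line_hlift(2)[OF g' l' k', of t] 1 by (simp add: ab_def)
    thus ?thesis using hproj_hlift[OF gi(1)] hproj_hlift[OF gi'(1)] by (metis UNIV_I)
  qed
  thus ?thesis using that by blast
qed

section \<open>Isometries that translate a line\<close>

text \<open>The translation length may have either sign or vanish, so that the relation is stable under reversing
  the line, inverses and powers.\<close>

definition translates :: "(real ^ 'n \<Rightarrow> real ^ 'n) \<Rightarrow> (real \<Rightarrow> real ^ 'n) \<Rightarrow> real \<Rightarrow> bool" where
  "translates h \<gamma> \<sigma> \<longleftrightarrow> unit_speed_geodesic_on UNIV \<gamma> \<and> (\<forall>t. h (\<gamma> t) = \<gamma> (t + \<sigma>))"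

lemma translatesD:
  assumes "translates h \<gamma> \<sigma>"
  shows "unit_speed_geodesic_on UNIV \<gamma>" "h (\<gamma> t) = \<gamma> (t + \<sigma>)" "\<gamma> t \<in> hyp_space" "hdist (\<gamma> s) (\<gamma> t) = \<bar>s - t\<bar>"
  using assms by (auto simp: translates_def unit_speed_geodesic_on_def)

lemma translates_reverse:
  assumes "translates h \<gamma> \<sigma>" shows "translates h (\<lambda>t. \<gamma> (- t)) (- \<sigma>)"
  using assms unit_speed_reverse by (auto simp: translates_def)

lemma range_reverse: "range (\<lambda>t. \<gamma> (- t :: real)) = range \<gamma>"
  by (metis (no_types) fun.set_map surj_uminus image_image)

lemma translates_inv:
  assumes h: "h \<in> carrier hyp_isom" and t: "translates h \<gamma> \<sigma>"
  shows "translates (inv\<^bsub>hyp_isom\<^esub> h) \<gamma> (- \<sigma>)"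
proof -
  have "(inv\<^bsub>hyp_isom\<^esub> h) (\<gamma> t) = \<gamma> (t - \<sigma>)" for t
    using hyp_isom_inv_apply(1)[OF h translatesD(3)[OF t], of "t - \<sigma>"] translatesD(2)[OF t, of "t - \<sigma>"] by simp
  thus ?thesis using translatesD(1)[OF t] by (simp add: translates_def)
qed

lemma translates_pow:
  assumes h: "h \<in> carrier hyp_isom" and t: "translates h \<gamma> \<sigma>"
  shows "translates (h [^]\<^bsub>hyp_isom\<^esub> (n::nat)) \<gamma> (real n * \<sigma>)"
proof -
  interpret group hyp_isom by (rule group_hyp_isom)
  have "(h [^]\<^bsub>hyp_isom\<^esub> n) (\<gamma> s) = \<gamma> (s + real n * \<sigma>)" for s
  proof (induction n arbitrary: s)
    case 0
    show ?case using hyp_isom_one_apply[OF translatesD(3)[OF t]] by simp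
  next
    case (Suc n)
    have "(h [^]\<^bsub>hyp_isom\<^esub> Suc n) (\<gamma> s) = (h [^]\<^bsub>hyp_isom\<^esub> n) (h (\<gamma> s))"
      using hyp_isom_mult_apply[OF nat_pow_closed[OF h] h translatesD(3)[OF t]] by simp
    also have "\<dots> = \<gamma> (s + \<sigma> + real n * \<sigma>)" unfolding translatesD(2)[OF t] by (rule Suc)
    finally show ?case by (simp add: algebra_simps)
  qed
  thus ?thesis using translatesD(1)[OF t] by (simp add: translates_def)
qed

lemma translates_iterate:
  assumes h: "h \<in> carrier hyp_isom" and t: "translates h \<gamma> \<sigma>" and t': "translates h \<gamma>' \<sigma>'"
  shows "hdist (\<gamma> (s + real n * \<sigma>)) (\<gamma>' (s' + real n * \<sigma>')) = hdist (\<gamma> s) (\<gamma>' s')"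
proof -
  interpret group hyp_isom by (rule group_hyp_isom)
  have "h [^]\<^bsub>hyp_isom\<^esub> n \<in> carrier hyp_isom" using h by simp
  from hdist_isom[OF this translatesD(3)[OF t] translatesD(3)[OF t'], of s s']
  show ?thesis unfolding translatesD(2)[OF translates_pow[OF h t]] translatesD(2)[OF translates_pow[OF h t']] .
qed

text \<open>After \<open>n\<close> steps the two base points have moved by \<open>n |\<sigma>|\<close> and \<open>n |\<sigma>'|\<close>, but their distance is unchanged.\<close>

lemma translation_length_le:
  assumes h: "h \<in> carrier hyp_isom" and t: "translates h \<gamma> \<sigma>" and t': "translates h \<gamma>' \<sigma>'"
  shows "\<bar>\<sigma>\<bar> \<le> \<bar>\<sigma>'\<bar>"
proof (rule ccontr)
  assume "\<not> ?thesis"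
  hence less: "\<bar>\<sigma>\<bar> - \<bar>\<sigma>'\<bar> > 0" by simp
  define C where "C = hdist (\<gamma> 0) (\<gamma>' 0)"
  have le: "real n * (\<bar>\<sigma>\<bar> - \<bar>\<sigma>'\<bar>) \<le> 2 * C" for n
  proof -
    note m = translatesD(3)[OF t] translatesD(3)[OF t']
    have "real n * \<bar>\<sigma>\<bar> = hdist (\<gamma> 0) (\<gamma> (0 + real n * \<sigma>))" by (simp add: translatesD(4)[OF t] abs_mult)
    also have "\<dots> \<le> hdist (\<gamma> 0) (\<gamma>' 0) + (hdist (\<gamma>' 0) (\<gamma>' (0 + real n * \<sigma>')) + hdist (\<gamma>' (0
      + real n * \<sigma>')) (\<gamma> (0 + real n * \<sigma>)))"
      using hdist_triangle[OF m(1)[of 0] m(2)[of 0] m(1)[of "0 + real n * \<sigma>"]]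
        hdist_triangle[OF m(2)[of 0] m(2)[of "0 + real n * \<sigma>'"] m(1)[of "0 + real n * \<sigma>"]] by linarith
    also have "hdist (\<gamma>' 0) (\<gamma>' (0 + real n * \<sigma>')) = real n * \<bar>\<sigma>'\<bar>"
      by (simp add: translatesD(4)[OF t'] abs_mult)
    also have "hdist (\<gamma>' (0 + real n * \<sigma>')) (\<gamma> (0 + real n * \<sigma>)) = C"
      using translates_iterate[OF h t t', of 0 n 0] by (simp add: C_def hdist_commute)
    finally show ?thesis by (simp add: C_def algebra_simps)
  qed
  obtain n :: nat where "2 * C / (\<bar>\<sigma>\<bar> - \<bar>\<sigma>'\<bar>) < real n" using reals_Archimedean2 by blast
  hence "2 * C < real n * (\<bar>\<sigma>\<bar> - \<bar>\<sigma>'\<bar>)" using less by (simp add: pos_divide_less_eq)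
  with le[of n] show False by simp
qed

text \<open>The distance between \<open>\<gamma> s\<close> and \<open>\<gamma>' s\<close> is periodic in \<open>s\<close>, hence bounded.\<close>

lemma same_translation_shift:
  fixes \<gamma> \<gamma>' :: "real \<Rightarrow> real ^ 'n"
  assumes h: "h \<in> carrier hyp_isom" and t: "translates h \<gamma> \<sigma>" and t': "translates h \<gamma>' \<sigma>" and \<sigma>: "\<sigma> > 0"
  obtains c where "\<And>t. \<gamma>' t = \<gamma> (t + c)"
proof -
  note m = translatesD(3)[OF t] translatesD(3)[OF t']
  define F where "F s = hdist (\<gamma> s) (\<gamma>' s)" for s
  have per: "F (s + real n * \<sigma>) = F s" for s n using translates_iterate[OF h t t', of s n s]
    by (simp add: F_def)
  have near: "F s \<le> 2 * \<sigma> + F 0" if "0 \<le> s" "s \<le> \<sigma>" for s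
  proof -
    have "F s \<le> hdist (\<gamma> s) (\<gamma> 0) + (hdist (\<gamma> 0) (\<gamma>' 0) + hdist (\<gamma>' 0) (\<gamma>' s))"
      using hdist_triangle[OF m(1)[of s] m(1)[of 0] m(2)[of s]] hdist_triangle[OF m(1)[of 0] m(2)[of 0] m(2)[of
        s]]
      by (simp add: F_def)
    thus ?thesis using that by (simp add: translatesD(4)[OF t] translatesD(4)[OF t'] F_def)
  qed
  have "F s \<le> 2 * \<sigma> + F 0" for s
  proof -
    define k where "k = \<lfloor>s / \<sigma>\<rfloor>"
    have k: "of_int k * \<sigma> \<le> s" "s < (of_int k + 1) * \<sigma>"
      using floor_divide_lower[OF \<sigma>, of s] floor_divide_upper[OF \<sigma>, of s] by (auto simp: k_def)
    have "F s = F (s - of_int k * \<sigma>)"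
    proof (cases "k \<ge> 0")
      case True
      thus ?thesis using per[of "s - of_int k * \<sigma>" "nat k"] by simp
    next
      case False
      thus ?thesis using per[of s "nat (- k)"] by simp
    qed
    also have "\<dots> \<le> 2 * \<sigma> + F 0" using k by (intro near) (auto simp: algebra_simps)
    finally show ?thesis .
  qed
  thus ?thesis
    using bounded_lines_shift[OF translatesD(1)[OF t] translatesD(1)[OF t'], of "2 * \<sigma> + F 0"] that
    unfolding F_def by blast
qed

lemma range_shift: "(\<And>t. \<gamma>' t = \<gamma> (t + c :: real)) \<Longrightarrow> range \<gamma>' = range \<gamma>"
  by (auto simp: image_iff) (metis diff_add_cancel)

lemma translates_positive:
  assumes "translates h \<gamma> \<sigma>" "\<sigma> \<noteq> 0"
  obtains \<beta> where "translates h \<beta> \<bar>\<sigma>\<bar>" "range \<beta> = range \<gamma>"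
proof (cases "\<sigma> > 0")
  case True
  thus ?thesis using assms that by auto
next
  case False
  hence "\<bar>\<sigma>\<bar> = - \<sigma>" by simp
  thus ?thesis using that[of "\<lambda>t. \<gamma> (- t)"] translates_reverse[OF assms(1)] by (simp add: range_reverse)
qed

lemma translated_line_unique:
  assumes h: "h \<in> carrier hyp_isom" and t: "translates h \<gamma> \<sigma>" "\<sigma> \<noteq> 0" and t': "translates h \<gamma>' \<sigma>'" "\<sigma>' \<noteq> 0"
  shows "range \<gamma> = range \<gamma>'"
proof -
  obtain \<beta> where b: "translates h \<beta> \<bar>\<sigma>\<bar>" "range \<beta> = range \<gamma>" using translates_positive[OF t] .
  obtain \<beta>' where b': "translates h \<beta>' \<bar>\<sigma>'\<bar>" "range \<beta>' = range \<gamma>'" using translates_positive[OF t'] .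
  have "\<bar>\<sigma>\<bar> = \<bar>\<sigma>'\<bar>" using translation_length_le[OF h b(1) b'(1)] translation_length_le[OF h b'(1) b(1)] by simp
  hence "translates h \<beta>' \<bar>\<sigma>\<bar>" using b'(1) by simp
  then obtain c where "\<And>t. \<beta>' t = \<beta> (t + c)"
    using same_translation_shift[OF h b(1)] t(2) by (metis zero_less_abs_iff)
  from range_shift[of \<beta>' \<beta>, OF this] show ?thesis using b b' by simp
qed

text \<open>The axis is defined by a definite description; uniqueness of translated lines makes it meaningful.\<close>

lemma lox_axis_eq:
  assumes h: "h \<in> carrier hyp_isom" and t: "translates h \<gamma> \<sigma>" "\<sigma> \<noteq> 0"
  shows "lox_axis h = range \<gamma>"
  unfolding lox_axis_def
proof (rule the_equality)
  obtain \<beta> where b: "translates h \<beta> \<bar>\<sigma>\<bar>" "range \<beta> = range \<gamma>" using translates_positive[OF t] .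
  show "translates_along h (range \<gamma>)"
    unfolding translates_along_def using b t by (intro exI[of _ \<beta>] exI[of _ "\<bar>\<sigma>\<bar>"]) (auto simp: translates_def)
next
  fix A assume "translates_along h A"
  then obtain \<beta> \<tau> where b: "unit_speed_geodesic_on UNIV \<beta>" "A = range \<beta>" "\<tau> > 0" "\<forall>t. h (\<beta> t) = \<beta> (t + \<tau>)"
    unfolding translates_along_def by blast
  hence "translates h \<beta> \<tau>" by (simp add: translates_def)
  from translated_line_unique[OF h this _ t] b show "A = range \<gamma>" by auto
qed

lemma loxodromicE:
  assumes "loxodromic h"
  obtains \<gamma> \<tau> where "h \<in> carrier hyp_isom" "translates h \<gamma> \<tau>" "\<tau> > 0" "lox_axis h = range \<gamma>"
proof -
  obtain \<gamma> \<tau> where g: "h \<in> carrier hyp_isom" "translates h \<gamma> \<tau>" "\<tau> > 0"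
    using assms unfolding loxodromic_def translates_along_def translates_def by blast
  with lox_axis_eq[OF g(1,2)] that show ?thesis by auto
qed

section \<open>Discrete groups of isometries\<close>

lemma hdist_small_norm:
  assumes "p \<in> hyp_space" "q \<in> hyp_space" "e > 0" "hdist p q < arcosh (1 + 2 * e\<^sup>2)"
  shows "norm (p - q) < e"
proof -
  have "cosh (hdist p q) < cosh (arcosh (1 + 2 * e\<^sup>2))"
    using assms hdist_nonneg[OF assms(1,2)] by (subst cosh_real_nonneg_less_iff) auto
  hence c: "(cosh (hdist p q) - 1) / 2 < e\<^sup>2" by simp
  have s: "0 < 1 - (norm p)\<^sup>2" "0 < 1 - (norm q)\<^sup>2" using assms(1,2)[THEN hyp_spaceD] by auto
  have "(norm (p - q))\<^sup>2 \<le> (cosh (hdist p q) - 1) / 2 * (1 * 1)"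
    unfolding norm_diff_hdist[OF assms(1,2)] using s
      by (intro mult_left_mono mult_mono) (auto simp: cosh_real_ge_1)
  with c have "(norm (p - q))\<^sup>2 < e\<^sup>2" by simp
  thus ?thesis using assms(3) by (simp add: power_less_imp_less_base)
qed

text \<open>In the topology of pointwise convergence an isolated identity is separated from the rest of the group
  by its values at finitely many points.\<close>

lemma discrete_identity_isolated:
  fixes \<Gamma> :: "(real ^ 'n \<Rightarrow> real ^ 'n) set"
  assumes G: "subgroup \<Gamma> hyp_isom" and d: "subtopology hyp_isom_topology \<Gamma> = discrete_topology \<Gamma>"
  obtains J \<epsilon> where "finite J" "J \<subseteq> hyp_space" "\<epsilon> > 0"
    "\<And>g. g \<in> \<Gamma> \<Longrightarrow> (\<And>z. z \<in> J \<Longrightarrow> hdist z (g z) < \<epsilon>) \<Longrightarrow> g = \<one>\<^bsub>hyp_isom\<^esub>"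
proof -
  let ?e = "\<one>\<^bsub>hyp_isom\<^esub> :: real ^ 'n \<Rightarrow> real ^ 'n"
  have Gc: "\<Gamma> \<subseteq> carrier hyp_isom" and e: "?e \<in> \<Gamma>" using G by (auto simp: subgroup_def)
  have "openin (subtopology hyp_isom_topology \<Gamma>) {?e}" unfolding d using e by simp
  then obtain V where V: "openin (product_topology (\<lambda>_. euclidean) hyp_space) V"
    "{?e} = V \<inter> carrier hyp_isom \<inter> \<Gamma>"
    unfolding hyp_isom_topology_def openin_subtopology by blast
  have eV: "?e \<in> V" using V(2) by blast
  have "\<exists>W. finite {i \<in> hyp_space. W i \<noteq> topspace (euclidean :: (real ^ 'n) topology)} \<and>
      (\<forall>i \<in> hyp_space. openin euclidean (W i)) \<and> ?e \<in> PiE hyp_space W \<and> PiE hyp_space W \<subseteq> V"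
    by (rule bspec[OF V(1)[unfolded openin_product_topology_alt] eV])
  then obtain W where W: "finite {i \<in> hyp_space. W i \<noteq> topspace (euclidean :: (real ^ 'n) topology)}"
      "\<And>i. i \<in> hyp_space \<Longrightarrow> openin euclidean (W i)" "?e \<in> PiE hyp_space W" "PiE hyp_space W \<subseteq> V"
    by auto
  define J where "J = {i \<in> hyp_space. W i \<noteq> UNIV}"
  have J: "finite J" "J \<subseteq> hyp_space" using W(1) by (auto simp: J_def)
  have "\<exists>e>0. ball z e \<subseteq> W z" if "z \<in> J" for z
  proof -
    have "z \<in> hyp_space" using that J by blast
    hence "open (W z)" "z \<in> W z" using W(2)[of z] W(3) hyp_isom_one_apply[of z] by (auto simp: PiE_iff)
    thus ?thesis using open_contains_ball by blast
  qed
  then obtain r where r: "\<And>z. z \<in> J \<Longrightarrow> r z > 0" "\<And>z. z \<in> J \<Longrightarrow> ball z (r z) \<subseteq> W z" by metis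
  define e where "e = Min (insert 1 (r ` J))"
  have e0: "e > 0" unfolding e_def using J r(1) by (subst Min_gr_iff) auto
  have er: "e \<le> r z" if "z \<in> J" for z unfolding e_def using that J by (intro Min_le) auto
  show ?thesis
  proof (rule that[OF J])
    show "arcosh (1 + 2 * e\<^sup>2) > 0" using e0 by simp
    fix g assume g: "g \<in> \<Gamma>" and small: "\<And>z. z \<in> J \<Longrightarrow> hdist z (g z) < arcosh (1 + 2 * e\<^sup>2)"
    have gc: "g \<in> carrier hyp_isom" using g Gc by blast
    have "g z \<in> W z" if z: "z \<in> hyp_space" for z
    proof (cases "z \<in> J")
      case True
      have "norm (z - g z) < e" by (rule hdist_small_norm[OF z hyp_isom_closed[OF gc z] e0 small[OF True]])
      thus ?thesis using er[OF True] r(2)[OF True] by (auto simp: dist_norm subset_iff)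
    qed (use z in \<open>auto simp: J_def\<close>)
    moreover have "g \<in> extensional hyp_space" using gc by (simp add: hyp_isom_simps Bij_def)
    ultimately have "g \<in> PiE hyp_space W" unfolding PiE_iff by blast
    hence "g \<in> V" using W(4) by blast
    thus "g = ?e" using V(2) gc g by blast
  qed
qed

lemma uniform_hdist_small:
  assumes "\<epsilon> > 0"
  obtains \<eta> where "\<eta> > 0" "\<And>p q. p \<in> hyp_space \<Longrightarrow> q \<in> hyp_space \<Longrightarrow> hdist 0 p \<le> R \<Longrightarrow> hdist 0 q \<le> R
      \<Longrightarrow> norm (p - q) < \<eta> \<Longrightarrow> hdist p q < \<epsilon>"
proof -
  have c: "cosh \<epsilon> > 1" using assms cosh_real_nonneg_less_iff[of 0 \<epsilon>] by simp
  define \<eta> where "\<eta> = sqrt ((cosh \<epsilon> - 1) / 2 * exp (- 2 * R))"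
  have \<eta>: "\<eta> > 0" using c by (simp add: \<eta>_def)
  show ?thesis
  proof (rule that[OF \<eta>])
    fix p q :: "real ^ 'a" assume p: "p \<in> hyp_space" "q \<in> hyp_space" and R: "hdist 0 p \<le> R" "hdist 0 q \<le> R"
      and n: "norm (p - q) < \<eta>"
    show "hdist p q < \<epsilon>"
    proof (rule ccontr)
      assume "\<not> ?thesis"
      hence "cosh \<epsilon> \<le> cosh (hdist p q)" using assms by (subst cosh_real_nonneg_le_iff) auto
      hence "(cosh \<epsilon> - 1) / 2 * exp (- 2 * R) \<le> (cosh (hdist p q) - 1) / 2 * exp (- hdist 0 p - hdist 0 q)"
        using c R by (intro mult_mono) auto
      also have "\<dots> \<le> (norm (p - q))\<^sup>2" by (rule norm_diff_ge_hdist[OF p])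
      also have "\<dots> < \<eta>\<^sup>2" using n by (intro power_strict_mono) auto
      also have "\<dots> = (cosh \<epsilon> - 1) / 2 * exp (- 2 * R)" using c by (simp add: \<eta>_def)
      finally show False by simp
    qed
  qed
qed

text \<open>Bounded subsets of hyperbolic space are totally bounded, so the pigeonhole principle applies.\<close>

lemma infinite_close_subset:
  fixes F :: "'b \<Rightarrow> real ^ 'n"
  assumes A: "infinite A" and F: "\<And>g. g \<in> A \<Longrightarrow> F g \<in> hyp_space" "\<And>g. g \<in> A \<Longrightarrow> hdist 0 (F g) \<le> R" and "\<epsilon> > 0"
  obtains B where "B \<subseteq> A" "infinite B" "\<And>g h. g \<in> B \<Longrightarrow> h \<in> B \<Longrightarrow> hdist (F g) (F h) < \<epsilon>"
proof -
  obtain \<eta> where \<eta>: "\<eta> > 0" "\<And>p q :: real ^ 'n. p \<in> hyp_space \<Longrightarrow> q \<in> hyp_space \<Longrightarrow> hdist 0 p \<le> R \<Longrightarrow> hdist 0 q \<le> R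
      \<Longrightarrow> norm (p - q) < \<eta> \<Longrightarrow> hdist p q < \<epsilon>"
    using uniform_hdist_small[OF \<open>\<epsilon> > 0\<close>] by blast
  obtain K where K: "finite K" "cball (0 :: real ^ 'n) 1 \<subseteq> (\<Union>c\<in>K. ball c (\<eta> / 2))"
    using \<eta>(1) compact_cball[of "0 :: real ^ 'n" 1] unfolding compact_eq_totally_bounded by (metis half_gt_zero)
  have "\<forall>g\<in>A. \<exists>c\<in>K. dist c (F g) < \<eta> / 2"
    using K(2) hyp_space_subset_cball[OF F(1)] by fastforce
  from pigeonhole_infinite_rel[OF A K(1) this]
  obtain c where c: "infinite {g \<in> A. dist c (F g) < \<eta> / 2}" by blast
  show ?thesis
  proof (rule that[OF _ c])
    fix g h assume "g \<in> {g \<in> A. dist c (F g) < \<eta> / 2}" "h \<in> {g \<in> A. dist c (F g) < \<eta> / 2}"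
    thus "hdist (F g) (F h) < \<epsilon>"
      using F dist_triangle_half_r[of c "F g" \<eta> "F h"] by (intro \<eta>(2)) (auto simp: dist_norm)
  qed auto
qed

text \<open>Infinitely many elements of bounded displacement at \<open>x\<close> have bounded displacement everywhere, so two of
  them, \<open>g\<close> and \<open>h\<close>, nearly agree at the finitely many test points of \<open>discrete_identity_isolated\<close>.
  Then \<open>h\<^sup>-\<^sup>1 g\<close> nearly fixes these points and must be the identity.\<close>

lemma discrete_finite_displacement:
  fixes \<Gamma> :: "(real ^ 'n \<Rightarrow> real ^ 'n) set"
  assumes G: "subgroup \<Gamma> hyp_isom" and d: "subtopology hyp_isom_topology \<Gamma> = discrete_topology \<Gamma>"
    and x: "x \<in> hyp_space"
  shows "finite {g \<in> \<Gamma>. hdist x (g x) \<le> R}"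
proof (rule ccontr)
  assume inf: "infinite {g \<in> \<Gamma>. hdist x (g x) \<le> R}"
  interpret group "hyp_isom :: (real ^ 'n \<Rightarrow> real ^ 'n) monoid" by (rule group_hyp_isom)
  interpret S: subgroup \<Gamma> hyp_isom by (rule G)
  obtain J \<epsilon> where J: "finite J" "J \<subseteq> hyp_space" "\<epsilon> > 0"
    "\<And>g. g \<in> \<Gamma> \<Longrightarrow> (\<And>z. z \<in> J \<Longrightarrow> hdist z (g z) < \<epsilon>) \<Longrightarrow> g = \<one>\<^bsub>hyp_isom\<^esub>"
    using discrete_identity_isolated[OF G d] by blast
  define A where "A = {g \<in> \<Gamma>. hdist x (g x) \<le> R}"
  have Ac: "g \<in> carrier hyp_isom" if "g \<in> A" for g using that S.subset by (auto simp: A_def)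
  have "\<exists>B\<subseteq>A. infinite B \<and> (\<forall>g\<in>B. \<forall>h\<in>B. \<forall>z\<in>J. hdist (g z) (h z) < \<epsilon>)"
    using J(1,2)
  proof (induction J rule: finite_induct)
    case empty
    show ?case using inf by (auto simp: A_def)
  next
    case (insert z J)
    then obtain B where B: "B \<subseteq> A" "infinite B" "\<And>g h w. g \<in> B \<Longrightarrow> h \<in> B \<Longrightarrow> w \<in> J \<Longrightarrow> hdist (g w) (h w) < \<epsilon>" by auto
    have z: "z \<in> hyp_space" using insert by auto
    have bd: "hdist 0 (g z) \<le> hdist 0 x + R + hdist x z" if "g \<in> B" for g
    proof -
      have g: "g \<in> carrier hyp_isom" "hdist x (g x) \<le> R" using that B Ac by (auto simp: A_def)
      note m = hyp_isom_closed[OF g(1) z] hyp_isom_closed[OF g(1) x]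
      show ?thesis
        using hdist_triangle[OF zero_in_hyp_space x m(1)] hdist_triangle[OF x m(2) m(1)] g(2) hdist_isom[OF g(1)
          x z] by linarith
    qed
    obtain B' where B': "B' \<subseteq> B" "infinite B'" "\<And>g h. g \<in> B' \<Longrightarrow> h \<in> B' \<Longrightarrow> hdist (g z) (h z) < \<epsilon>"
    proof (rule infinite_close_subset[OF B(2), of "\<lambda>g. g z" "hdist 0 x + R + hdist x z" \<epsilon>])
      show "g z \<in> hyp_space" if "g \<in> B" for g using that B(1) Ac hyp_isom_closed z by blast
    qed (use bd J in auto)
    have "hdist (g w) (h w) < \<epsilon>" if "g \<in> B'" "h \<in> B'" "w \<in> insert z J" for g h w
      using that B'(3)[OF that(1,2)] B(3)[of g h w] B'(1) by blast
    with B B' show ?case by (intro exI[of _ B']) blast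
  qed
  then obtain B where B: "B \<subseteq> A" "infinite B" "\<And>g h z. g \<in> B \<Longrightarrow> h \<in> B \<Longrightarrow> z \<in> J \<Longrightarrow> hdist (g z) (h z) < \<epsilon>" by blast
  have "B \<noteq> {}" using B(2) by (metis finite.emptyI)
  then obtain g where g: "g \<in> B" by blast
  have "infinite (B - {g})" using B(2) by simp
  hence "B - {g} \<noteq> {}" by (metis finite.emptyI)
  then obtain h where h: "h \<in> B" "h \<noteq> g" by blast
  have c: "g \<in> carrier hyp_isom" "h \<in> carrier hyp_isom" "g \<in> \<Gamma>" "h \<in> \<Gamma>" using g h B(1) Ac by (auto simp: A_def)
  have "inv\<^bsub>hyp_isom\<^esub> h \<otimes>\<^bsub>hyp_isom\<^esub> g = \<one>\<^bsub>hyp_isom\<^esub>"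
  proof (rule J(4))
    show "inv\<^bsub>hyp_isom\<^esub> h \<otimes>\<^bsub>hyp_isom\<^esub> g \<in> \<Gamma>" using c by simp
    fix z assume z: "z \<in> J"
    hence zh: "z \<in> hyp_space" using J by auto
    have "hdist z ((inv\<^bsub>hyp_isom\<^esub> h \<otimes>\<^bsub>hyp_isom\<^esub> g) z)
      = hdist ((inv\<^bsub>hyp_isom\<^esub> h) (h z)) ((inv\<^bsub>hyp_isom\<^esub> h) (g z))"
      using c hyp_isom_mult_apply[OF inv_closed[OF c(2)] c(1) zh] hyp_isom_inv_apply(1)[OF c(2) zh] by simp
    also have "\<dots> = hdist (h z) (g z)"
      using hdist_isom[OF inv_closed[OF c(2)] hyp_isom_closed[OF c(2) zh] hyp_isom_closed[OF c(1) zh]] .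
    also have "\<dots> < \<epsilon>" using B(3)[OF h(1) g z] .
    finally show "hdist z ((inv\<^bsub>hyp_isom\<^esub> h \<otimes>\<^bsub>hyp_isom\<^esub> g) z) < \<epsilon>" .
  qed
  hence "g = h" using c by (metis inv_equality inv_inv inv_closed)
  with h show False by simp
qed

lemma asymptotic_lines_bounded:
  fixes \<gamma> \<gamma>' :: "real \<Rightarrow> real ^ 'n"
  assumes g: "unit_speed_geodesic_on UNIV \<gamma>" "unit_speed_geodesic_on UNIV \<gamma>'"
    and l: "(\<lambda>k. \<gamma> (real k)) \<longlonglongrightarrow> \<xi>" "(\<lambda>k. \<gamma>' (real k)) \<longlonglongrightarrow> \<xi>"
  obtains B where "\<And>t. t \<ge> 0 \<Longrightarrow> hdist (\<gamma> t) (\<gamma>' t) \<le> B"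
proof -
  obtain C C' where C: "\<And>t. t \<ge> 0 \<Longrightarrow> norm (\<gamma> t - \<xi>) \<le> C * exp (- t)"
    "\<And>t. t \<ge> 0 \<Longrightarrow> norm (\<gamma>' t - \<xi>) \<le> C' * exp (- t)"
    using geodesic_endpoint[OF g(1)] geodesic_endpoint[OF g(2)] LIMSEQ_unique[OF l(1)] LIMSEQ_unique[OF l(2)]
    by (metis subset_UNIV)
  define D where "D = hdist 0 (\<gamma> 0) + hdist 0 (\<gamma>' 0)"
  define M where "M = 2 + 4 * (C + C')\<^sup>2 * exp D"
  have M: "M > 0" by (simp add: M_def add_pos_nonneg)
  have "hdist (\<gamma> t) (\<gamma>' t) \<le> ln M" if t: "t \<ge> 0" for t
  proof -
    note m = unit_speedD(1)[OF g(1) UNIV_I, of t] unit_speedD(1)[OF g(2) UNIV_I, of t]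
      unit_speedD(1)[OF g(1) UNIV_I, of 0] unit_speedD(1)[OF g(2) UNIV_I, of 0]
    have "norm (\<gamma> t - \<gamma>' t) \<le> norm (\<gamma> t - \<xi>) + norm (\<gamma>' t - \<xi>)"
      using norm_triangle_ineq4[of "\<gamma> t - \<xi>" "\<gamma>' t - \<xi>"] by simp
    also have "\<dots> \<le> (C + C') * exp (- t)" using C(1)[OF t] C(2)[OF t] by (simp add: algebra_simps)
    finally have n: "(norm (\<gamma> t - \<gamma>' t))\<^sup>2 \<le> ((C + C') * exp (- t))\<^sup>2" by (intro power_mono) auto
    have d: "hdist 0 (\<gamma> t) + hdist 0 (\<gamma>' t) \<le> D + 2 * t"
      using hdist_triangle[OF zero_in_hyp_space m(3) m(1)] hdist_triangle[OF zero_in_hyp_space m(4) m(2)]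
        unit_speedD(2)[OF g(1), of 0 t] unit_speedD(2)[OF g(2), of 0 t] t by (simp add: D_def)
    have "exp (hdist (\<gamma> t) (\<gamma>' t)) \<le> 2 + 4 * (norm (\<gamma> t - \<gamma>' t))\<^sup>2 * exp (hdist 0 (\<gamma> t) + hdist 0 (\<gamma>' t))"
      by (rule exp_hdist_le[OF m(1,2)])
    also have "\<dots> \<le> 2 + 4 * ((C + C') * exp (- t))\<^sup>2 * exp (D + 2 * t)"
      using n d by (intro add_left_mono mult_mono) auto
    also have "\<dots> = M"
    proof -
      have "(exp (- t))\<^sup>2 * exp (D + 2 * t) = exp D" by (simp add: exp_double[symmetric] exp_add[symmetric])
      thus ?thesis by (simp add: M_def power_mult_distrib mult.assoc)
    qed
    finally show ?thesis using M by (simp add: ln_ge_iff)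
  qed
  thus ?thesis using that by blast
qed

text \<open>The point \<open>g\<^sup>k (\<gamma> 0)\<close> runs to the common endpoint along \<open>\<gamma>\<close>, where \<open>\<gamma>\<close> stays close to \<open>\<gamma>'\<close> and \<open>h\<close>
  therefore moves points by a bounded amount. Hence the conjugates \<open>g\<^sup>-\<^sup>k h g\<^sup>k\<close> move \<open>\<gamma> 0\<close> by a bounded amount, and by
  discreteness two of them coincide. Then \<open>h\<close> commutes with a power of \<open>g\<close>, so it preserves the axis of
  that power, which is \<open>\<gamma>\<close>, and translates along it.\<close>

lemma common_endpoint_common_axis:
  fixes \<Gamma> :: "(real ^ 'n \<Rightarrow> real ^ 'n) set"
  assumes G: "subgroup \<Gamma> hyp_isom" and fin: "\<And>x R. x \<in> hyp_space \<Longrightarrow> finite {g \<in> \<Gamma>. hdist x (g x) \<le> R}"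
    and g: "g \<in> \<Gamma>" "translates g \<gamma> \<tau>" "\<tau> > 0" and h: "h \<in> \<Gamma>" "translates h \<gamma>' \<sigma>" "\<sigma> \<noteq> 0"
    and l: "(\<lambda>k. \<gamma> (real k)) \<longlonglongrightarrow> \<xi>" "(\<lambda>k. \<gamma>' (real k)) \<longlonglongrightarrow> \<xi>"
  shows "range \<gamma> = range \<gamma>'"
proof -
  interpret group "hyp_isom :: (real ^ 'n \<Rightarrow> real ^ 'n) monoid" by (rule group_hyp_isom)
  interpret S: subgroup \<Gamma> hyp_isom by (rule G)
  have gc: "g \<in> carrier hyp_isom" and hc: "h \<in> carrier hyp_isom" using g h S.subset by auto
  obtain B where B: "\<And>t. t \<ge> 0 \<Longrightarrow> hdist (\<gamma> t) (\<gamma>' t) \<le> B"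
    using asymptotic_lines_bounded[OF translatesD(1)[OF g(2)] translatesD(1)[OF h(2)] l] by blast
  note m = translatesD(3)[OF g(2)] and m' = translatesD(3)[OF h(2)]
  have disp: "hdist (\<gamma> t) (h (\<gamma> t)) \<le> 2 * B + \<bar>\<sigma>\<bar>" if "t \<ge> 0" for t
  proof -
    have "hdist (\<gamma> t) (h (\<gamma> t)) \<le> hdist (\<gamma> t) (\<gamma>' t) + (hdist (\<gamma>' t) (h (\<gamma>' t)) + hdist (h (\<gamma>' t)) (h (\<gamma> t)))"
      using hdist_triangle[OF m m' hyp_isom_closed[OF hc m], of t t t]
        hdist_triangle[OF m' hyp_isom_closed[OF hc m'] hyp_isom_closed[OF hc m], of t t t] by linarith
    also have "hdist (h (\<gamma>' t)) (h (\<gamma> t)) = hdist (\<gamma> t) (\<gamma>' t)" using hdist_isom[OF hc m' m]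
      by (simp add: hdist_commute)
    also have "hdist (\<gamma>' t) (h (\<gamma>' t)) = \<bar>\<sigma>\<bar>" by (simp add: translatesD(2,4)[OF h(2)])
    finally show ?thesis using B[OF that] by simp
  qed
  have pc: "g [^]\<^bsub>hyp_isom\<^esub> k \<in> carrier hyp_isom" for k :: nat using gc by simp
  have pG: "g [^]\<^bsub>hyp_isom\<^esub> k \<in> \<Gamma>" for k :: nat by (induction k) (use g in auto)
  note tp = translates_pow[OF gc g(2)]
  note ti = translates_inv[OF pc tp]
  define f where "f k = inv\<^bsub>hyp_isom\<^esub> (g [^]\<^bsub>hyp_isom\<^esub> k) \<otimes>\<^bsub>hyp_isom\<^esub> (h \<otimes>\<^bsub>hyp_isom\<^esub> g [^]\<^bsub>hyp_isom\<^esub> k)" for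
    k :: nat
  have f_apply: "f k z = (inv\<^bsub>hyp_isom\<^esub> (g [^]\<^bsub>hyp_isom\<^esub> k)) (h ((g [^]\<^bsub>hyp_isom\<^esub> k) z))"
    if "z \<in> hyp_space" for k z
    unfolding f_def
      using hyp_isom_mult_apply[OF inv_closed[OF pc] m_closed[OF hc pc] that] hyp_isom_mult_apply[OF hc pc that]
        by simp
  have "f k \<in> {g \<in> \<Gamma>. hdist (\<gamma> 0) (g (\<gamma> 0)) \<le> 2 * B + \<bar>\<sigma>\<bar>}" for k
  proof -
    have "f k \<in> \<Gamma>" unfolding f_def using pG h by simp
    moreover have "hdist (\<gamma> 0) (f k (\<gamma> 0))
      = hdist ((inv\<^bsub>hyp_isom\<^esub> (g [^]\<^bsub>hyp_isom\<^esub> k)) (\<gamma> (real k * \<tau>))) ((inv\<^bsub>hyp_isom\<^esub> (g [^]\<^bsub>hyp_isom\<^esub> k)) (h (\<gamma>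
        (real k * \<tau>))))"
      by (simp add: f_apply[OF m] translatesD(2)[OF tp] translatesD(2)[OF ti])
    moreover have "\<dots> = hdist (\<gamma> (real k * \<tau>)) (h (\<gamma> (real k * \<tau>)))"
      by (rule hdist_isom[OF inv_closed[OF pc] m hyp_isom_closed[OF hc m]])
    ultimately show ?thesis using disp[of "real k * \<tau>"] g(3) by simp
  qed
  hence "range f \<subseteq> {g \<in> \<Gamma>. hdist (\<gamma> 0) (g (\<gamma> 0)) \<le> 2 * B + \<bar>\<sigma>\<bar>}" by (rule image_subsetI)
  hence "finite (range f)" by (rule finite_subset[OF _ fin[OF m[of 0]]])
  hence "\<not> inj f" using finite_imageD[of f UNIV] infinite_UNIV_nat by blast
  then obtain i j where "f i = f j" "i \<noteq> j" by (auto simp: inj_def)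
  then obtain k n where kn: "f k = f n" "k < n" by (metis linorder_neqE_nat)
  \<comment> \<open>\<open>h\<close> will be seen to commute with \<open>g\<^sup>q\<close> on \<open>\<gamma>\<close>.\<close>
  define q where "q = n - k"
  have q: "n = q + k" "q > 0" using kn by (auto simp: q_def)
  let ?p = "\<lambda>k. g [^]\<^bsub>hyp_isom\<^esub> (k :: nat)"
  have comm: "?p q (h (\<gamma> t)) = h (\<gamma> (t + real q * \<tau>))" for t
  proof -
    define z where "z = \<gamma> (t - real k * \<tau>)"
    have z: "z \<in> hyp_space" "?p k z = \<gamma> t" "?p n z = \<gamma> (t + real q * \<tau>)"
      unfolding z_def using m by (auto simp: translatesD(2)[OF tp] q algebra_simps)
    note hm = hyp_isom_closed[OF hc m]
    have "?p n (f k z) = ?p q (?p k ((inv\<^bsub>hyp_isom\<^esub> (?p k)) (h (\<gamma> t))))"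
      unfolding f_apply[OF z(1)] z(2)
      using hyp_isom_mult_apply[OF pc pc hyp_isom_closed[OF inv_closed[OF pc] hm], of q k k t]
      by (simp add: q(1) nat_pow_mult gc)
    hence "?p n (f k z) = ?p q (h (\<gamma> t))" by (simp add: hyp_isom_inv_apply(2)[OF pc hm])
    moreover have "?p n (f n z) = h (\<gamma> (t + real q * \<tau>))"
      unfolding f_apply[OF z(1)] z(3) by (rule hyp_isom_inv_apply(2)[OF pc hm])
    ultimately show ?thesis using kn(1) by simp
  qed
  have "unit_speed_geodesic_on UNIV (\<lambda>t. h (\<gamma> t))"
    unfolding unit_speed_geodesic_on_def
    using hyp_isom_closed[OF hc m] hdist_isom[OF hc m m] translatesD(4)[OF g(2)] by auto
  hence th: "translates (?p q) (\<lambda>t. h (\<gamma> t)) (real q * \<tau>)" using comm by (simp add: translates_def)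
  obtain c where c: "\<And>t. h (\<gamma> t) = \<gamma> (t + c)"
    using same_translation_shift[OF pc tp th] q(2) g(3) by auto
  hence tc: "translates h \<gamma> c" using translatesD(1)[OF g(2)] by (simp add: translates_def)
  \<comment> \<open>All translation lengths of \<open>h\<close> agree up to sign, and \<open>\<sigma> \<noteq> 0\<close>.\<close>
  have "c \<noteq> 0" using translation_length_le[OF hc h(2) tc] h(3) by auto
  thus ?thesis using translated_line_unique[OF hc tc _ h(2,3)] by blast
qed

lemma loxodromic_endpoints_distinct:
  fixes \<Gamma> :: "(real ^ 'n \<Rightarrow> real ^ 'n) set"
  assumes G: "subgroup \<Gamma> hyp_isom" and fin: "\<And>x R. x \<in> hyp_space \<Longrightarrow> finite {g \<in> \<Gamma>. hdist x (g x) \<le> R}"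
    and g: "g \<in> \<Gamma>" "translates g \<gamma> \<tau>" "\<tau> > 0" and h: "h \<in> \<Gamma>" "translates h \<gamma>' \<sigma>" "\<sigma> > 0"
    and ne: "range \<gamma> \<noteq> range \<gamma>'"
    and l: "(\<lambda>k. \<gamma> (real k)) \<longlonglongrightarrow> \<xi>" "(\<lambda>k. \<gamma> (- real k)) \<longlonglongrightarrow> \<xi>'"
     "(\<lambda>k. \<gamma>' (real k)) \<longlonglongrightarrow> \<eta>" "(\<lambda>k. \<gamma>' (- real k)) \<longlonglongrightarrow> \<eta>'"
  shows "distinct [\<xi>, \<xi>', \<eta>, \<eta>']"
proof -
  have ig: "inv\<^bsub>hyp_isom\<^esub> g \<in> \<Gamma>" using g G by (simp add: subgroup.m_inv_closed)
  have gc: "g \<in> carrier hyp_isom" using g G subgroup.subset by blast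
  have tg: "translates (inv\<^bsub>hyp_isom\<^esub> g) (\<lambda>t. \<gamma> (- t)) \<tau>"
    using translates_reverse[OF translates_inv[OF gc g(2)]] by simp
  have th: "translates h (\<lambda>t. \<gamma>' (- t)) (- \<sigma>)" using translates_reverse[OF h(2)] .
  have "\<xi> \<noteq> \<eta>" using common_endpoint_common_axis[OF G fin g h(1,2) _ l(1)] l(3) h(3) ne by auto
  moreover have "\<xi> \<noteq> \<eta>'"
    using common_endpoint_common_axis[OF G fin g h(1) th _ l(1)] l(4) h(3) ne by (auto simp: range_reverse)
  moreover have "\<xi>' \<noteq> \<eta>"
    using common_endpoint_common_axis[OF G fin ig tg g(3) h(1,2) _ l(2)] l(3) h(3) ne
      by (auto simp: range_reverse)
  moreover have "\<xi>' \<noteq> \<eta>'"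
    using common_endpoint_common_axis[OF G fin ig tg g(3) h(1) th _ l(2)] l(4) h(3) ne
      by (auto simp: range_reverse)
  moreover have "\<xi> \<noteq> \<xi>'" by (rule line_endpoints_distinct[OF translatesD(1)[OF g(2)] l(1,2)])
  moreover have "\<eta> \<noteq> \<eta>'" by (rule line_endpoints_distinct[OF translatesD(1)[OF h(2)] l(3,4)])
  ultimately show ?thesis by auto
qed

section \<open>Ping-pong on the closed ball\<close>

text \<open>A half-space together with its boundary at infinity.\<close>

definition closer :: "real ^ 'n \<Rightarrow> real ^ 'n \<Rightarrow> (real ^ 'n) set" where
  "closer a b = {p \<in> cball 0 1. hnear a p \<le> hnear b p}"

text \<open>For \<open>p\<close> in this half-space \<open>|p - \<gamma> (k \<tau>)|\<^sup>2\<close> is at most a multiple of \<open>1 - |\<gamma> (k \<tau>)|\<^sup>2\<close>, which decays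
  exponentially.\<close>

lemma closer_shrinks:
  fixes \<gamma> :: "real \<Rightarrow> real ^ 'n"
  assumes g: "unit_speed_geodesic_on UNIV \<gamma>" and l: "(\<lambda>k. \<gamma> (real k)) \<longlonglongrightarrow> \<xi>" and \<tau>: "\<tau> > 0" and e: "\<epsilon> > 0"
  shows "\<forall>\<^sub>F k in sequentially. closer (\<gamma> (real k * \<tau>)) (\<gamma> 0) \<subseteq> ball \<xi> \<epsilon>"
proof -
  note m = unit_speedD(1)[OF g UNIV_I]
  obtain C where C: "\<And>t. t \<ge> 0 \<Longrightarrow> norm (\<gamma> t - \<xi>) \<le> C * exp (- t)"
    using geodesic_endpoint[OF g] LIMSEQ_unique[OF l] by (metis subset_UNIV)
  define a where "a = 1 - (norm (\<gamma> 0))\<^sup>2"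
  have a: "a > 0" using hyp_spaceD[OF m] by (simp add: a_def)
  define D where "D = hdist 0 (\<gamma> 0)"
  define b where "b k = sqrt (4 * (4 * exp (D - real k * \<tau>)) / a)" for k
  have le: "norm (p - \<xi>) \<le> b k + C * exp (- (real k * \<tau>))" if p: "p \<in> closer (\<gamma> (real k * \<tau>)) (\<gamma> 0)" for p k
  proof -
    let ?q = "\<gamma> (real k * \<tau>)"
    have q: "1 - (norm ?q)\<^sup>2 > 0" using hyp_spaceD[OF m] by simp
    have "norm (p - \<gamma> 0) \<le> 2"
      using p m[of 0] norm_triangle_ineq4[of p "\<gamma> 0"] by (simp add: closer_def hyp_space_iff)
    hence "(norm (p - \<gamma> 0))\<^sup>2 \<le> 2\<^sup>2" by (intro power_mono) auto
    hence "hnear (\<gamma> 0) p \<le> 4 / a" using a by (simp add: hnear_def a_def divide_right_mono)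
    hence "(norm (p - ?q))\<^sup>2 / (1 - (norm ?q)\<^sup>2) \<le> 4 / a" using p by (simp add: closer_def hnear_def)
    hence "(norm (p - ?q))\<^sup>2 \<le> 4 / a * (1 - (norm ?q)\<^sup>2)" using q by (simp add: divide_le_eq)
    also have "\<dots> \<le> 4 / a * (4 * exp (- hdist 0 ?q))" using a one_minus_norm_sq_le[OF m]
      by (intro mult_left_mono) auto
    also have "\<dots> \<le> 4 / a * (4 * exp (D - real k * \<tau>))"
      using a \<tau> unit_speed_hdist_0[OF g, of "real k * \<tau>"] by (intro mult_left_mono) (auto simp: D_def)
    also have "\<dots> = (b k)\<^sup>2" using a by (simp add: b_def)
    finally have "norm (p - ?q) \<le> b k" by (rule power2_le_imp_le) (use a in \<open>simp add: b_def\<close>)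
    moreover have "norm (?q - \<xi>) \<le> C * exp (- (real k * \<tau>))" using C \<tau> by simp
    moreover have "norm (p - \<xi>) \<le> norm (p - ?q) + norm (?q - \<xi>)" using norm_triangle_ineq[of "p - ?q" "?q - \<xi>"]
      by simp
    ultimately show ?thesis by linarith
  qed
  have "(\<lambda>k. sqrt (4 * (4 * exp (D - real k * \<tau>)) / a) + C * exp (- (real k * \<tau>))) \<longlonglongrightarrow> 0"
    using \<tau> a by real_asymp
  hence "\<forall>\<^sub>F k in sequentially. b k + C * exp (- (real k * \<tau>)) < \<epsilon>"
    unfolding b_def using e by (rule order_tendstoD(2))
  thus ?thesis
    by eventually_elim (use le in \<open>force simp: dist_norm norm_minus_commute\<close>)
qed

text \<open>A translation by \<open>\<sigma>\<close> carries the pair \<open>\<gamma> (- \<sigma>)\<close>, \<open>\<gamma> 0\<close> to \<open>\<gamma> 0\<close>, \<open>\<gamma> \<sigma>\<close>.\<close>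

lemma closer_translate:
  assumes h: "h \<in> carrier hyp_isom" and t: "translates h \<gamma> \<sigma>"
    and p: "p \<in> cball 0 1" "p \<notin> closer (\<gamma> (- \<sigma>)) (\<gamma> 0)"
  shows "bext h p \<in> closer (\<gamma> \<sigma>) (\<gamma> 0)"
proof -
  have "hnear (\<gamma> 0) p < hnear (\<gamma> (- \<sigma>)) p" using p by (simp add: closer_def)
  from hnear_isom_le[OF h translatesD(3)[OF t] translatesD(3)[OF t] p(1) this]
  show ?thesis using bext_cball[OF h p(1)] by (simp add: closer_def translatesD(2)[OF t])
qed

text \<open>A high power of \<open>g\<close> maps the complement of a small half-space at one end of its axis into a small
  half-space at the other end, and likewise for \<open>h\<close>. The four endpoints are distinct, so the four
  half-spaces are disjoint once the power is large.\<close>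

lemma ping_pong:
  fixes \<Gamma> :: "(real ^ 'n \<Rightarrow> real ^ 'n) set"
  assumes G: "subgroup \<Gamma> hyp_isom" and fin: "\<And>x R. x \<in> hyp_space \<Longrightarrow> finite {g \<in> \<Gamma>. hdist x (g x) \<le> R}"
    and g: "g \<in> \<Gamma>" "loxodromic g" and h: "h \<in> \<Gamma>" "loxodromic h" and ne: "lox_axis g \<noteq> lox_axis h"
  obtains n :: nat and A1 A2 B1 B2 :: "(real ^ 'n) set" where
    "A1 \<inter> A2 = {}" "B1 \<inter> B2 = {}" "(A1 \<union> A2) \<inter> (B1 \<union> B2) = {}"
    "\<And>p. p \<in> cball 0 1 \<Longrightarrow> p \<notin> A1 \<Longrightarrow> bext (g [^]\<^bsub>hyp_isom\<^esub> n) p \<in> A2"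
    "\<And>p. p \<in> cball 0 1 \<Longrightarrow> p \<notin> B1 \<Longrightarrow> bext (h [^]\<^bsub>hyp_isom\<^esub> n) p \<in> B2"
proof -
  interpret group "hyp_isom :: (real ^ 'n \<Rightarrow> real ^ 'n) monoid" by (rule group_hyp_isom)
  obtain \<gamma> \<tau> where g': "g \<in> carrier hyp_isom" "translates g \<gamma> \<tau>" "\<tau> > 0" "lox_axis g = range \<gamma>"
    using loxodromicE[OF g(2)] .
  obtain \<gamma>' \<sigma> where h': "h \<in> carrier hyp_isom" "translates h \<gamma>' \<sigma>" "\<sigma> > 0" "lox_axis h = range \<gamma>'"
    using loxodromicE[OF h(2)] .
  note u = translatesD(1)[OF g'(2)] and u' = translatesD(1)[OF h'(2)]
  note v = unit_speed_reverse[OF u] and v' = unit_speed_reverse[OF u']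
  obtain \<xi> where l1: "(\<lambda>k. \<gamma> (real k)) \<longlonglongrightarrow> \<xi>" using geodesic_endpoint[OF u] by auto
  obtain \<xi>' where l2: "(\<lambda>k. \<gamma> (- real k)) \<longlonglongrightarrow> \<xi>'" using geodesic_endpoint[OF v] by auto
  obtain \<eta> where l3: "(\<lambda>k. \<gamma>' (real k)) \<longlonglongrightarrow> \<eta>" using geodesic_endpoint[OF u'] by auto
  obtain \<eta>' where l4: "(\<lambda>k. \<gamma>' (- real k)) \<longlonglongrightarrow> \<eta>'" using geodesic_endpoint[OF v'] by auto
  have dist: "distinct [\<xi>, \<xi>', \<eta>, \<eta>']"
    using loxodromic_endpoints_distinct[OF G fin g(1) g'(2,3) h(1) h'(2,3) _ l1 l2 l3 l4] ne g'(4) h'(4) by simp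
  define \<epsilon> where "\<epsilon> = Min {dist a b | a b. a \<in> {\<xi>, \<xi>', \<eta>, \<eta>'} \<and> b \<in> {\<xi>, \<xi>', \<eta>, \<eta>'} \<and> a \<noteq> b} / 2"
  let ?S = "{dist a b | a b. a \<in> {\<xi>, \<xi>', \<eta>, \<eta>'} \<and> b \<in> {\<xi>, \<xi>', \<eta>, \<eta>'} \<and> a \<noteq> b}"
  have fS: "finite ?S"
    by (rule finite_subset[of _ "(\<lambda>(a, b). dist a b) ` ({\<xi>, \<xi>', \<eta>, \<eta>'} \<times> {\<xi>, \<xi>', \<eta>, \<eta>'})"]) auto
  have \<epsilon>: "\<epsilon> > 0"
    unfolding \<epsilon>_def using fS dist by (subst zero_less_divide_iff, subst Min_gr_iff) auto
  have disj: "ball a \<epsilon> \<inter> ball b \<epsilon> = {}" if "a \<in> {\<xi>, \<xi>', \<eta>, \<eta>'}" "b \<in> {\<xi>, \<xi>', \<eta>, \<eta>'}" "a \<noteq> b" for a b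
  proof -
    have "2 * \<epsilon> \<le> dist a b" unfolding \<epsilon>_def using Min_le[OF fS, of "dist a b"] that by auto
    thus ?thesis by (intro disjoint_ballI) simp
  qed
  have "\<forall>\<^sub>F k in sequentially. closer (\<gamma> (real k * \<tau>)) (\<gamma> 0) \<subseteq> ball \<xi> \<epsilon> \<and> closer (\<gamma> (- (real k * \<tau>))) (\<gamma> 0)
    \<subseteq> ball \<xi>' \<epsilon>
     \<and> closer (\<gamma>' (real k * \<sigma>)) (\<gamma>' 0) \<subseteq> ball \<eta> \<epsilon> \<and> closer (\<gamma>' (- (real k * \<sigma>))) (\<gamma>' 0) \<subseteq> ball \<eta>' \<epsilon>"
    using closer_shrinks[OF u l1 g'(3) \<epsilon>] closer_shrinks[OF v l2 g'(3) \<epsilon>] closer_shrinks[OF u' l3 h'(3) \<epsilon>]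
      closer_shrinks[OF v' l4 h'(3) \<epsilon>]
    by (intro eventually_conj) simp_all
  then obtain n where n: "closer (\<gamma> (real n * \<tau>)) (\<gamma> 0) \<subseteq> ball \<xi> \<epsilon>"
    "closer (\<gamma> (- (real n * \<tau>))) (\<gamma> 0) \<subseteq> ball \<xi>' \<epsilon>"
     "closer (\<gamma>' (real n * \<sigma>)) (\<gamma>' 0) \<subseteq> ball \<eta> \<epsilon>" "closer (\<gamma>' (- (real n * \<sigma>))) (\<gamma>' 0) \<subseteq> ball \<eta>' \<epsilon>"
    by (auto simp: eventually_sequentially)
  have "ball \<xi>' \<epsilon> \<inter> ball \<xi> \<epsilon> = {}" "ball \<eta>' \<epsilon> \<inter> ball \<eta> \<epsilon> = {}"
    "ball \<xi>' \<epsilon> \<inter> ball \<eta>' \<epsilon> = {}" "ball \<xi>' \<epsilon> \<inter> ball \<eta> \<epsilon> = {}"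
    "ball \<xi> \<epsilon> \<inter> ball \<eta>' \<epsilon> = {}" "ball \<xi> \<epsilon> \<inter> ball \<eta> \<epsilon> = {}"
    by (rule disj; use dist in auto)+
  note balls = this
  have gn: "g [^]\<^bsub>hyp_isom\<^esub> n \<in> carrier hyp_isom" and hn: "h [^]\<^bsub>hyp_isom\<^esub> n \<in> carrier hyp_isom"
    using g'(1) h'(1) by auto
  show ?thesis
  proof (rule that)
    show "closer (\<gamma> (- (real n * \<tau>))) (\<gamma> 0) \<inter> closer (\<gamma> (real n * \<tau>)) (\<gamma> 0) = {}"
      using n balls by blast
    show "closer (\<gamma>' (- (real n * \<sigma>))) (\<gamma>' 0) \<inter> closer (\<gamma>' (real n * \<sigma>)) (\<gamma>' 0) = {}"
      using n balls by blast
    show "(closer (\<gamma> (- (real n * \<tau>))) (\<gamma> 0) \<union> closer (\<gamma> (real n * \<tau>)) (\<gamma> 0))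
        \<inter> (closer (\<gamma>' (- (real n * \<sigma>))) (\<gamma>' 0) \<union> closer (\<gamma>' (real n * \<sigma>)) (\<gamma>' 0)) = {}"
      using n balls by blast
  qed (fact closer_translate[OF gn translates_pow[OF g'(1,2)]] closer_translate[OF hn translates_pow[OF
    h'(1,2)]])+
qed

section \<open>Growth of orbits\<close>

text \<open>Balls of radius \<open>s / 2\<close> around the points are disjoint and lie in the ball of radius \<open>2\<close>.\<close>

lemma separated_card_le:
  fixes E :: "(real ^ 'n) set"
  assumes "finite E" "E \<subseteq> hyp_space" and s: "0 < s" "s \<le> 2"
    and sep: "\<And>p q. p \<in> E \<Longrightarrow> q \<in> E \<Longrightarrow> p \<noteq> q \<Longrightarrow> s \<le> dist p q"
  shows "real (card E) \<le> (4 / s) ^ CARD('n)"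
proof -
  let ?v = "unit_ball_vol (real CARD('n))"
  have v: "?v > 0" by simp
  have "(\<Sum>p\<in>E. emeasure lborel (ball p (s / 2))) = emeasure lborel (\<Union>p\<in>E. ball p (s / 2))"
    using assms sep by (intro sum_emeasure) (auto simp: disjoint_family_on_def intro!: disjoint_ballI)
  also have "\<dots> \<le> emeasure lborel (ball (0 :: real ^ 'n) 2)"
  proof (rule emeasure_mono)
    show "(\<Union>p\<in>E. ball p (s / 2)) \<subseteq> ball 0 2"
    proof safe
      fix p z assume "p \<in> E" "z \<in> ball p (s / 2)"
      hence "norm p < 1" "norm (z - p) < s / 2" using assms
        by (auto simp: hyp_space_iff dist_norm norm_minus_commute)
      thus "z \<in> ball 0 2" using norm_triangle_ineq[of "z - p" p] s by simp
    qed
  qed auto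
  finally have "ennreal (real (card E) * (?v * (s / 2) ^ CARD('n))) \<le> ennreal (?v * 2 ^ CARD('n))"
    using s by (simp add: emeasure_ball ennreal_mult ennreal_of_nat_eq_real_of_nat)
  hence "real (card E) * (?v * (s / 2) ^ CARD('n)) \<le> ?v * 2 ^ CARD('n)" using v by (simp add: ennreal_le_iff)
  hence "real (card E) * (s / 2) ^ CARD('n) \<le> 2 ^ CARD('n)" using v by (simp add: mult_ac)
  hence "real (card E) \<le> 2 ^ CARD('n) / (s / 2) ^ CARD('n)" using s by (simp add: pos_le_divide_eq)
  also have "\<dots> = (4 / s) ^ CARD('n)" by (simp add: power_divide[symmetric])
  finally show ?thesis .
qed

text \<open>Distinct points of the orbit are at distance at least some \<open>\<delta> > 0\<close>. For points at hyperbolic distance at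
  most \<open>R\<close> from the origin this means Euclidean distance at least a multiple of \<open>exp (- R)\<close>, and
  \<open>separated_card_le\<close> bounds their number.\<close>

lemma orbit_growth:
  fixes \<Gamma> :: "(real ^ 'n \<Rightarrow> real ^ 'n) set"
  assumes G: "subgroup \<Gamma> hyp_isom" and fin: "\<And>R. finite {g \<in> \<Gamma>. hdist x (g x) \<le> R}" and x: "x \<in> hyp_space"
  obtains C where "C > 0" "\<And>R. finite {z \<in> (\<lambda>g. g x) ` \<Gamma>. hdist 0 z \<le> R}"
    "\<And>R. R \<ge> 0 \<Longrightarrow> real (card {z \<in> (\<lambda>g. g x) ` \<Gamma>. hdist 0 z \<le> R}) \<le> C * exp (real CARD('n) * R)"
proof -
  interpret group "hyp_isom :: (real ^ 'n \<Rightarrow> real ^ 'n) monoid" by (rule group_hyp_isom)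
  interpret S: subgroup \<Gamma> hyp_isom by (rule G)
  define Orb where "Orb = (\<lambda>g. g x) ` \<Gamma>"
  have Orb: "Orb \<subseteq> hyp_space" using S.subset hyp_isom_closed x by (auto simp: Orb_def)
  have finO: "finite {z \<in> Orb. hdist 0 z \<le> R}" for R
  proof (rule finite_subset)
    show "{z \<in> Orb. hdist 0 z \<le> R} \<subseteq> (\<lambda>g. g x) ` {g \<in> \<Gamma>. hdist x (g x) \<le> hdist x 0 + R}"
    proof safe
      fix z assume z: "z \<in> Orb" "hdist 0 z \<le> R"
      then obtain g where g: "g \<in> \<Gamma>" "z = g x" by (auto simp: Orb_def)
      have "hdist x z \<le> hdist x 0 + R" using hdist_triangle[OF x zero_in_hyp_space, of z] z Orb by auto
      thus "z \<in> (\<lambda>g. g x) ` {g \<in> \<Gamma>. hdist x (g x) \<le> hdist x 0 + R}" using g by blast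
    qed
  qed (intro finite_imageI fin)
  \<comment> \<open>Only displacements at most \<open>1\<close> matter for the minimum, and there are finitely many of them.\<close>
  define D where "D = insert 1 (hdist x ` ((\<lambda>g. g x) ` {g \<in> \<Gamma>. hdist x (g x) \<le> 1} - {x}))"
  define \<delta> where "\<delta> = Min D"
  have D: "finite D" unfolding D_def using fin by auto
  have \<delta>0: "\<delta> > 0"
    unfolding \<delta>_def using D
  proof (subst Min_gr_iff)
    have "hdist x (g x) > 0" if "g \<in> \<Gamma>" "g x \<noteq> x" for g
    proof -
      have "g x \<in> hyp_space" using that(1) S.subset x hyp_isom_closed by blast
      thus ?thesis using hdist_eq_0[OF x] hdist_nonneg[OF x] that(2) by (metis order_le_less)
    qed
    thus "\<forall>a\<in>D. 0 < a" by (auto simp: D_def)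
  qed (auto simp: D_def)
  have sep: "\<delta> \<le> hdist p q" if pq: "p \<in> Orb" "q \<in> Orb" "p \<noteq> q" for p q
  proof -
    obtain g h where g: "g \<in> \<Gamma>" "p = g x" and h: "h \<in> \<Gamma>" "q = h x" using pq by (auto simp: Orb_def)
    have c: "g \<in> carrier hyp_isom" "h \<in> carrier hyp_isom" using g h S.subset by auto
    let ?k = "inv\<^bsub>hyp_isom\<^esub> g \<otimes>\<^bsub>hyp_isom\<^esub> h"
    have k: "?k \<in> \<Gamma>" using g h by simp
    have kx: "?k x = (inv\<^bsub>hyp_isom\<^esub> g) q" using hyp_isom_mult_apply[OF inv_closed[OF c(1)] c(2) x] h by simp
    have "hdist p q = hdist ((inv\<^bsub>hyp_isom\<^esub> g) p) ((inv\<^bsub>hyp_isom\<^esub> g) q)"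
      by (rule hdist_isom[OF inv_closed[OF c(1)], symmetric]) (use pq Orb in auto)
    hence e: "hdist p q = hdist x (?k x)" using hyp_isom_inv_apply(1)[OF c(1) x] g kx by simp
    have "?k x \<noteq> x"
    proof
      assume "?k x = x"
      hence "g x = g ((inv\<^bsub>hyp_isom\<^esub> g) q)" using kx by simp
      also have "\<dots> = q" by (rule hyp_isom_inv_apply(2)[OF c(1)]) (use pq Orb in auto)
      finally show False using g pq by simp
    qed
    show ?thesis
    proof (cases "hdist x (?k x) \<le> 1")
      case True
      hence "hdist x (?k x) \<in> D" using k \<open>?k x \<noteq> x\<close> by (auto simp: D_def)
      thus ?thesis unfolding \<delta>_def e by (rule Min_le[OF D])
    next
      case False
      have "\<delta> \<le> 1" unfolding \<delta>_def by (rule Min_le[OF D]) (simp add: D_def)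
      thus ?thesis using False e by simp
    qed
  qed
  define \<kappa> where "\<kappa> = min 1 (sqrt ((cosh \<delta> - 1) / 2))"
  have "cosh \<delta> > 1" using \<delta>0 cosh_real_nonneg_less_iff[of 0 \<delta>] by simp
  hence \<kappa>: "\<kappa> > 0" "\<kappa> \<le> 1" "\<kappa>\<^sup>2 \<le> (cosh \<delta> - 1) / 2"
    using power_mono[of \<kappa> "sqrt ((cosh \<delta> - 1) / 2)" 2] by (auto simp: \<kappa>_def)
  define C where "C = (4 / \<kappa>) ^ CARD('n)"
  show ?thesis
  proof (rule that[of C])
    show "C > 0" using \<kappa> by (simp add: C_def)
    show "finite {z \<in> (\<lambda>g. g x) ` \<Gamma>. hdist 0 z \<le> R}" for R using finO by (simp add: Orb_def)
    fix R :: real assume R: "R \<ge> 0"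
    have "real (card {z \<in> Orb. hdist 0 z \<le> R}) \<le> (4 / (\<kappa> * exp (- R))) ^ CARD('n)"
    proof (rule separated_card_le[OF finO])
      have "\<kappa> * exp (- R) \<le> 1 * 1" using \<kappa> R by (intro mult_mono) auto
      thus "\<kappa> * exp (- R) \<le> 2" by simp
      fix p q assume p: "p \<in> {z \<in> Orb. hdist 0 z \<le> R}" and q: "q \<in> {z \<in> Orb. hdist 0 z \<le> R}" and ne: "p \<noteq> q"
      have pq: "p \<in> hyp_space" "q \<in> hyp_space" using p q Orb by auto
      have "(\<kappa> * exp (- R))\<^sup>2 = \<kappa>\<^sup>2 * exp (- R - R)" by (simp add: power_mult_distrib exp_double[symmetric])
      also have "\<dots> \<le> (cosh (hdist p q) - 1) / 2 * exp (- hdist 0 p - hdist 0 q)"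
      proof (rule mult_mono)
        have "cosh \<delta> \<le> cosh (hdist p q)" using sep[of p q] p q ne \<delta>0 by (subst cosh_real_nonneg_le_iff) auto
        thus "\<kappa>\<^sup>2 \<le> (cosh (hdist p q) - 1) / 2" using \<kappa>(3) by argo
      qed (use p q in \<open>auto simp: cosh_real_ge_1\<close>)
      also have "\<dots> \<le> (dist p q)\<^sup>2" unfolding dist_norm by (rule norm_diff_ge_hdist[OF pq])
      finally show "\<kappa> * exp (- R) \<le> dist p q" by (rule power2_le_imp_le) simp
    qed (use Orb \<kappa> in auto)
    also have "4 / (\<kappa> * exp (- R)) = 4 / \<kappa> * exp R" by (simp add: exp_minus field_simps)
    also have "\<dots> ^ CARD('n) = C * exp (real CARD('n) * R)"
      by (simp only: C_def power_mult_distrib exp_of_nat_mult)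
    finally show "real (card {z \<in> (\<lambda>g. g x) ` \<Gamma>. hdist 0 z \<le> R}) \<le> C * exp (real CARD('n) * R)"
      by (simp add: Orb_def)
  qed
qed

section \<open>A spectral gap for averaging operators\<close>

text \<open>The squared \<open>\<ell>\<^sup>2\<close>-norm over a discrete set, with values in the extended nonnegative reals so that sums may
  be interchanged freely.\<close>

definition l2_sq :: "('a \<Rightarrow> real) \<Rightarrow> ennreal" where
  "l2_sq f = (\<integral>\<^sup>+x. ennreal ((f x)\<^sup>2) \<partial>count_space UNIV)"

definition l2_sq_on :: "'a set \<Rightarrow> ('a \<Rightarrow> real) \<Rightarrow> ennreal" where
  "l2_sq_on A f = (\<integral>\<^sup>+x. ennreal ((f x)\<^sup>2) * indicator A x \<partial>count_space UNIV)"

lemma l2_sq_ge_point: "ennreal ((f z)\<^sup>2) \<le> l2_sq f"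
proof -
  have "ennreal ((f z)\<^sup>2) = (\<integral>\<^sup>+x. ennreal ((f x)\<^sup>2) * indicator {z} x \<partial>count_space UNIV)"
    by (subst nn_integral_indicator_singleton) (auto simp: emeasure_count_space)
  also have "\<dots> \<le> l2_sq f" unfolding l2_sq_def by (intro nn_integral_mono) (auto simp: indicator_def)
  finally show ?thesis .
qed

lemma l2_sq_reindex: "bij b \<Longrightarrow> l2_sq (\<lambda>x. f (b x)) = l2_sq f"
  unfolding l2_sq_def by (rule nn_integral_bij_count_space)

lemma l2_sq_minus_commute: "l2_sq (\<lambda>x. f x - g x) = l2_sq (\<lambda>x. g x - f x)"
  unfolding l2_sq_def by (simp add: power2_commute)

lemma l2_sq_add_le: "l2_sq (\<lambda>x. f x + g x) \<le> 2 * l2_sq f + 2 * l2_sq g"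
proof -
  have "l2_sq (\<lambda>x. f x + g x) \<le> (\<integral>\<^sup>+x. 2 * ennreal ((f x)\<^sup>2) + 2 * ennreal ((g x)\<^sup>2) \<partial>count_space UNIV)"
    unfolding l2_sq_def
  proof (intro nn_integral_mono)
    fix x
    have "(f x + g x)\<^sup>2 \<le> 2 * (f x)\<^sup>2 + 2 * (g x)\<^sup>2" using sum_squares_bound[of "f x" "g x"]
      by (simp add: power2_sum)
    hence "ennreal ((f x + g x)\<^sup>2) \<le> ennreal (2 * (f x)\<^sup>2 + 2 * (g x)\<^sup>2)" by (rule ennreal_leI)
    thus "ennreal ((f x + g x)\<^sup>2) \<le> 2 * ennreal ((f x)\<^sup>2) + 2 * ennreal ((g x)\<^sup>2)"
      by (simp add: ennreal_plus ennreal_mult')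
  qed
  also have "\<dots> = 2 * l2_sq f + 2 * l2_sq g"
    unfolding l2_sq_def by (simp add: nn_integral_add nn_integral_cmult)
  finally show ?thesis .
qed

text \<open>Counting measure on an uncountable set is not \<open>\<sigma>\<close>-finite, so Tonelli for product measures does not apply;
  the interchange is one of two counting measures.\<close>

lemma nn_integral_pmf_count_space_swap:
  "(\<integral>\<^sup>+x. (\<integral>\<^sup>+s. F x s \<partial>measure_pmf p) \<partial>count_space UNIV)
    = (\<integral>\<^sup>+s. (\<integral>\<^sup>+x. F x s \<partial>count_space UNIV) \<partial>measure_pmf p)"
proof -
  have "(\<integral>\<^sup>+x. (\<integral>\<^sup>+s. F x s \<partial>measure_pmf p) \<partial>count_space UNIV)
      = (\<integral>\<^sup>+x. (\<integral>\<^sup>+s. ennreal (pmf p s) * F x s \<partial>count_space UNIV) \<partial>count_space UNIV)"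
    by (simp add: nn_integral_measure_pmf)
  also have "\<dots> = (\<integral>\<^sup>+s. (\<integral>\<^sup>+x. ennreal (pmf p s) * F x s \<partial>count_space UNIV) \<partial>count_space UNIV)"
    using nn_integral_fst_count_space[of "\<lambda>(x, s). ennreal (pmf p s) * F x s"]
      nn_integral_snd_count_space[of "\<lambda>(x, s). ennreal (pmf p s) * F x s"] by simp
  also have "\<dots> = (\<integral>\<^sup>+s. (\<integral>\<^sup>+x. F x s \<partial>count_space UNIV) \<partial>measure_pmf p)"
    by (simp add: nn_integral_measure_pmf nn_integral_cmult)
  finally show ?thesis .
qed

text \<open>A group acting by permutations, from the right, on a set seen as discrete, and a probability \<open>\<mu>\<close> on the
  group. For the random walk \<open>\<beta> g\<close> is the action of the inverse of \<open>g\<close>, so that \<open>avg\<close> below maps the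
  law of a point \<open>y\<close> to the law of \<open>s y\<close>, where \<open>s\<close> has law \<open>\<mu>\<close> and is independent of
  \<open>y\<close>. Functions are supported in \<open>X\<close>.\<close>

locale averaging =
  fixes G (structure) and \<mu> :: "'g pmf" and \<beta> :: "'g \<Rightarrow> 'a \<Rightarrow> 'a" and X :: "'a set"
  assumes group: "group G" and supp: "set_pmf \<mu> \<subseteq> carrier G"
    and act_one: "\<beta> \<one> x = x"
    and act_mult: "g \<in> carrier G \<Longrightarrow> h \<in> carrier G \<Longrightarrow> \<beta> (g \<otimes> h) x = \<beta> h (\<beta> g x)"
    and act_X: "g \<in> carrier G \<Longrightarrow> \<beta> g x \<in> X \<longleftrightarrow> x \<in> X"
begin

sublocale group G by (rule group)

lemma act_inv:
  assumes "g \<in> carrier G" shows "\<beta> (inv g) (\<beta> g x) = x" "\<beta> g (\<beta> (inv g) x) = x"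
  using assms by (simp_all add: act_mult[symmetric] act_one)

lemma act_bij: "g \<in> carrier G \<Longrightarrow> bij (\<beta> g)"
  using act_inv by (intro o_bij[of "\<beta> (inv g)"]) auto

definition avg :: "('a \<Rightarrow> real) \<Rightarrow> 'a \<Rightarrow> real" where
  "avg f x = measure_pmf.expectation \<mu> (\<lambda>s. f (\<beta> s x))"

text \<open>The operator of the walk that stands still with probability one half. Its norm detects every element
  of the support, whereas the norm of \<open>avg\<close> itself would only detect the quotients of two such elements.\<close>

definition lazy :: "('a \<Rightarrow> real) \<Rightarrow> 'a \<Rightarrow> real" where
  "lazy f x = (f x + avg f x) / 2"

text \<open>The Dirichlet form of the walk, up to normalization.\<close>

definition energy :: "('a \<Rightarrow> real) \<Rightarrow> ennreal" where
  "energy f = (\<integral>\<^sup>+s. l2_sq (\<lambda>x. f x - f (\<beta> s x)) \<partial>measure_pmf \<mu>)"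

definition sub_prob :: "('a \<Rightarrow> real) \<Rightarrow> bool" where
  "sub_prob f \<longleftrightarrow> (\<forall>x. 0 \<le> f x \<and> f x \<le> 1) \<and> (\<forall>x. x \<notin> X \<longrightarrow> f x = 0)"

lemma avg_integrable: "(\<And>x. \<bar>f x\<bar> \<le> B) \<Longrightarrow> integrable (measure_pmf \<mu>) (\<lambda>s. f (\<beta> s x) :: real)"
  by (intro measure_pmf.integrable_const_bound[where B=B]) auto

lemma sub_prob_integrable: "sub_prob f \<Longrightarrow> integrable (measure_pmf \<mu>) (\<lambda>s. f (\<beta> s x))"
  by (intro avg_integrable[where B=1]) (auto simp: sub_prob_def)

lemma avg_mono:
  assumes "sub_prob f" "sub_prob g" "\<And>x. c * f x \<le> g x"
  shows "c * avg f x \<le> avg g x"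
proof -
  have "c * avg f x = measure_pmf.expectation \<mu> (\<lambda>s. c * f (\<beta> s x))" unfolding avg_def by simp
  also have "\<dots> \<le> avg g x"
    unfolding avg_def by (intro integral_mono integrable_mult_right sub_prob_integrable assms)
  finally show ?thesis .
qed

lemma sub_prob_avg:
  assumes f: "sub_prob f" shows "sub_prob (avg f)"
  unfolding sub_prob_def
proof (intro conjI allI impI)
  fix x
  show "0 \<le> avg f x" unfolding avg_def using f by (intro integral_nonneg_AE) (auto simp: sub_prob_def)
  have "avg f x \<le> measure_pmf.expectation \<mu> (\<lambda>s. 1)"
    unfolding avg_def using f by (intro integral_mono sub_prob_integrable[OF f]) (auto simp: sub_prob_def)
  thus "avg f x \<le> 1" by simp
  assume x: "x \<notin> X"
  have "avg f x = measure_pmf.expectation \<mu> (\<lambda>s. 0)"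
    unfolding avg_def
    by (intro integral_cong_AE) (use x f supp act_X in \<open>auto simp: AE_measure_pmf_iff sub_prob_def\<close>)
  thus "avg f x = 0" by simp
qed

lemma sub_prob_lazy:
  assumes "sub_prob f" shows "sub_prob (lazy f)"
proof -
  have "0 \<le> f x + avg f x \<and> f x + avg f x \<le> 2" "x \<notin> X \<longrightarrow> f x + avg f x = 0" for x
    using assms sub_prob_avg[OF assms] by (force simp: sub_prob_def dest: spec[of _ x])+
  thus ?thesis unfolding sub_prob_def lazy_def by simp
qed

text \<open>The mean of \<open>f\<close> and its translate by \<open>s\<close> satisfies the parallelogram law; averaging over \<open>s\<close> and Jensen's
  inequality give the claim.\<close>

lemma energy_dissipation:
  assumes f: "sub_prob f"
  shows "l2_sq (lazy f) + energy f / 4 \<le> l2_sq f"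
proof -
  have int: "integrable (measure_pmf \<mu>) (\<lambda>s. h (f (\<beta> s x)))"
    if "\<And>t. 0 \<le> t \<Longrightarrow> t \<le> 1 \<Longrightarrow> \<bar>h t\<bar> \<le> B" for h :: "real \<Rightarrow> real" and B x
    using f by (intro measure_pmf.integrable_const_bound[where B=B]) (auto simp: sub_prob_def that)
  have point: "ennreal ((lazy f x)\<^sup>2) + (\<integral>\<^sup>+s. ennreal ((f x - f (\<beta> s x))\<^sup>2 / 4) \<partial>measure_pmf \<mu>)
       \<le> (\<integral>\<^sup>+s. ennreal ((f x)\<^sup>2 / 2) + ennreal ((f (\<beta> s x))\<^sup>2 / 2) \<partial>measure_pmf \<mu>)" for x
  proof -
    have fx: "0 \<le> f x" "f x \<le> 1" using f by (auto simp: sub_prob_def)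
    define Y where "Y s = (f x + f (\<beta> s x)) / 2" for s
    have Y: "0 \<le> Y s" "Y s \<le> 1" for s using f
      by (auto simp: Y_def sub_prob_def) (smt (verit) field_sum_of_halves)
    have iY: "integrable (measure_pmf \<mu>) Y" "integrable (measure_pmf \<mu>) (\<lambda>s. (Y s)\<^sup>2)"
      by (intro measure_pmf.integrable_const_bound[where B=1]; use Y in \<open>auto simp: power_le_one\<close>)+
    have lz: "lazy f x = measure_pmf.expectation \<mu> Y"
      unfolding lazy_def avg_def Y_def using sub_prob_integrable[OF f] by simp
    \<comment> \<open>Jensen's inequality, as nonnegativity of the variance.\<close>
    have "(measure_pmf.expectation \<mu> Y)\<^sup>2 \<le> measure_pmf.expectation \<mu> (\<lambda>s. (Y s)\<^sup>2)"
      using measure_pmf.variance_eq[OF iY] measure_pmf.variance_positive[of \<mu> Y] by simp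
    hence "ennreal ((lazy f x)\<^sup>2) \<le> ennreal (measure_pmf.expectation \<mu> (\<lambda>s. (Y s)\<^sup>2))" unfolding lz
      by (rule ennreal_leI)
    also have "\<dots> = (\<integral>\<^sup>+s. ennreal ((Y s)\<^sup>2) \<partial>measure_pmf \<mu>)"
      by (rule nn_integral_eq_integral[symmetric]) (use iY in auto)
    finally have "ennreal ((lazy f x)\<^sup>2) + (\<integral>\<^sup>+s. ennreal ((f x - f (\<beta> s x))\<^sup>2 / 4) \<partial>measure_pmf \<mu>)
        \<le> (\<integral>\<^sup>+s. ennreal ((Y s)\<^sup>2) + ennreal ((f x - f (\<beta> s x))\<^sup>2 / 4) \<partial>measure_pmf \<mu>)"
      by (simp add: nn_integral_add)
    also have "\<dots> = (\<integral>\<^sup>+s. ennreal ((f x)\<^sup>2 / 2) + ennreal ((f (\<beta> s x))\<^sup>2 / 2) \<partial>measure_pmf \<mu>)"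
    proof (intro nn_integral_cong)
      fix s
      have "(Y s)\<^sup>2 + (f x - f (\<beta> s x))\<^sup>2 / 4 = (f x)\<^sup>2 / 2 + (f (\<beta> s x))\<^sup>2 / 2"
        by (simp add: Y_def power2_eq_square field_simps)
      thus "ennreal ((Y s)\<^sup>2) + ennreal ((f x - f (\<beta> s x))\<^sup>2 / 4) = ennreal ((f x)\<^sup>2 / 2)
        + ennreal ((f (\<beta> s x))\<^sup>2 / 2)"
        by (simp add: ennreal_plus[symmetric] del: ennreal_plus)
    qed
    finally show ?thesis .
  qed
  have quarter: "(\<integral>\<^sup>+x. ennreal ((u x)\<^sup>2 / c) \<partial>count_space UNIV) = l2_sq u / ennreal c"
    if "c > 0" for u :: "'a \<Rightarrow> real" and c
    unfolding l2_sq_def using that by (simp add: divide_ennreal[symmetric] nn_integral_divide)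
  have "l2_sq (lazy f) + energy f / 4 = (\<integral>\<^sup>+x. ennreal ((lazy f x)\<^sup>2)
    + (\<integral>\<^sup>+s. ennreal ((f x - f (\<beta> s x))\<^sup>2 / 4) \<partial>measure_pmf \<mu>) \<partial>count_space UNIV)"
  proof -
    have "energy f / 4 = (\<integral>\<^sup>+s. (\<integral>\<^sup>+x. ennreal ((f x - f (\<beta> s x))\<^sup>2 / 4) \<partial>count_space UNIV) \<partial>measure_pmf \<mu>)"
      unfolding energy_def by (simp add: quarter nn_integral_divide)
    thus ?thesis by (simp add: nn_integral_pmf_count_space_swap[symmetric] nn_integral_add l2_sq_def)
  qed
  also have "\<dots> \<le> (\<integral>\<^sup>+x. (\<integral>\<^sup>+s. ennreal ((f x)\<^sup>2 / 2)
    + ennreal ((f (\<beta> s x))\<^sup>2 / 2) \<partial>measure_pmf \<mu>) \<partial>count_space UNIV)"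
    by (intro nn_integral_mono point)
  also have "\<dots> = (\<integral>\<^sup>+s. (\<integral>\<^sup>+x. ennreal ((f x)\<^sup>2 / 2)
    + ennreal ((f (\<beta> s x))\<^sup>2 / 2) \<partial>count_space UNIV) \<partial>measure_pmf \<mu>)"
    by (rule nn_integral_pmf_count_space_swap)
  also have "\<dots> = (\<integral>\<^sup>+s. l2_sq f \<partial>measure_pmf \<mu>)"
  proof (intro nn_integral_cong_AE, unfold AE_measure_pmf_iff, intro ballI)
    fix s assume "s \<in> set_pmf \<mu>"
    hence s: "s \<in> carrier G" using supp by auto
    have "(\<integral>\<^sup>+x. ennreal ((f x)\<^sup>2 / 2) + ennreal ((f (\<beta> s x))\<^sup>2 / 2) \<partial>count_space UNIV) = l2_sq f / 2
      + l2_sq (\<lambda>x. f (\<beta> s x)) / 2"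
      using quarter[of 2 f] quarter[of 2 "\<lambda>x. f (\<beta> s x)"] by (simp add: nn_integral_add)
    also have "\<dots> = l2_sq f" unfolding l2_sq_reindex[OF act_bij[OF s]]
      by (cases "l2_sq f") (auto simp: ennreal_divide_numeral ennreal_plus[symmetric] ennreal_top_divide simp
        del: ennreal_plus)
    finally show "(\<integral>\<^sup>+x. ennreal ((f x)\<^sup>2 / 2) + ennreal ((f (\<beta> s x))\<^sup>2 / 2) \<partial>count_space UNIV) = l2_sq f" .
  qed
  also have "\<dots> = l2_sq f" by simp
  finally show ?thesis .
qed

text \<open>The energy is an average over \<open>s\<close>, in which each \<open>s\<close> has positive weight.\<close>

lemma increment_le_energy:
  assumes "s \<in> set_pmf \<mu>"
  shows "l2_sq (\<lambda>x. f x - f (\<beta> s x)) \<le> ennreal (1 / pmf \<mu> s) * energy f"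
proof -
  have p: "pmf \<mu> s > 0" using assms by (simp add: pmf_positive)
  have "l2_sq (\<lambda>x. f x - f (\<beta> s x)) * ennreal (pmf \<mu> s)
    = (\<integral>\<^sup>+t. l2_sq (\<lambda>x. f x - f (\<beta> t x)) * indicator {s} t \<partial>measure_pmf \<mu>)"
    by (subst nn_integral_indicator_singleton) (auto simp: emeasure_pmf_single)
  also have "\<dots> \<le> energy f" unfolding energy_def by (intro nn_integral_mono) (auto simp: indicator_def)
  finally have "ennreal (1 / pmf \<mu> s) * (l2_sq (\<lambda>x. f x - f (\<beta> s x)) * ennreal (pmf \<mu> s))
    \<le> ennreal (1 / pmf \<mu> s) * energy f"
    by (intro mult_left_mono) auto
  moreover have "ennreal (1 / pmf \<mu> s) * (l2_sq (\<lambda>x. f x - f (\<beta> s x)) * ennreal (pmf \<mu> s))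
      = l2_sq (\<lambda>x. f x - f (\<beta> s x)) * (ennreal (1 / pmf \<mu> s) * ennreal (pmf \<mu> s))"
    by (simp add: mult_ac)
  moreover have "ennreal (1 / pmf \<mu> s) * ennreal (pmf \<mu> s) = 1" using p by (simp add: ennreal_mult'[symmetric])
  ultimately show ?thesis by simp
qed

text \<open>A function of small energy is almost invariant under the support of \<open>\<mu>\<close>, hence under each element of the
  group that it generates, with a constant that depends on the element.\<close>

lemma displacement_le_energy:
  assumes "g \<in> generate G (set_pmf \<mu>)"
  shows "\<exists>C\<ge>0. \<forall>f. l2_sq (\<lambda>x. f x - f (\<beta> g x)) \<le> ennreal C * energy f"
  using assms
proof (induction rule: generate.induct)
  case one
  show ?case by (intro exI[of _ 0]) (simp add: act_one l2_sq_def)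
next
  case (incl s)
  thus ?case using increment_le_energy by (intro exI[of _ "1 / pmf \<mu> s"]) auto
next
  case (inv s)
  have s: "s \<in> carrier G" using inv supp by auto
  have "l2_sq (\<lambda>x. f x - f (\<beta> (inv s) x)) \<le> ennreal (1 / pmf \<mu> s) * energy f" for f
  proof -
    have "l2_sq (\<lambda>x. f x - f (\<beta> (inv s) x)) = l2_sq (\<lambda>x. f (\<beta> s x) - f (\<beta> (inv s) (\<beta> s x)))"
      by (rule l2_sq_reindex[OF act_bij[OF s], symmetric, of "\<lambda>x. f x - f (\<beta> (inv s) x)"])
    also have "\<dots> = l2_sq (\<lambda>x. f x - f (\<beta> s x))" unfolding act_inv(1)[OF s] by (rule l2_sq_minus_commute)
    finally have eq: "l2_sq (\<lambda>x. f x - f (\<beta> (inv s) x)) = l2_sq (\<lambda>x. f x - f (\<beta> s x))" .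
    thus ?thesis using increment_le_energy[OF inv] by simp
  qed
  thus ?case by (intro exI[of _ "1 / pmf \<mu> s"]) auto
next
  case (eng g h)
  have gh: "g \<in> carrier G" "h \<in> carrier G" using eng generate_incl[OF supp] by auto
  obtain C D where C: "C \<ge> 0" "\<And>f. l2_sq (\<lambda>x. f x - f (\<beta> g x)) \<le> ennreal C * energy f"
    and D: "D \<ge> 0" "\<And>f. l2_sq (\<lambda>x. f x - f (\<beta> h x)) \<le> ennreal D * energy f"
    using eng by blast
  have "l2_sq (\<lambda>x. f x - f (\<beta> (g \<otimes> h) x)) \<le> ennreal (2 * C + 2 * D) * energy f" for f
  proof -
    have "l2_sq (\<lambda>x. f x - f (\<beta> (g \<otimes> h) x)) = l2_sq (\<lambda>x. (f x - f (\<beta> g x)) + (f (\<beta> g x) - f (\<beta> h (\<beta> g x))))"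
      by (simp add: act_mult[OF gh])
    also have "\<dots> \<le> 2 * l2_sq (\<lambda>x. f x - f (\<beta> g x)) + 2 * l2_sq (\<lambda>x. f (\<beta> g x) - f (\<beta> h (\<beta> g x)))"
      by (rule l2_sq_add_le)
    also have "l2_sq (\<lambda>x. f (\<beta> g x) - f (\<beta> h (\<beta> g x))) = l2_sq (\<lambda>x. f x - f (\<beta> h x))"
      by (rule l2_sq_reindex[OF act_bij[OF gh(1)], of "\<lambda>x. f x - f (\<beta> h x)"])
    also have "2 * l2_sq (\<lambda>x. f x - f (\<beta> g x)) + 2 * l2_sq (\<lambda>x. f x - f (\<beta> h x)) \<le> 2 * (ennreal C * energy f)
      + 2 * (ennreal D * energy f)"
      by (intro add_mono mult_left_mono C D) auto
    also have "\<dots> = ennreal (2 * C + 2 * D) * energy f"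
      using C(1) D(1) by (simp add: ennreal_plus ennreal_mult' distrib_right mult.assoc)
    finally show ?thesis .
  qed
  thus ?case using C(1) D(1) by (intro exI[of _ "2 * C + 2 * D"]) auto
qed

text \<open>If the inverse of \<open>\<beta> g\<close> pushes the complement of \<open>A1\<close> into \<open>A2\<close>, then a function that is almost invariant
  under \<open>\<beta> g\<close> has nearly all of its mass on \<open>A1\<close> and \<open>A2\<close>. The constants come from
  \<open>b\<^sup>2 \<le> (1 + \<eta>) a\<^sup>2 + (1 + 1 / \<eta>) (a - b)\<^sup>2\<close> with \<open>\<eta> = 1 / 2\<close>.\<close>

lemma paradoxical_half:
  assumes g: "g \<in> carrier G" and f: "sub_prob f" and pp: "\<And>p. p \<in> X \<Longrightarrow> p \<notin> A1 \<Longrightarrow> \<beta> (inv g) p \<in> A2"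
  shows "l2_sq f \<le> ennreal (3/2) * (l2_sq_on A1 f + l2_sq_on A2 f) + 3 * l2_sq (\<lambda>x. f x - f (\<beta> g x))"
proof -
  have "l2_sq_on (X - A1) f = (\<integral>\<^sup>+x. ennreal ((f (\<beta> g x))\<^sup>2) * indicator (X - A1) (\<beta> g x) \<partial>count_space UNIV)"
    unfolding l2_sq_on_def by (rule nn_integral_bij_count_space[OF act_bij[OF g], symmetric])
  also have "\<dots> \<le> (\<integral>\<^sup>+x. ennreal (3/2) * (ennreal ((f x)\<^sup>2) * indicator A2 x)
    + 3 * ennreal ((f x - f (\<beta> g x))\<^sup>2) \<partial>count_space UNIV)"
  proof (intro nn_integral_mono)
    fix x
    show "ennreal ((f (\<beta> g x))\<^sup>2) * indicator (X - A1) (\<beta> g x)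
      \<le> ennreal (3/2) * (ennreal ((f x)\<^sup>2) * indicator A2 x) + 3 * ennreal ((f x - f (\<beta> g x))\<^sup>2)"
    proof (cases "\<beta> g x \<in> X - A1")
      case True
      hence x: "x \<in> A2" using pp[of "\<beta> g x"] act_inv(1)[OF g] by simp
      have "(f (\<beta> g x))\<^sup>2 \<le> 3/2 * (f x)\<^sup>2 + 3 * (f x - f (\<beta> g x))\<^sup>2"
      proof -
        have "3/2 * (f x)\<^sup>2 + 3 * (f x - f (\<beta> g x))\<^sup>2 - (f (\<beta> g x))\<^sup>2 = (3 * f x - 2 * f (\<beta> g x))\<^sup>2 / 2"
          by (simp add: power2_eq_square field_simps)
        thus ?thesis using zero_le_power2[of "3 * f x - 2 * f (\<beta> g x)"] by linarith
      qed
      hence "ennreal ((f (\<beta> g x))\<^sup>2) \<le> ennreal (3/2 * (f x)\<^sup>2 + 3 * (f x - f (\<beta> g x))\<^sup>2)" by (rule ennreal_leI)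
      also have "\<dots> = ennreal (3/2) * ennreal ((f x)\<^sup>2) + 3 * ennreal ((f x - f (\<beta> g x))\<^sup>2)"
        by (subst ennreal_plus, simp, simp) (simp only: ennreal_mult' zero_le_power2 ennreal_mult''
          ennreal_numeral)
      finally show ?thesis using True x by simp
    qed simp
  qed
  also have "\<dots> = ennreal (3/2) * l2_sq_on A2 f + 3 * l2_sq (\<lambda>x. f x - f (\<beta> g x))"
    unfolding l2_sq_on_def l2_sq_def by (simp add: nn_integral_add nn_integral_cmult)
  finally have 1: "l2_sq_on (X - A1) f \<le> ennreal (3/2) * l2_sq_on A2 f + 3 * l2_sq (\<lambda>x. f x - f (\<beta> g x))" .
  have "l2_sq f \<le> (\<integral>\<^sup>+x. ennreal ((f x)\<^sup>2) * indicator A1 x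
    + ennreal ((f x)\<^sup>2) * indicator (X - A1) x \<partial>count_space UNIV)"
    unfolding l2_sq_def using f by (intro nn_integral_mono) (auto simp: indicator_def sub_prob_def)
  also have "\<dots> = l2_sq_on A1 f + l2_sq_on (X - A1) f" unfolding l2_sq_on_def by (simp add: nn_integral_add)
  also have "\<dots> \<le> ennreal (3/2) * l2_sq_on A1 f + (ennreal (3/2) * l2_sq_on A2 f
    + 3 * l2_sq (\<lambda>x. f x - f (\<beta> g x)))"
  proof (intro add_mono 1)
    have "1 * l2_sq_on A1 f \<le> ennreal (3/2) * l2_sq_on A1 f"
      by (intro mult_right_mono) (auto simp: ennreal_1[symmetric] ennreal_le_iff simp del: ennreal_1)
    thus "l2_sq_on A1 f \<le> ennreal (3/2) * l2_sq_on A1 f" by simp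
  qed
  finally show ?thesis by (simp add: distrib_left add.assoc)
qed

text \<open>Nonamenability. A function of small energy would have nearly all of its mass on \<open>A1 \<union> A2\<close> and also nearly
  all on the disjoint set \<open>B1 \<union> B2\<close>. Hence the energy is at least a fixed multiple of the squared norm,
  and the lazy operator dissipates that much.\<close>

lemma spectral_gap:
  assumes g: "g \<in> generate G (set_pmf \<mu>)" and h: "h \<in> generate G (set_pmf \<mu>)"
    and disj: "A1 \<inter> A2 = {}" "B1 \<inter> B2 = {}" "(A1 \<union> A2) \<inter> (B1 \<union> B2) = {}"
    and A: "\<And>p. p \<in> X \<Longrightarrow> p \<notin> A1 \<Longrightarrow> \<beta> (inv g) p \<in> A2"
    and B: "\<And>p. p \<in> X \<Longrightarrow> p \<notin> B1 \<Longrightarrow> \<beta> (inv h) p \<in> B2"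
  obtains \<rho> where "0 \<le> \<rho>" "\<rho> < 1"
    "\<And>f. sub_prob f \<Longrightarrow> l2_sq f < \<infinity> \<Longrightarrow> l2_sq (lazy f) \<le> ennreal \<rho> * l2_sq f"
proof -
  have gh: "g \<in> carrier G" "h \<in> carrier G" using g h generate_incl[OF supp] by auto
  obtain C D where C: "C \<ge> 0" "\<And>f. l2_sq (\<lambda>x. f x - f (\<beta> g x)) \<le> ennreal C * energy f"
    and D: "D \<ge> 0" "\<And>f. l2_sq (\<lambda>x. f x - f (\<beta> h x)) \<le> ennreal D * energy f"
    using displacement_le_energy[OF g] displacement_le_energy[OF h] by blast
  \<comment> \<open>Adding \<open>1\<close> keeps the contraction factor \<open>1 - 1 / (4 K)\<close> between \<open>0\<close> and \<open>1\<close>.\<close>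
  define K where "K = 6 * (C + D) + 1"
  have K: "K \<ge> 1" using C D by (simp add: K_def)
  have gap: "l2_sq (lazy f) \<le> ennreal (1 - 1 / (4 * K)) * l2_sq f" if f: "sub_prob f"
    and fin: "l2_sq f < \<infinity>" for f
  proof -
    have dis: "l2_sq (lazy f) + energy f / 4 \<le> l2_sq f" by (rule energy_dissipation[OF f])
    hence le: "l2_sq (lazy f) \<le> l2_sq f" "energy f / 4 \<le> l2_sq f"
      using order_trans[OF _ dis] by (auto simp: add_increasing add_increasing2)
    obtain n where n: "l2_sq f = ennreal n" "n \<ge> 0" using fin by (cases "l2_sq f") auto
    obtain l where l: "l2_sq (lazy f) = ennreal l" "l \<ge> 0" using fin le(1)
      by (cases "l2_sq (lazy f)") (auto simp: top_unique)
    have "energy f \<noteq> \<top>" using le(2) fin by (auto simp: ennreal_top_divide top_unique)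
    then obtain e where e: "energy f = ennreal e" "e \<ge> 0" by (cases "energy f") auto
    have r1: "l + e / 4 \<le> n"
    proof -
      have "energy f / 4 = ennreal (e / 4)" unfolding e(1) using divide_ennreal[of e 4] e(2) by simp
      hence "ennreal (l + e / 4) \<le> ennreal n" using dis l e n by (simp add: ennreal_plus)
      thus ?thesis using n by (simp add: ennreal_le_iff)
    qed
    have tot: "(l2_sq_on A1 f + l2_sq_on A2 f) + (l2_sq_on B1 f + l2_sq_on B2 f) \<le> l2_sq f"
    proof -
      have "(l2_sq_on A1 f + l2_sq_on A2 f) + (l2_sq_on B1 f + l2_sq_on B2 f)
          = (\<integral>\<^sup>+x. (ennreal ((f x)\<^sup>2) * indicator A1 x + ennreal ((f x)\<^sup>2) * indicator A2 x) + (ennreal ((f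
            x)\<^sup>2) * indicator B1 x + ennreal ((f x)\<^sup>2) * indicator B2 x) \<partial>count_space UNIV)"
        unfolding l2_sq_on_def by (simp add: nn_integral_add)
      also have "\<dots> \<le> l2_sq f"
        unfolding l2_sq_def using disj by (intro nn_integral_mono) (auto simp: indicator_def)
      finally show ?thesis .
    qed
    \<comment> \<open>The two ping-pong pairs together carry the mass only once, but each bounds it separately.\<close>
    have "l2_sq f + l2_sq f \<le> (ennreal (3/2) * (l2_sq_on A1 f + l2_sq_on A2 f) + 3 * (ennreal C * energy f))
      + (ennreal (3/2) * (l2_sq_on B1 f + l2_sq_on B2 f) + 3 * (ennreal D * energy f))"
      by (intro add_mono order_trans[OF paradoxical_half[OF gh(1) f A]] order_trans[OF paradoxical_half[OF gh(2)
        f B]] mult_left_mono C D order_refl) auto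
    also have "\<dots> = ennreal (3/2) * ((l2_sq_on A1 f + l2_sq_on A2 f) + (l2_sq_on B1 f + l2_sq_on B2 f))
      + (3 * (ennreal C * energy f) + 3 * (ennreal D * energy f))"
      by (simp add: distrib_left add_ac)
    also have "\<dots> \<le> ennreal (3/2) * l2_sq f + (3 * (ennreal C * energy f) + 3 * (ennreal D * energy f))"
      by (intro add_mono mult_left_mono tot) auto
    also have "\<dots> = ennreal (3/2 * n + (3 * (C * e) + 3 * (D * e)))"
      using C(1) D(1) n e
        by (simp only: ennreal_plus ennreal_mult ennreal_numeral mult_nonneg_nonneg add_nonneg_nonneg
          zero_le_numeral zero_le_divide_iff simp_thms)
    finally have "ennreal (n + n) \<le> ennreal (3/2 * n + (3 * (C * e) + 3 * (D * e)))"
      unfolding n(1) ennreal_plus[OF n(2) n(2), symmetric] .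
    hence "n + n \<le> 3/2 * n + (3 * (C * e) + 3 * (D * e))"
      by (subst (asm) ennreal_le_iff) (use C(1) D(1) n e in auto)
    hence "n \<le> 6 * (C + D) * e" by (simp add: algebra_simps)
    also have "\<dots> \<le> K * e" unfolding K_def using e by (simp add: algebra_simps)
    finally have "n / K \<le> e" using K by (simp add: divide_le_eq mult.commute)
    hence "l \<le> n - n / K / 4" using r1 by argo
    also have "\<dots> = (1 - 1 / (4 * K)) * n" by (simp add: algebra_simps)
    finally show ?thesis unfolding l(1) n(1) using K n(2) by (simp add: ennreal_mult'[symmetric] ennreal_leI)
  qed
  show ?thesis
  proof (rule that[of "1 - 1 / (4 * K)"])
    show "0 \<le> 1 - 1 / (4 * K)" "1 - 1 / (4 * K) < 1" using K by (auto simp: field_simps)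
  qed (rule gap)
qed

text \<open>A fixed point of \<open>avg\<close> is a fixed point of the contraction \<open>lazy\<close>.\<close>

lemma stationary_vanishes:
  assumes gap: "\<rho> < 1" "\<And>f. sub_prob f \<Longrightarrow> l2_sq f < \<infinity> \<Longrightarrow> l2_sq (lazy f) \<le> ennreal \<rho> * l2_sq f"
    and f: "sub_prob f" "l2_sq f < \<infinity>" "\<And>x. avg f x = f x"
  shows "f x = 0"
proof -
  have "lazy f = f" using f(3) by (simp add: lazy_def fun_eq_iff)
  hence le: "l2_sq f \<le> ennreal \<rho> * l2_sq f" using gap(2)[OF f(1,2)] by simp
  obtain n where n: "l2_sq f = ennreal n" "n \<ge> 0" using f(2) by (cases "l2_sq f") auto
  have "n = 0"
  proof (rule ccontr)
    assume "n \<noteq> 0"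
    hence "n > 0" using n by simp
    have "ennreal n \<le> ennreal (\<rho> * n)" using le n by (simp add: ennreal_mult'')
    hence "n \<le> \<rho> * n \<or> n \<le> 0" using \<open>n > 0\<close> by (cases "\<rho> * n \<ge> 0") (auto simp: ennreal_le_iff ennreal_neg)
    thus False using \<open>n > 0\<close> gap(1) by auto
  qed
  hence "ennreal ((f x)\<^sup>2) \<le> 0" using l2_sq_ge_point[of f x] n by simp
  thus ?thesis by simp
qed

text \<open>The lazy operator is \<open>(1 + avg) / 2\<close>, and all terms of the binomial expansion of its \<open>N\<close>-th power are
  nonnegative.\<close>

lemma binomial_lazy:
  assumes f: "sub_prob f"
  shows "sub_prob ((lazy ^^ N) f) \<and> sub_prob ((avg ^^ N) f)"
    and "real (N choose m) / 2 ^ N * (avg ^^ m) f x \<le> (lazy ^^ N) f x"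
proof -
  show sp: "sub_prob ((lazy ^^ N) f) \<and> sub_prob ((avg ^^ N) f)" for N
    by (induction N) (auto simp: f sub_prob_lazy sub_prob_avg)
  show "real (N choose m) / 2 ^ N * (avg ^^ m) f x \<le> (lazy ^^ N) f x"
  proof (induction N arbitrary: m x)
    case 0
    show ?case using f by (cases m) (auto simp: sub_prob_def)
  next
    case (Suc N)
    have IH: "real (N choose m) / 2 ^ N * (avg ^^ m) f x \<le> (lazy ^^ N) f x" by (rule Suc)
    have lazy_Suc: "(lazy ^^ Suc N) f x = ((lazy ^^ N) f x + avg ((lazy ^^ N) f) x) / 2"
      using lazy_def[of "(lazy ^^ N) f" x] by simp
    show ?case
    proof (cases m)
      case 0
      have "0 \<le> avg ((lazy ^^ N) f) x" using sub_prob_avg sp by (auto simp: sub_prob_def)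
      moreover have "real (Suc N choose m) / 2 ^ Suc N * (avg ^^ m) f x
        = (real (N choose m) / 2 ^ N * (avg ^^ m) f x) / 2"
        by (simp add: 0)
      moreover note lazy_Suc
      ultimately show ?thesis using IH by argo
    next
      case (Suc k)
      have IH2: "real (N choose k) / 2 ^ N * avg ((avg ^^ k) f) x \<le> avg ((lazy ^^ N) f) x"
        by (rule avg_mono) (use sp Suc.IH in auto)
      have "real (Suc N choose m) / 2 ^ Suc N * (avg ^^ m) f x
          = (real (N choose m) / 2 ^ N * (avg ^^ m) f x + real (N choose k) / 2 ^ N * avg ((avg ^^ k) f) x) / 2"
        by (simp add: Suc add_divide_distrib distrib_right)
      also have "\<dots> \<le> ((lazy ^^ N) f x + avg ((lazy ^^ N) f) x) / 2"
        by (intro divide_right_mono add_mono IH IH2) auto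
      finally show ?thesis unfolding lazy_Suc .
    qed
  qed
qed

text \<open>Compare with the central term of the binomial expansion for \<open>N = 2 m\<close>, whose weight is at least
  \<open>1 / (2 m)\<close>.\<close>

lemma density_decay:
  assumes gap: "0 \<le> \<rho>" "\<And>f. sub_prob f \<Longrightarrow> l2_sq f < \<infinity> \<Longrightarrow> l2_sq (lazy f) \<le> ennreal \<rho> * l2_sq f"
    and f: "sub_prob f" "l2_sq f \<le> 1" and m: "m > 0"
  shows "(avg ^^ m) f x \<le> 2 * real m * \<rho> ^ m"
proof -
  have dec: "l2_sq ((lazy ^^ k) f) \<le> ennreal (\<rho> ^ k)" for k
  proof (induction k)
    case (Suc k)
    have "l2_sq ((lazy ^^ k) f) < \<infinity>" using Suc by (auto simp: le_less_trans)
    hence "l2_sq ((lazy ^^ Suc k) f) \<le> ennreal \<rho> * l2_sq ((lazy ^^ k) f)" using gap(2) binomial_lazy(1)[OF f(1)]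
      by simp
    also have "\<dots> \<le> ennreal \<rho> * ennreal (\<rho> ^ k)" by (intro mult_left_mono Suc) auto
    finally show ?case using gap(1) by (simp add: ennreal_mult')
  qed (use f in simp)
  have "ennreal (((lazy ^^ (2 * m)) f x)\<^sup>2) \<le> ennreal (\<rho> ^ (2 * m))"
    by (rule order_trans[OF l2_sq_ge_point dec])
  hence "((lazy ^^ (2 * m)) f x)\<^sup>2 \<le> (\<rho> ^ m)\<^sup>2" using gap(1)
    by (simp add: ennreal_le_iff power_mult[symmetric] mult.commute)
  hence l: "(lazy ^^ (2 * m)) f x \<le> \<rho> ^ m" by (rule power2_le_imp_le) (use gap(1) in simp)
  have a: "(avg ^^ m) f x \<ge> 0" using binomial_lazy(1)[OF f(1)] by (auto simp: sub_prob_def)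
  have "4 ^ m / (2 * real m) / 2 ^ (2 * m) * (avg ^^ m) f x
    \<le> real ((2 * m) choose m) / 2 ^ (2 * m) * (avg ^^ m) f x"
    using a central_binomial_lower_bound[OF m] by (intro mult_right_mono divide_right_mono) auto
  also have "\<dots> \<le> \<rho> ^ m" using order_trans[OF binomial_lazy(2)[OF f(1)] l] .
  finally have "(avg ^^ m) f x / (2 * real m) \<le> \<rho> ^ m" by (simp add: power_mult)
  thus ?thesis using m by (simp add: divide_le_eq mult_ac)
qed

end

section \<open>The random walk\<close>

locale hyp_walk =
  fixes \<mu> :: "(real ^ 'n \<Rightarrow> real ^ 'n) pmf" and x :: "real ^ 'n"
  assumes supp: "set_pmf \<mu> \<subseteq> carrier hyp_isom" and x: "x \<in> hyp_space"
begin

sublocale averaging hyp_isom \<mu> "\<lambda>g. bext (inv\<^bsub>hyp_isom\<^esub> g)" "cball 0 1"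
proof -
  interpret group "hyp_isom :: (real ^ 'n \<Rightarrow> real ^ 'n) monoid" by (rule group_hyp_isom)
  show "averaging hyp_isom \<mu> (\<lambda>g. bext (inv\<^bsub>hyp_isom\<^esub> g)) (cball 0 1)"
  proof
    show "bext (inv\<^bsub>hyp_isom\<^esub> \<one>\<^bsub>hyp_isom\<^esub>) z = z" for z :: "real ^ 'n" by (simp add: bext_one)
    fix g h :: "real ^ 'n \<Rightarrow> real ^ 'n" and z
    assume g: "g \<in> carrier hyp_isom" 
    show "(bext (inv\<^bsub>hyp_isom\<^esub> g) z \<in> cball 0 1) = (z \<in> cball 0 1)" by (rule bext_cball_iff) (use g in simp)
    assume h: "h \<in> carrier hyp_isom"
    show "bext (inv\<^bsub>hyp_isom\<^esub> (g \<otimes>\<^bsub>hyp_isom\<^esub> h)) z = bext (inv\<^bsub>hyp_isom\<^esub> h) (bext (inv\<^bsub>hyp_isom\<^esub> g) z)"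
      using g h by (simp add: inv_mult_group bext_mult)
  qed (rule supp)
qed

abbreviation "step \<equiv> restrict_space (measure_pmf \<mu>) (set_pmf \<mu>)"

lemma space_step: "space step = set_pmf \<mu>"
  by (simp add: space_restrict_space)

lemma sets_step: "sets step = Pow (set_pmf \<mu>)"
  by (auto simp: sets_restrict_space image_iff)

lemma prob_space_step: "prob_space step"
proof
  have "emeasure step (set_pmf \<mu>) = emeasure (measure_pmf \<mu>) (set_pmf \<mu>)"
    by (subst emeasure_restrict_space) auto
  thus "emeasure step (space step) = 1" unfolding space_step
    by (simp add: measure_pmf.emeasure_eq_measure measure_pmf.prob_eq_1 AE_measure_pmf)
qed

sublocale steps: sequence_space step
proof -
  interpret prob_space step by (rule prob_space_step)
  show "sequence_space step" by unfold_locales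
qed

lemma increments_eq: "increments \<mu> = PiM UNIV (\<lambda>_. step)"
  by (simp add: increments_def)

lemma prob_space_increments: "prob_space (increments \<mu>)"
  unfolding increments_eq by (rule steps.prob_space_axioms)

sublocale I: prob_space "increments \<mu>" by (rule prob_space_increments)

lemma space_increments: "space (increments \<mu>) = {\<omega>. \<forall>i. \<omega> i \<in> set_pmf \<mu>}"
  unfolding increments_eq by (auto simp: space_PiM space_step PiE_iff)

lemma measurable_step: "(\<lambda>\<omega>. \<omega> i) \<in> measurable (increments \<mu>) (count_space (set_pmf \<mu>))"
proof -
  have "(\<lambda>\<omega>. \<omega> i) \<in> measurable (increments \<mu>) step"
    unfolding increments_eq by measurable
  moreover have "(\<lambda>g. g) \<in> measurable step (count_space (set_pmf \<mu>))"
    by (rule measurableI) (auto simp: space_step sets_step)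
  ultimately show ?thesis by (rule measurable_compose)
qed

lemma walk_measurable: "(\<lambda>\<omega>. walk \<omega> m) \<in> measurable (increments \<mu>) (count_space UNIV)"
proof (induction m)
  case (Suc m)
  have "(\<lambda>\<omega>. walk \<omega> m \<otimes>\<^bsub>hyp_isom\<^esub> \<omega> m) \<in> measurable (increments \<mu>) (count_space UNIV)"
  proof (rule measurable_compose_countable'[where I = "set_pmf \<mu>" and g = "\<lambda>\<omega>. \<omega> m"
    and f = "\<lambda>s \<omega>. walk \<omega> m \<otimes>\<^bsub>hyp_isom\<^esub> s"])
    show "(\<lambda>\<omega>. walk \<omega> m \<otimes>\<^bsub>hyp_isom\<^esub> s) \<in> measurable (increments \<mu>) (count_space UNIV)" for s
      using measurable_compose[OF Suc, of "\<lambda>w. w \<otimes>\<^bsub>hyp_isom\<^esub> s" "count_space UNIV"] by simp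
  qed (auto intro: measurable_step countable_set_pmf)
  thus ?case by simp
qed simp

definition pos :: "(nat \<Rightarrow> real ^ 'n \<Rightarrow> real ^ 'n) \<Rightarrow> nat \<Rightarrow> real ^ 'n" where
  "pos \<omega> m = walk \<omega> m x"

lemma pos_measurable_discrete: "(\<lambda>\<omega>. pos \<omega> m) \<in> measurable (increments \<mu>) (count_space UNIV)"
  using measurable_compose[OF walk_measurable, of "\<lambda>w. w x" "count_space UNIV" m] by (simp add: pos_def)

lemma pos_measurable [measurable]: "(\<lambda>\<omega>. pos \<omega> m) \<in> borel_measurable (increments \<mu>)"
  using measurable_compose[OF pos_measurable_discrete, of "\<lambda>z. z" borel m] by simp

lemma walk_carrier: "(\<And>i. \<omega> i \<in> set_pmf \<mu>) \<Longrightarrow> walk \<omega> m \<in> carrier hyp_isom"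
proof (induction m)
  case (Suc m)
  thus ?case using supp by (simp add: subset_iff)
qed simp

lemma pos_hyp_space:
  assumes "\<And>i. \<omega> i \<in> set_pmf \<mu>" shows "pos \<omega> m \<in> hyp_space"
  unfolding pos_def by (rule hyp_isom_closed[OF walk_carrier[OF assms] x])

lemma walk_shift:
  assumes s: "s \<in> carrier hyp_isom" and w: "\<And>i. \<omega> i \<in> set_pmf \<mu>"
  shows "walk (case_nat s \<omega>) (Suc m) = s \<otimes>\<^bsub>hyp_isom\<^esub> walk \<omega> m"
proof (induction m)
  case (Suc m)
  have "\<omega> m \<in> carrier hyp_isom" using w supp by auto
  thus ?case using Suc s walk_carrier[of \<omega> m, OF w] by (simp add: m_assoc)
qed (use s in simp)

lemma pos_shift:
  assumes s: "s \<in> carrier hyp_isom" and w: "\<And>i. \<omega> i \<in> set_pmf \<mu>"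
  shows "pos (case_nat s \<omega>) (Suc m) = s (pos \<omega> m)"
  unfolding pos_def walk_shift[OF assms] by (rule hyp_isom_mult_apply[OF s walk_carrier[OF w] x])

lemma hdist_pos_Suc:
  assumes w: "\<And>i. \<omega> i \<in> set_pmf \<mu>"
  shows "hdist (pos \<omega> m) (pos \<omega> (Suc m)) = hdist x (\<omega> m x)"
proof -
  have c: "\<omega> m \<in> carrier hyp_isom" using w supp by auto
  have "pos \<omega> (Suc m) = walk \<omega> m (\<omega> m x)"
    unfolding pos_def using hyp_isom_mult_apply[OF walk_carrier[OF w] c x] by simp
  thus ?thesis unfolding pos_def using hdist_isom[OF walk_carrier[OF w] x hyp_isom_closed[OF c x]] by simp
qed

text \<open>The increments after the first one have the same law as all increments and are independent of the first.\<close>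

lemma prob_first_step:
  assumes A: "{\<omega> \<in> space (increments \<mu>). P \<omega>} \<in> sets (increments \<mu>)"
  shows "\<P>(\<omega> in increments \<mu>. P \<omega>)
    = measure_pmf.expectation \<mu> (\<lambda>s. \<P>(\<omega> in increments \<mu>. P (case_nat s \<omega>)))"
proof -
  let ?I = "increments \<mu>" and ?A = "{\<omega> \<in> space (increments \<mu>). P \<omega>}"
  let ?f = "\<lambda>(s, \<omega>). case_nat s \<omega>"
  have f: "?f \<in> measurable (step \<Otimes>\<^sub>M ?I) ?I" unfolding increments_eq by measurable
  have "emeasure ?I ?A = emeasure (distr (step \<Otimes>\<^sub>M ?I) ?I ?f) ?A"
    using steps.PiM_iter unfolding increments_eq by simp
  also have "\<dots> = emeasure (step \<Otimes>\<^sub>M ?I) (?f -` ?A \<inter> space (step \<Otimes>\<^sub>M ?I))"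
    by (rule emeasure_distr[OF f A])
  also have "\<dots> = (\<integral>\<^sup>+s. emeasure ?I (Pair s -` (?f -` ?A \<inter> space (step \<Otimes>\<^sub>M ?I))) \<partial>step)"
    by (rule I.emeasure_pair_measure_alt[OF measurable_sets[OF f A]])
  also have "\<dots> = (\<integral>\<^sup>+s. emeasure ?I {\<omega> \<in> space ?I. P (case_nat s \<omega>)} \<partial>step)"
  proof (rule nn_integral_cong)
    fix s assume "s \<in> space step"
    hence "Pair s -` (?f -` ?A \<inter> space (step \<Otimes>\<^sub>M ?I)) = {\<omega> \<in> space ?I. P (case_nat s \<omega>)}"
      by (auto simp: space_pair_measure space_step space_increments split: nat.split)
    thus "emeasure ?I (Pair s -` (?f -` ?A \<inter> space (step \<Otimes>\<^sub>M ?I)))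
      = emeasure ?I {\<omega> \<in> space ?I. P (case_nat s \<omega>)}" by simp
  qed
  also have "\<dots> = (\<integral>\<^sup>+s. emeasure ?I {\<omega> \<in> space ?I. P (case_nat s \<omega>)} * indicator (set_pmf \<mu>) s \<partial>measure_pmf \<mu>)"
    by (rule nn_integral_restrict_space) simp
  also have "\<dots> = (\<integral>\<^sup>+s. ennreal (\<P>(\<omega> in ?I. P (case_nat s \<omega>))) \<partial>measure_pmf \<mu>)"
    by (intro nn_integral_cong_AE) (auto simp: AE_measure_pmf_iff I.emeasure_eq_measure)
  also have "\<dots> = ennreal (measure_pmf.expectation \<mu> (\<lambda>s. \<P>(\<omega> in ?I. P (case_nat s \<omega>))))"
    by (intro nn_integral_eq_integral measure_pmf.integrable_const_bound[where B=1]) auto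
  finally have "ennreal (measure ?I ?A) = ennreal (measure_pmf.expectation \<mu> (\<lambda>s. \<P>(\<omega> in ?I. P (case_nat s
    \<omega>))))"
    by (simp add: I.emeasure_eq_measure)
  thus ?thesis by (subst (asm) ennreal_inj) (auto intro!: integral_nonneg_AE)
qed

lemma isom_apply_eq_iff:
  assumes s: "s \<in> carrier hyp_isom" and y: "y \<in> hyp_space"
  shows "s y = z \<longleftrightarrow> y = bext (inv\<^bsub>hyp_isom\<^esub> s) z"
  using bext_hyp_space[OF s y] bext_inv[OF s] by metis

text \<open>The positions at time \<open>m + 1\<close> are obtained by letting the first increment act on the positions at time \<open>m\<close>,
  which is what \<open>avg\<close> describes.\<close>

lemma law_pos:
  "\<P>(\<omega> in increments \<mu>. pos \<omega> m = z) = (avg ^^ m) (indicator {x}) z"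
proof (induction m arbitrary: z)
  case 0
  have "{\<omega> \<in> space (increments \<mu>). pos \<omega> 0 = z} = (if x = z then space (increments \<mu>) else {})"
    by (auto simp: pos_def hyp_isom_one_apply[OF x])
  thus ?case by (auto simp: indicator_def I.prob_space)
next
  case (Suc m)
  have "\<P>(\<omega> in increments \<mu>. pos \<omega> (Suc m) = z)
      = measure_pmf.expectation \<mu> (\<lambda>s. \<P>(\<omega> in increments \<mu>. pos (case_nat s \<omega>) (Suc m) = z))"
    by (rule prob_first_step) measurable
  also have "\<dots> = measure_pmf.expectation \<mu> (\<lambda>s. (avg ^^ m) (indicator {x}) (bext (inv\<^bsub>hyp_isom\<^esub> s) z))"
  proof (intro integral_cong_AE, simp, simp, unfold AE_measure_pmf_iff, intro ballI)
    fix s assume "s \<in> set_pmf \<mu>"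
    hence s: "s \<in> carrier hyp_isom" using supp by auto
    have "pos (case_nat s \<omega>) (Suc m) = z \<longleftrightarrow> pos \<omega> m = bext (inv\<^bsub>hyp_isom\<^esub> s) z"
      if "\<omega> \<in> space (increments \<mu>)" for \<omega>
      using that pos_shift[OF s, of \<omega> m] isom_apply_eq_iff[OF s pos_hyp_space[of \<omega> m]]
        by (simp add: space_increments)
    hence "{\<omega> \<in> space (increments \<mu>). pos (case_nat s \<omega>) (Suc m) = z} = {\<omega> \<in> space (increments \<mu>). pos \<omega> m
      = bext (inv\<^bsub>hyp_isom\<^esub> s) z}"
      by blast
    thus "\<P>(\<omega> in increments \<mu>. pos (case_nat s \<omega>) (Suc m) = z)
      = (avg ^^ m) (indicator {x}) (bext (inv\<^bsub>hyp_isom\<^esub> s) z)"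
      using Suc by simp
  qed
  also have "\<dots> = (avg ^^ Suc m) (indicator {x}) z" by (simp add: avg_def)
  finally show ?case .
qed

lemma indicator_sub_prob: "sub_prob (indicator {x})" "l2_sq (indicator {x}) \<le> 1"
proof -
  show "sub_prob (indicator {x})" using hyp_space_subset_cball[OF x] by (auto simp: sub_prob_def indicator_def)
  have "l2_sq (indicator {x} :: real ^ 'n \<Rightarrow> real) = (\<integral>\<^sup>+z. 1 * indicator {x} z \<partial>count_space UNIV)"
    unfolding l2_sq_def by (intro nn_integral_cong) (auto simp: indicator_def)
  also have "\<dots> = 1" by (subst nn_integral_indicator_singleton) auto
  finally show "l2_sq (indicator {x}) \<le> 1" by simp
qed

lemma summable_nat_times_geometric:
  fixes r :: real assumes "0 \<le> r" "r < 1"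
  shows "summable (\<lambda>m. real m * r ^ m)"
proof -
  have "summable (\<lambda>m. real (Suc m) * r ^ m)" using geometric_deriv_sums[of r] assms by (auto simp: sums_iff)
  thus ?thesis by (rule summable_comparison_test') (use assms in \<open>auto intro!: mult_right_mono\<close>)
qed

section \<open>Escape and convergence to the boundary\<close>

text \<open>Each point carries mass at most \<open>2 m \<rho>\<^sup>m\<close> at time \<open>m\<close>, and only exponentially many points of the orbit lie
  within distance \<open>c m\<close>. For small \<open>c\<close> the product is summable, and the Borel-Cantelli lemma applies.\<close>

lemma linear_escape:
  assumes gap: "0 \<le> \<rho>" "\<rho> < 1" "\<And>f. sub_prob f \<Longrightarrow> l2_sq f < \<infinity> \<Longrightarrow> l2_sq (lazy f) \<le> ennreal \<rho> * l2_sq f"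
    and growth: "a > 0" "\<And>R. finite {z \<in> Orb. hdist 0 z \<le> R}"
      "\<And>R. R \<ge> 0 \<Longrightarrow> real (card {z \<in> Orb. hdist 0 z \<le> R}) \<le> C * exp (a * R)"
    and orb: "\<And>\<omega> m. \<omega> \<in> space (increments \<mu>) \<Longrightarrow> pos \<omega> m \<in> Orb"
  obtains c where "c > 0" "AE \<omega> in increments \<mu>. \<forall>\<^sub>F m in sequentially. hdist 0 (pos \<omega> m) > c * real m"
proof -
  \<comment> \<open>The lower bound \<open>1/2\<close> makes the logarithm available when \<open>\<rho> = 0\<close>.\<close>
  define r where "r = max \<rho> (1/2)"
  have r: "r > 0" "r < 1" "\<rho> \<le> r" using gap by (auto simp: r_def)
  \<comment> \<open>Chosen so that the growth \<open>exp (a c m)\<close> of the orbit costs only half of the decay \<open>r\<^sup>m\<close>.\<close>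
  define c where "c = - ln r / (2 * a)"
  have c: "c > 0" using r growth(1) by (simp add: c_def divide_neg_pos)
  define q where "q = sqrt r"
  have q: "q \<ge> 0" "q < 1" "q * q = r" "q > 0" using r by (auto simp: q_def real_sqrt_lt_1_iff)
  have ac: "exp (a * c) = 1 / q"
  proof -
    have "exp (a * c) = exp (- (ln r / 2))" using growth(1) by (simp add: c_def)
    also have "ln r / 2 = ln q" using r by (simp add: q_def ln_sqrt)
    finally show ?thesis using q by (simp add: exp_minus inverse_eq_divide)
  qed
  have C: "C \<ge> 0" using growth(3)[of 0] by (auto intro: order_trans[rotated])
  let ?A = "\<lambda>m. {\<omega> \<in> space (increments \<mu>). hdist 0 (pos \<omega> m) \<le> c * real m}"
  have meas: "?A m \<in> sets (increments \<mu>)" for m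
    using measurable_sets[OF pos_measurable_discrete, of "{z. hdist 0 z \<le> c * real m}" m]
    by (auto simp: vimage_def Int_def conj_commute)
  have bound: "measure (increments \<mu>) (?A m) \<le> 2 * C * (real m * q ^ m)" if m: "m > 0" for m
  proof -
    let ?B = "{z \<in> Orb. hdist 0 z \<le> c * real m}"
    have ms: "{\<omega> \<in> space (increments \<mu>). pos \<omega> m = z} \<in> sets (increments \<mu>)" for z by measurable
    have "measure (increments \<mu>) (?A m) \<le> measure (increments \<mu>) (\<Union>z\<in>?B. {\<omega> \<in> space (increments \<mu>). pos \<omega> m
      = z})"
      using orb ms growth(2) by (intro I.finite_measure_mono sets.finite_UN) auto
    also have "\<dots> \<le> (\<Sum>z\<in>?B. \<P>(\<omega> in increments \<mu>. pos \<omega> m = z))"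
      using ms growth(2) by (intro I.finite_measure_subadditive_finite) auto
    also have "\<dots> \<le> (\<Sum>z\<in>?B. 2 * real m * \<rho> ^ m)"
      unfolding law_pos by (intro sum_mono density_decay[OF gap(1,3) indicator_sub_prob m])
    also have "\<dots> = real (card ?B) * (2 * real m * \<rho> ^ m)" by simp
    also have "\<dots> \<le> (C * exp (a * (c * real m))) * (2 * real m * r ^ m)"
      using growth(3)[of "c * real m"] c gap(1) r C by (intro mult_mono power_mono) auto
    also have "exp (a * (c * real m)) = (1 / q) ^ m"
      unfolding ac[symmetric] exp_of_nat_mult[symmetric] by (simp add: mult_ac)
    also have "(C * (1 / q) ^ m) * (2 * real m * r ^ m) = 2 * C * (real m * ((1 / q) ^ m * (q * q) ^ m))"
      by (simp add: q(3))
    also have "(1 / q) ^ m * (q * q) ^ m = q ^ m" using q(4) by (simp add: power_mult_distrib[symmetric])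
    finally show ?thesis .
  qed
  have "summable (\<lambda>m. measure (increments \<mu>) (?A m))"
  proof (rule summable_comparison_test'[where N=1])
    show "summable (\<lambda>m. 2 * C * (real m * q ^ m))" by (intro summable_mult summable_nat_times_geometric q)
  qed (use bound in auto)
  hence "AE \<omega> in increments \<mu>. \<forall>\<^sub>F m in sequentially. \<omega> \<in> space (increments \<mu>) - ?A m"
    by (intro borel_cantelli_AE1 meas) (auto simp: I.emeasure_eq_measure)
  hence "AE \<omega> in increments \<mu>. \<forall>\<^sub>F m in sequentially. hdist 0 (pos \<omega> m) > c * real m"
    by (rule AE_mp) (auto intro!: AE_I2 elim!: eventually_mono)
  with c that show ?thesis by blast
qed

text \<open>A first moment bounds the sum over \<open>m\<close> of the probabilities that a step is longer than \<open>c m\<close>.\<close>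

lemma sublinear_steps:
  assumes int: "integrable (measure_pmf \<mu>) (\<lambda>s. hdist x (s x))" and c: "c > 0"
  shows "AE \<omega> in increments \<mu>. \<forall>\<^sub>F m in sequentially. hdist x (\<omega> m x) \<le> c * real m"
proof -
  let ?A = "\<lambda>m. {\<omega> \<in> space (increments \<mu>). \<not> hdist x (\<omega> m x) \<le> c * real m}"
  let ?B = "\<lambda>m. {s. \<not> hdist x (s x) \<le> c * real m}"
  have meas: "?A m \<in> sets (increments \<mu>)" for m
    using measurable_sets[OF measurable_step, of "?B m \<inter> set_pmf \<mu>" m]
    by (simp add: vimage_def Int_def conj_commute space_increments cong: conj_cong)
  have eq: "measure (increments \<mu>) (?A m) = measure (measure_pmf \<mu>) (?B m)" for m
  proof -
    have mc: "(\<lambda>\<omega>. \<omega> m) \<in> measurable (increments \<mu>) step" unfolding increments_eq by measurable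
    have "measure step (?B m \<inter> set_pmf \<mu>) = measure (distr (increments \<mu>) step (\<lambda>\<omega>. \<omega> m)) (?B m \<inter> set_pmf \<mu>)"
      unfolding increments_eq by (subst steps.PiM_component) auto
    also have "\<dots> = measure (increments \<mu>) ((\<lambda>\<omega>. \<omega> m) -` (?B m \<inter> set_pmf \<mu>) \<inter> space (increments \<mu>))"
      by (rule measure_distr[OF mc]) (simp add: sets_step)
    also have "(\<lambda>\<omega>. \<omega> m) -` (?B m \<inter> set_pmf \<mu>) \<inter> space (increments \<mu>) = ?A m"
      by (auto simp: space_increments)
    finally have "measure (increments \<mu>) (?A m) = measure step (?B m \<inter> set_pmf \<mu>)" by simp
    also have "\<dots> = measure (measure_pmf \<mu>) (?B m \<inter> set_pmf \<mu>)" by (rule measure_restrict_space) auto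
    also have "\<dots> = measure (measure_pmf \<mu>) (?B m)" by (rule measure_Int_set_pmf)
    finally show ?thesis .
  qed
  have "summable (\<lambda>m. measure (measure_pmf \<mu>) (?B m))"
  proof (rule bounded_imp_summable)
    fix N
    have "(\<Sum>m\<le>N. measure (measure_pmf \<mu>) (?B m)) = (\<Sum>m\<le>N. measure_pmf.expectation \<mu> (indicator (?B m)))"
      by simp
    also have "\<dots> = measure_pmf.expectation \<mu> (\<lambda>s. \<Sum>m\<le>N. indicator (?B m) s)"
      by (rule Bochner_Integration.integral_sum[symmetric])
        (intro measure_pmf.integrable_const_bound[where B=1], auto simp: indicator_def)
    also have "\<dots> \<le> measure_pmf.expectation \<mu> (\<lambda>s. hdist x (s x) / c + 1)"
    proof (rule integral_mono_AE)
      show "integrable (measure_pmf \<mu>) (\<lambda>s. hdist x (s x) / c + 1)" using int by auto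
      show "AE s in measure_pmf \<mu>. (\<Sum>m\<le>N. indicator (?B m) s) \<le> hdist x (s x) / c + 1"
        unfolding AE_measure_pmf_iff
      proof
        fix s assume "s \<in> set_pmf \<mu>"
        hence "s \<in> carrier hyp_isom" using supp by blast
        hence s: "hdist x (s x) \<ge> 0" by (rule hdist_nonneg[OF x hyp_isom_closed[OF _ x]])
        \<comment> \<open>The step \<open>s\<close> is longer than \<open>c m\<close> only for \<open>m \<le> k\<close>.\<close>
        define k where "k = nat \<lfloor>hdist x (s x) / c\<rfloor>"
        have k: "real k \<le> hdist x (s x) / c" using s c by (simp add: k_def)
        have "(\<Sum>m\<le>N. indicator (?B m) s) = (\<Sum>m\<in>{m\<in>{..N}. s \<in> ?B m}. 1 :: real)"
          by (simp add: indicator_def sum.If_cases Int_def)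
        also have "\<dots> = real (card {m\<in>{..N}. s \<in> ?B m})" by simp
        also have "\<dots> \<le> real (card {..k})"
        proof (intro of_nat_mono card_mono)
          show "{m\<in>{..N}. s \<in> ?B m} \<subseteq> {..k}"
          proof
            fix m assume "m \<in> {m\<in>{..N}. s \<in> ?B m}"
            hence "real m < hdist x (s x) / c" using c by (simp add: field_simps)
            thus "m \<in> {..k}" by (simp add: k_def le_nat_floor)
          qed
        qed simp
        also have "\<dots> \<le> hdist x (s x) / c + 1" using k by simp
        finally show "(\<Sum>m\<le>N. indicator (?B m) s) \<le> hdist x (s x) / c + 1" .
      qed
    qed (intro Bochner_Integration.integrable_sum measure_pmf.integrable_const_bound[where B=1], auto simp:
      indicator_def)
    finally show "(\<Sum>m\<le>N. measure (measure_pmf \<mu>) (?B m)) \<le> measure_pmf.expectation \<mu> (\<lambda>s. hdist x (s x) / c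
      + 1)" .
  qed simp
  hence "AE \<omega> in increments \<mu>. \<forall>\<^sub>F m in sequentially. \<omega> \<in> space (increments \<mu>) - ?A m"
    unfolding eq[symmetric] by (intro borel_cantelli_AE1 meas) (auto simp: I.emeasure_eq_measure)
  thus ?thesis
    by (rule AE_mp) (auto intro!: AE_I2 elim!: eventually_mono)
qed

text \<open>Successive positions have distance at most \<open>c m\<close>, while both are at distance more than \<open>c m\<close> from the origin;
  their Gromov product is at least \<open>c m / 2\<close>, so their Euclidean distance decays geometrically.\<close>

lemma converges_to_boundary:
  assumes w: "\<And>i. \<omega> i \<in> set_pmf \<mu>" and c: "c > 0"
    and esc: "\<forall>\<^sub>F m in sequentially. hdist 0 (pos \<omega> m) > c * real m"
    and st: "\<forall>\<^sub>F m in sequentially. hdist x (\<omega> m x) \<le> c * real m"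
  shows "\<exists>\<xi>\<in>hyp_boundary. pos \<omega> \<longlonglongrightarrow> \<xi>"
proof -
  define b where "b = exp (- c / 2)"
  have b: "0 < b" "b < 1" using c by (auto simp: b_def)
  have "\<forall>\<^sub>F m in sequentially. hdist 0 (pos \<omega> m) > c * real m \<and> hdist 0 (pos \<omega> (Suc m)) > c * real (Suc m)
    \<and> hdist x (\<omega> m x) \<le> c * real m"
    using esc st eventually_sequentially_Suc[of "\<lambda>m. hdist 0 (pos \<omega> m) > c * real m"]
      by (intro eventually_conj) auto
  hence step: "\<forall>\<^sub>F m in sequentially. norm (pos \<omega> (Suc m) - pos \<omega> m) \<le> 4 * b ^ m"
  proof eventually_elim
    case (elim m)
    show ?case
    proof (rule power2_le_imp_le)
      have "(norm (pos \<omega> (Suc m) - pos \<omega> m))\<^sup>2 = (norm (pos \<omega> m - pos \<omega> (Suc m)))\<^sup>2"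
        by (simp add: norm_minus_commute)
      also have "\<dots> \<le> 16 * exp (hdist (pos \<omega> m) (pos \<omega> (Suc m)) - hdist 0 (pos \<omega> m) - hdist 0 (pos \<omega> (Suc m)))"
        by (rule norm_diff_le_hdist[OF pos_hyp_space[OF w] pos_hyp_space[OF w]])
      also have "\<dots> \<le> 16 * exp (- (c * real m))"
        unfolding hdist_pos_Suc[OF w] using elim c by (simp add: algebra_simps)
      also have "exp (- (c * real m)) = b ^ (m * 2)"
        unfolding b_def exp_of_nat_mult[symmetric] by simp
      also have "16 * b ^ (m * 2) = (4 * b ^ m)\<^sup>2" by (simp add: power_mult_distrib power_mult)
      finally show "(norm (pos \<omega> (Suc m) - pos \<omega> m))\<^sup>2 \<le> (4 * b ^ m)\<^sup>2" .
    qed (use b in simp)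
  qed
  have "summable (\<lambda>m. 4 * b ^ m)" using b by (intro summable_mult summable_geometric) auto
  hence "summable (\<lambda>m. pos \<omega> (Suc m) - pos \<omega> m)" by (rule summable_comparison_test_ev[OF step])
  hence "convergent (\<lambda>N. \<Sum>m<N. pos \<omega> (Suc m) - pos \<omega> m)" by (simp add: summable_iff_convergent)
  then obtain L where "(\<lambda>N. pos \<omega> N - pos \<omega> 0) \<longlonglongrightarrow> L"
    unfolding sum_lessThan_telescope by (auto simp: convergent_def)
  hence lim: "pos \<omega> \<longlonglongrightarrow> L + pos \<omega> 0"
    using tendsto_add[OF _ tendsto_const, of "\<lambda>N. pos \<omega> N - pos \<omega> 0" L sequentially "pos \<omega> 0"] by simp
  have "filterlim (\<lambda>m. c * real m) at_top sequentially" using c by real_asymp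
  hence "filterlim (\<lambda>m. hdist 0 (pos \<omega> m)) at_top sequentially"
    by (rule filterlim_at_top_mono) (use esc in \<open>auto elim: eventually_mono\<close>)
  from tendsto_hyp_boundary[OF pos_hyp_space[OF w] this lim]
  have "norm (L + pos \<omega> 0) = 1" by simp
  thus ?thesis using lim by (intro bexI[of _ "L + pos \<omega> 0"]) (auto simp: hyp_boundary_def)
qed

section \<open>The harmonic measure has no atoms\<close>

lemma boundary_lim_eq: "pos \<omega> \<longlonglongrightarrow> \<xi> \<Longrightarrow> \<xi> \<in> hyp_boundary \<Longrightarrow> boundary_lim (pos \<omega>) = \<xi>"
  unfolding boundary_lim_def using limI by auto

lemma hyp_boundary_nonempty: "\<exists>\<xi>. \<xi> \<in> (hyp_boundary :: (real ^ 'n) set)"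
  using vector_choose_size[of 1] by (auto simp: hyp_boundary_def)

lemma boundary_lim_in: "boundary_lim X \<in> (hyp_boundary :: (real ^ 'n) set)"
  unfolding boundary_lim_def using limI someI_ex[OF hyp_boundary_nonempty] by auto

lemma Cauchy_pos_measurable [measurable]: "Measurable.pred (increments \<mu>) (\<lambda>\<omega>. Cauchy (pos \<omega>))"
  using sets_Collect_Cauchy[of "\<lambda>i \<omega>. pos \<omega> i" "increments \<mu>"] pos_measurable by (simp add: pred_def)

lemma lim_pos_measurable [measurable]: "(\<lambda>\<omega>. lim (pos \<omega>)) \<in> borel_measurable (increments \<mu>)"
  using borel_measurable_lim_metric[of "\<lambda>i \<omega>. pos \<omega> i" "increments \<mu>"] pos_measurable by simp

text \<open>Convergence to a boundary point is expressed by the Cauchy property and the norm of the limit, which are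
  measurable.\<close>

lemma boundary_lim_measurable:
  "(\<lambda>\<omega>. boundary_lim (pos \<omega>)) \<in> measurable (increments \<mu>) (restrict_space borel hyp_boundary)"
proof (rule measurable_restrict_space2)
  have eq: "(\<exists>\<xi>\<in>hyp_boundary. X \<longlonglongrightarrow> \<xi>) \<longleftrightarrow> Cauchy X \<and> norm (lim X) = 1" for X :: "nat \<Rightarrow> real ^ 'n"
    by (auto simp: Cauchy_convergent_iff convergent_LIMSEQ_iff hyp_boundary_def dest: limI intro!: convergentI)
  have "(\<lambda>\<omega>. if Cauchy (pos \<omega>) \<and> norm (lim (pos \<omega>))
    = 1 then lim (pos \<omega>) else (SOME \<xi>. \<xi> \<in> hyp_boundary)) \<in> borel_measurable (increments \<mu>)"
    by measurable
  thus "(\<lambda>\<omega>. boundary_lim (pos \<omega>)) \<in> borel_measurable (increments \<mu>)"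
    unfolding boundary_lim_def eq .
qed (use boundary_lim_in in blast)

lemma harmonic_measure_eq: "harmonic_measure \<mu> x
  = distr (increments \<mu>) (restrict_space borel hyp_boundary) (\<lambda>\<omega>. boundary_lim (pos \<omega>))"
  unfolding harmonic_measure_def pos_def ..

lemma prob_space_harmonic: "prob_space (harmonic_measure \<mu> x)"
  unfolding harmonic_measure_eq by (rule I.prob_space_distr[OF boundary_lim_measurable])

lemma sets_harmonic: "sets (harmonic_measure \<mu> x) = sets (restrict_space borel hyp_boundary)"
  unfolding harmonic_measure_eq by simp

lemma tendsto_event: "{\<omega> \<in> space (increments \<mu>). pos \<omega> \<longlonglongrightarrow> z} \<in> sets (increments \<mu>)"
proof -
  have eq: "pos \<omega> \<longlonglongrightarrow> z \<longleftrightarrow> Cauchy (pos \<omega>) \<and> lim (pos \<omega>) = z" for \<omega>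
    by (auto simp: Cauchy_convergent_iff convergent_LIMSEQ_iff dest: limI intro!: convergentI)
  show ?thesis unfolding eq by measurable
qed

text \<open>Almost surely the walk converges, so the default value in \<^const>\<open>boundary_lim\<close> contributes nothing.\<close>

lemma harmonic_atom:
  assumes conv: "AE \<omega> in increments \<mu>. \<exists>\<xi>\<in>hyp_boundary. pos \<omega> \<longlonglongrightarrow> \<xi>" and z: "z \<in> hyp_boundary"
  shows "measure (harmonic_measure \<mu> x) {z} = \<P>(\<omega> in increments \<mu>. pos \<omega> \<longlonglongrightarrow> z)"
proof -
  have "measure (harmonic_measure \<mu> x) {z}
    = measure (increments \<mu>) ((\<lambda>\<omega>. boundary_lim (pos \<omega>)) -` {z} \<inter> space (increments \<mu>))"
    unfolding harmonic_measure_eq using z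
      by (intro measure_distr boundary_lim_measurable) (auto simp: sets_restrict_space_iff hyp_boundary_def)
  also have "\<dots> = \<P>(\<omega> in increments \<mu>. pos \<omega> \<longlonglongrightarrow> z)"
  proof (rule I.finite_measure_eq_AE)
    show "AE \<omega> in increments \<mu>. \<omega> \<in> (\<lambda>\<omega>. boundary_lim (pos \<omega>)) -` {z} \<inter> space (increments \<mu>)
      \<longleftrightarrow> \<omega> \<in> {\<omega> \<in> space (increments \<mu>). pos \<omega> \<longlonglongrightarrow> z}"
      using conv by (rule AE_mp) (auto intro!: AE_I2 simp: boundary_lim_eq dest: LIMSEQ_unique)
    show "(\<lambda>\<omega>. boundary_lim (pos \<omega>)) -` {z} \<inter> space (increments \<mu>) \<in> sets (increments \<mu>)"
      using z by (intro measurable_sets[OF boundary_lim_measurable]) (auto simp: sets_restrict_space_iff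
        hyp_boundary_def)
  qed (rule tendsto_event)
  finally show ?thesis .
qed

text \<open>Let the first increment act on the limit of the remaining walk. Summed over the boundary as a discrete
  set, this is the stationarity of the harmonic measure.\<close>

lemma harmonic_stationary:
  assumes conv: "AE \<omega> in increments \<mu>. \<exists>\<xi>\<in>hyp_boundary. pos \<omega> \<longlonglongrightarrow> \<xi>"
  shows "avg (\<lambda>z. measure (harmonic_measure \<mu> x) {z}) z = measure (harmonic_measure \<mu> x) {z}"
proof (cases "z \<in> hyp_boundary")
  case True
  have "measure (harmonic_measure \<mu> x) {z} = \<P>(\<omega> in increments \<mu>. pos \<omega> \<longlonglongrightarrow> z)"
    by (rule harmonic_atom[OF conv True])
  also have "\<dots> = measure_pmf.expectation \<mu> (\<lambda>s. \<P>(\<omega> in increments \<mu>. pos (case_nat s \<omega>) \<longlonglongrightarrow> z))"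
    by (rule prob_first_step[OF tendsto_event])
  also have "\<dots> = measure_pmf.expectation \<mu> (\<lambda>s. measure (harmonic_measure \<mu> x) {bext (inv\<^bsub>hyp_isom\<^esub> s) z})"
  proof (intro integral_cong_AE, simp, simp, unfold AE_measure_pmf_iff, intro ballI)
    fix s assume "s \<in> set_pmf \<mu>"
    hence s: "s \<in> carrier hyp_isom" using supp by auto
    let ?z = "bext (inv\<^bsub>hyp_isom\<^esub> s) z"
    have z: "?z \<in> hyp_boundary" using bext_hyp_boundary_iff[OF inv_closed[OF s]] True by simp
    have "pos (case_nat s \<omega>) \<longlonglongrightarrow> z \<longleftrightarrow> pos \<omega> \<longlonglongrightarrow> ?z" if w: "\<omega> \<in> space (increments \<mu>)" for \<omega>
    proof -
      have w': "\<omega> i \<in> set_pmf \<mu>" for i using w by (simp add: space_increments)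
      have "pos (case_nat s \<omega>) \<longlonglongrightarrow> z \<longleftrightarrow> (\<lambda>m. s (pos \<omega> m)) \<longlonglongrightarrow> bext s ?z"
        unfolding filterlim_sequentially_Suc[of "pos (case_nat s \<omega>)", symmetric] pos_shift[OF s w']
          bext_inv(2)[OF s] ..
      also have "\<dots> \<longleftrightarrow> pos \<omega> \<longlonglongrightarrow> ?z"
        using z by (intro bext_tendsto_iff[OF s pos_hyp_space[OF w']]) (simp add: hyp_boundary_def)
      finally show ?thesis .
    qed
    hence "{\<omega> \<in> space (increments \<mu>). pos (case_nat s \<omega>) \<longlonglongrightarrow> z} = {\<omega> \<in> space (increments \<mu>). pos \<omega> \<longlonglongrightarrow> ?z}" by blast
    thus "\<P>(\<omega> in increments \<mu>. pos (case_nat s \<omega>) \<longlonglongrightarrow> z) = measure (harmonic_measure \<mu> x) {?z}"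
      using harmonic_atom[OF conv z] by simp
  qed
  finally show ?thesis by (simp add: avg_def)
next
  case False
  have null: "measure (harmonic_measure \<mu> x) {y} = 0" if "y \<notin> hyp_boundary" for y
    using that by (intro measure_notin_sets) (auto simp: sets_harmonic sets_restrict_space)
  have "avg (\<lambda>z. measure (harmonic_measure \<mu> x) {z}) z = measure_pmf.expectation \<mu> (\<lambda>s. 0)"
    unfolding avg_def
  proof (intro integral_cong_AE, simp, simp, unfold AE_measure_pmf_iff, intro ballI null)
    fix s assume "s \<in> set_pmf \<mu>"
    thus "bext (inv\<^bsub>hyp_isom\<^esub> s) z \<notin> hyp_boundary"
      using False supp by (subst bext_hyp_boundary_iff[OF inv_closed]) auto
  qed
  thus ?thesis using null[OF False] by simp
qed

text \<open>Squares of probabilities are at most the probabilities, and only countably many points carry mass.\<close>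

lemma l2_sq_atoms:
  fixes \<nu> :: "'b measure"
  assumes "prob_space \<nu>"
  shows "l2_sq (\<lambda>z. measure \<nu> {z}) \<le> 1"
proof -
  interpret N: prob_space \<nu> by fact
  define A where "A = {z. measure \<nu> {z} \<noteq> 0}"
  have A: "countable A" unfolding A_def by (rule N.countable_support)
  have As: "{z} \<in> sets \<nu>" if "z \<in> A" for z using that measure_notin_sets by (auto simp: A_def)
  have "l2_sq (\<lambda>z. measure \<nu> {z}) \<le> (\<integral>\<^sup>+z. emeasure \<nu> {z} * indicator A z \<partial>count_space UNIV)"
    unfolding l2_sq_def
  proof (intro nn_integral_mono)
    fix z
    have "(measure \<nu> {z})\<^sup>2 \<le> measure \<nu> {z}" using power_decreasing[of 1 2 "measure \<nu> {z}"] by simp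
    thus "ennreal ((measure \<nu> {z})\<^sup>2) \<le> emeasure \<nu> {z} * indicator A z"
      by (auto simp: A_def indicator_def N.emeasure_eq_measure intro: ennreal_leI)
  qed
  also have "\<dots> = (\<integral>\<^sup>+z. emeasure \<nu> {z} \<partial>count_space A)"
    by (simp add: nn_integral_count_space_indicator)
  also have "\<dots> = emeasure \<nu> A" by (rule emeasure_countable_singleton[OF As A, symmetric])
  also have "\<dots> \<le> 1" by (rule N.emeasure_le_1)
  finally show ?thesis .
qed

text \<open>The masses of the atoms form a square-summable function on the closed ball that is fixed by \<open>avg\<close>, and
  the spectral gap excludes such a function other than zero.\<close>

theorem harmonic_nonatomic:
  assumes conv: "AE \<omega> in increments \<mu>. \<exists>\<xi>\<in>hyp_boundary. pos \<omega> \<longlonglongrightarrow> \<xi>"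
    and gap: "\<rho> < 1" "\<And>f. sub_prob f \<Longrightarrow> l2_sq f < \<infinity> \<Longrightarrow> l2_sq (lazy f) \<le> ennreal \<rho> * l2_sq f"
  shows "measure (harmonic_measure \<mu> x) {z} = 0"
proof -
  interpret N: prob_space "harmonic_measure \<mu> x" by (rule prob_space_harmonic)
  have fin: "l2_sq (\<lambda>z. measure (harmonic_measure \<mu> x) {z}) < \<infinity>"
    using l2_sq_atoms[OF prob_space_harmonic] by (auto intro: le_less_trans)
  have "measure (harmonic_measure \<mu> x) {y} = 0" if "y \<notin> cball 0 1" for y
    using that by (intro measure_notin_sets) (auto simp: sets_harmonic sets_restrict_space hyp_boundary_def)
  hence "sub_prob (\<lambda>z. measure (harmonic_measure \<mu> x) {z})" by (auto simp: sub_prob_def)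
  from stationary_vanishes[OF gap this fin harmonic_stationary[OF conv]] show ?thesis .
qed

end

section \<open>Statistical hyperbolicity\<close>

lemma hdist_measurable: "(\<lambda>p. hdist (fst p) (snd p)) \<in> borel_measurable (borel \<Otimes>\<^sub>M (borel :: (real ^ 'n)
  measure))"
  unfolding hdist_def arcosh_def by measurable

lemma horo_eq: "horo \<xi> y = fst (hlift y) - snd (hlift y) \<bullet> \<xi>"
  by (simp add: mink_def)

lemma ray_point_measurable:
  fixes \<nu> :: "(real ^ 'n) measure"
  assumes sets: "sets \<nu> = sets (restrict_space borel hyp_boundary)" and y: "y \<in> hyp_space" and r: "r \<ge> 0"
  shows "ray_point y r \<in> measurable \<nu> (restrict_space borel (hyp_sphere y r))"
proof -
  have sp: "space \<nu> = hyp_boundary" using sets_eq_imp_space_eq[OF sets] by (simp add: space_restrict_space)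
  have b: "(\<lambda>\<xi>. hproj (ray_vec y r \<xi>)) \<in> borel_measurable borel"
    unfolding hproj_def ray_vec_def horo_eq by (simp del: scaleR_Pair add: fst_add snd_add) measurable
  have "(\<lambda>\<xi>. hproj (ray_vec y r \<xi>)) \<in> measurable \<nu> borel"
    unfolding measurable_cong_sets[OF sets refl] by (rule measurable_restrict_space1[OF b])
  moreover have "ray_point y r \<xi> = hproj (ray_vec y r \<xi>)" if "\<xi> \<in> space \<nu>" for \<xi>
    using that ray_point_eq[OF y _ r] by (simp add: sp hyp_boundary_def)
  ultimately have m: "ray_point y r \<in> measurable \<nu> borel" by (simp cong: measurable_cong)
  show ?thesis
  proof (rule measurable_restrict_space2[OF _ m])
    show "ray_point y r \<in> space \<nu> \<rightarrow> hyp_sphere y r"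
      using hlift_ray_vec(1)[OF y _ r] hdist_ray_points(3)[OF y _ _ r] ray_point_eq[OF y _ r]
      by (auto simp: sp hyp_boundary_def hyp_sphere_def)
  qed
qed

text \<open>By \<open>hdist_ray_points\<close> the distance is at most \<open>2 r\<close> and at least \<open>ln (c (sinh r)\<^sup>2)\<close> with \<open>c > 0\<close>.\<close>

lemma ray_distance_growth:
  fixes \<xi> \<eta> :: "real ^ 'n"
  assumes y: "y \<in> hyp_space" and n: "norm \<xi> = 1" "norm \<eta> = 1" and ne: "\<xi> \<noteq> \<eta>"
  shows "((\<lambda>r. 1 / r * hdist (ray_point y r \<xi>) (ray_point y r \<eta>)) \<longlongrightarrow> 2) at_top"
proof -
  define c where "c = (1 - \<xi> \<bullet> \<eta>) / (horo \<xi> y * horo \<eta> y)"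
  have "(norm (\<xi> - \<eta>))\<^sup>2 > 0" using ne by simp
  hence "1 - \<xi> \<bullet> \<eta> > 0" unfolding norm_diff_square n by simp
  hence c: "c > 0" unfolding c_def using horo_pos[OF y n(1)] horo_pos[OF y n(2)] by simp
  have lower: "1 / r * ln ((sinh r)\<^sup>2 * c) \<le> 1 / r * hdist (ray_point y r \<xi>) (ray_point y r \<eta>)"
    if r: "r > 0" for r
  proof (intro mult_left_mono)
    have p: "ray_point y r \<xi> \<in> hyp_space" "ray_point y r \<eta> \<in> hyp_space"
      using hlift_ray_vec(1)[OF y n(1), of r] hlift_ray_vec(1)[OF y n(2), of r] ray_point_eq[OF y n(1), of r]
        ray_point_eq[OF y n(2), of r] r by auto
    have "(sinh r)\<^sup>2 * c \<le> cosh (hdist (ray_point y r \<xi>) (ray_point y r \<eta>))"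
      unfolding c_def using hdist_ray_points(1)[OF y n] r by simp
    also have "\<dots> \<le> exp (hdist (ray_point y r \<xi>) (ray_point y r \<eta>))"
      by (rule cosh_bounds(2)[OF hdist_nonneg[OF p]])
    finally have "ln ((sinh r)\<^sup>2 * c) \<le> ln (exp (hdist (ray_point y r \<xi>) (ray_point y r \<eta>)))"
      using c r by (subst ln_le_cancel_iff) auto
    thus "ln ((sinh r)\<^sup>2 * c) \<le> hdist (ray_point y r \<xi>) (ray_point y r \<eta>)" by simp
  qed (use r in simp)
  show ?thesis
  proof (rule tendsto_sandwich)
    show "\<forall>\<^sub>F r in at_top. 1 / r * ln ((sinh r)\<^sup>2 * c) \<le> 1 / r * hdist (ray_point y r \<xi>) (ray_point y r \<eta>)"
      using eventually_gt_at_top[of 0] by eventually_elim (rule lower)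
    show "\<forall>\<^sub>F r in at_top. 1 / r * hdist (ray_point y r \<xi>) (ray_point y r \<eta>) \<le> 2"
      using eventually_gt_at_top[of 0]
        by eventually_elim (use hdist_ray_points(2)[OF y n] in \<open>simp add: field_simps\<close>)
    show "((\<lambda>r. 1 / r * ln ((sinh r)\<^sup>2 * c)) \<longlongrightarrow> 2) at_top"
      unfolding sinh_field_def using c by real_asymp
  qed simp
qed

text \<open>Without atoms the diagonal is a null set of the product measure. Off the diagonal the integrand divided by
  \<open>r\<close> tends to \<open>2\<close>, and it is bounded by \<open>2\<close>, so dominated convergence applies.\<close>

theorem nonatomic_statistically_hyperbolic:
  fixes \<nu> :: "(real ^ 'n) measure"
  assumes prob: "prob_space \<nu>" and sets: "sets \<nu> = sets (restrict_space borel hyp_boundary)"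
    and atoms: "\<And>z. measure \<nu> {z} = 0"
  shows "statistically_hyperbolic \<nu>"
  unfolding statistically_hyperbolic_def
proof
  fix y :: "real ^ 'n" assume y: "y \<in> hyp_space"
  interpret N: prob_space \<nu> by fact
  interpret NN: pair_prob_space \<nu> \<nu> ..
  have sp: "space \<nu> = hyp_boundary" using sets_eq_imp_space_eq[OF sets] by (simp add: space_restrict_space)
  have idm: "(\<lambda>z. z) \<in> measurable \<nu> borel"
    unfolding measurable_cong_sets[OF sets refl] by (rule measurable_restrict_space1) simp
  have fm: "fst \<in> measurable (\<nu> \<Otimes>\<^sub>M \<nu>) borel" "snd \<in> measurable (\<nu> \<Otimes>\<^sub>M \<nu>) borel"
    using measurable_compose[OF measurable_fst idm] measurable_compose[OF measurable_snd idm] by auto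
  define F where "F r p = hdist (ray_point y r (fst p)) (ray_point y r (snd p))" for r
    and p :: "(real ^ 'n) \<times> (real ^ 'n)"
  have Fb: "0 \<le> F r p \<and> F r p \<le> 2 * r" if "p \<in> space (\<nu> \<Otimes>\<^sub>M \<nu>)" "r \<ge> 0" for r p
  proof -
    have n: "norm (fst p) = 1" "norm (snd p) = 1" using that(1)
      by (auto simp: space_pair_measure sp hyp_boundary_def)
    show ?thesis unfolding F_def
      using hdist_ray_points(2)[OF y n that(2)] hlift_ray_vec(1)[OF y n(1) that(2)] hlift_ray_vec(1)[OF y n(2)
        that(2)]
      by (auto simp: ray_point_eq[OF y n(1) that(2)] ray_point_eq[OF y n(2) that(2)] intro!: hdist_nonneg)
  qed
  have rm: "(\<lambda>(a, b). (ray_point y r a, ray_point y r b)) \<in> measurable (\<nu> \<Otimes>\<^sub>M \<nu>) (restrict_space borel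
    (hyp_sphere y r) \<Otimes>\<^sub>M restrict_space borel (hyp_sphere y r))" if "r \<ge> 0" for r
  proof -
    note [measurable] = ray_point_measurable[OF sets y that]
    show ?thesis by measurable
  qed
  have hm: "(\<lambda>p. hdist (fst p) (snd p)) \<in> borel_measurable (restrict_space borel A \<Otimes>\<^sub>M restrict_space borel A)"
    for A :: "(real ^ 'n) set"
  proof -
    have i: "(\<lambda>z. z) \<in> measurable (restrict_space borel A) borel" by (rule measurable_restrict_space1) simp
    have "(\<lambda>p. (fst p, snd p)) \<in> measurable (restrict_space borel A \<Otimes>\<^sub>M restrict_space borel A) (borel \<Otimes>\<^sub>M
      borel)"
      by (intro measurable_Pair measurable_compose[OF measurable_fst i] measurable_compose[OF measurable_snd i])
    from measurable_compose[OF this hdist_measurable] show ?thesis by simp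
  qed
  have Fm: "F r \<in> borel_measurable (\<nu> \<Otimes>\<^sub>M \<nu>)" if "r \<ge> 0" for r
    using measurable_compose[OF rm[OF that] hm] by (simp add: F_def[abs_def] split_beta)
  have int: "(\<integral>p. hdist (fst p) (snd p) \<partial>(sphere_measure \<nu> y r \<Otimes>\<^sub>M sphere_measure \<nu> y r))
    = (\<integral>p. F r p \<partial>(\<nu> \<Otimes>\<^sub>M \<nu>))" if r: "r \<ge> 0" for r
  proof -
    let ?S = "restrict_space borel (hyp_sphere y r)"
    have m: "ray_point y r \<in> measurable \<nu> ?S" by (rule ray_point_measurable[OF sets y r])
    have ps: "prob_space (distr \<nu> ?S (ray_point y r))" by (rule N.prob_space_distr[OF m])
    have "sphere_measure \<nu> y r \<Otimes>\<^sub>M sphere_measure \<nu> y r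
      = distr (\<nu> \<Otimes>\<^sub>M \<nu>) (?S \<Otimes>\<^sub>M ?S) (\<lambda>(a, b). (ray_point y r a, ray_point y r b))"
      unfolding sphere_measure_def
      by (rule pair_measure_distr[OF m m prob_space_imp_sigma_finite[OF ps]])
    thus ?thesis by (simp add: integral_distr[OF rm[OF r] hm] F_def split_beta)
  qed
  have diag: "AE p in \<nu> \<Otimes>\<^sub>M \<nu>. fst p \<noteq> snd p"
  proof (rule AE_I)
    let ?D = "{p \<in> space (\<nu> \<Otimes>\<^sub>M \<nu>). fst p = snd p}"
    show "{p \<in> space (\<nu> \<Otimes>\<^sub>M \<nu>). \<not> fst p \<noteq> snd p} \<subseteq> ?D" by auto
    note [measurable] = fm
    show D: "?D \<in> sets (\<nu> \<Otimes>\<^sub>M \<nu>)" by measurable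
    have "emeasure (\<nu> \<Otimes>\<^sub>M \<nu>) ?D = (\<integral>\<^sup>+a. emeasure \<nu> (Pair a -` ?D) \<partial>\<nu>)"
      by (rule N.emeasure_pair_measure_alt[OF D])
    also have "\<dots> = (\<integral>\<^sup>+a. 0 \<partial>\<nu>)"
    proof (rule nn_integral_cong)
      fix a assume "a \<in> space \<nu>"
      hence "Pair a -` ?D = {a}" by (auto simp: space_pair_measure)
      thus "emeasure \<nu> (Pair a -` ?D) = 0" using atoms by (simp add: N.emeasure_eq_measure)
    qed
    finally show "emeasure (\<nu> \<Otimes>\<^sub>M \<nu>) ?D = 0" by simp
  qed
  \<comment> \<open>The value \<open>0\<close> for \<open>r \<le> 0\<close> is only there to have measurability for every \<open>r\<close>.\<close>
  define s where "s r p = (if r > 0 then 1 / r * F r p else 0)" for r p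
  have "((\<lambda>r. integral\<^sup>L (\<nu> \<Otimes>\<^sub>M \<nu>) (s r)) \<longlongrightarrow> integral\<^sup>L (\<nu> \<Otimes>\<^sub>M \<nu>) (\<lambda>p. 2)) at_top"
  proof (rule integral_dominated_convergence_at_top[where w = "\<lambda>_. 2"])
    show "s r \<in> borel_measurable (\<nu> \<Otimes>\<^sub>M \<nu>)" for r
      using Fm[of r] by (cases "r > 0") (auto simp: s_def[abs_def])
    show "AE p in \<nu> \<Otimes>\<^sub>M \<nu>. ((\<lambda>r. s r p) \<longlongrightarrow> 2) at_top"
      using diag
    proof (rule AE_mp, intro AE_I2 impI)
      fix p assume p: "p \<in> space (\<nu> \<Otimes>\<^sub>M \<nu>)" and ne: "fst p \<noteq> snd p"
      have n: "norm (fst p) = 1" "norm (snd p) = 1" using p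
        by (auto simp: space_pair_measure sp hyp_boundary_def)
      show "((\<lambda>r. s r p) \<longlongrightarrow> 2) at_top"
      proof (rule Lim_transform_eventually[OF ray_distance_growth[OF y n ne]])
        show "\<forall>\<^sub>F r in at_top. 1 / r * hdist (ray_point y r (fst p)) (ray_point y r (snd p)) = s r p"
          using eventually_gt_at_top[of 0] by eventually_elim (simp add: s_def F_def)
      qed
    qed
    show "\<forall>\<^sub>F r in at_top. AE p in \<nu> \<Otimes>\<^sub>M \<nu>. norm (s r p) \<le> 2"
      using eventually_gt_at_top[of 0]
    proof eventually_elim
      case (elim r)
      show ?case using Fb[of _ r] elim by (intro AE_I2) (auto simp: s_def field_simps)
    qed
  qed auto
  hence "((\<lambda>r. integral\<^sup>L (\<nu> \<Otimes>\<^sub>M \<nu>) (s r)) \<longlongrightarrow> 2) at_top" by (simp add: NN.prob_space)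
  thus "((\<lambda>r. 1 / r * (\<integral>p. hdist (fst p) (snd p) \<partial>(sphere_measure \<nu> y r \<Otimes>\<^sub>M sphere_measure \<nu> y r))) \<longlongrightarrow> 2) at_top"
  proof (rule Lim_transform_eventually)
    show "\<forall>\<^sub>F r in at_top. integral\<^sup>L (\<nu> \<Otimes>\<^sub>M \<nu>) (s r)
      = 1 / r * (\<integral>p. hdist (fst p) (snd p) \<partial>(sphere_measure \<nu> y r \<Otimes>\<^sub>M sphere_measure \<nu> y r))"
      using eventually_gt_at_top[of 0] by eventually_elim (simp add: int s_def[abs_def])
  qed
qed

text \<open>Moving the base point changes displacements by at most twice the distance moved.\<close>

lemma first_moment_integrable:
  assumes G: "\<Gamma> \<subseteq> carrier hyp_isom" and s: "set_pmf \<mu> \<subseteq> \<Gamma>" and fm: "finite_first_moment \<Gamma> \<mu>"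
    and x: "x \<in> hyp_space"
  shows "integrable (measure_pmf \<mu>) (\<lambda>g. hdist x (g x))"
proof -
  obtain z where z: "z \<in> hyp_space" and sum: "(\<lambda>g. pmf \<mu> g * hdist z (g z)) summable_on \<Gamma>"
    using fm by (auto simp: finite_first_moment_def)
  have "integrable (count_space UNIV) (\<lambda>g. indicator \<Gamma> g *\<^sub>R (pmf \<mu> g * hdist z (g z)))"
    using abs_summable_equivalent[THEN iffD1, OF summable_on_iff_abs_summable_on_real[THEN iffD1, OF sum]]
    unfolding abs_summable_on_altdef set_integrable_def .
  moreover have "(\<lambda>g. indicator \<Gamma> g *\<^sub>R (pmf \<mu> g * hdist z (g z))) = (\<lambda>g. pmf \<mu> g *\<^sub>R hdist z (g z))"
    using s by (intro ext) (auto simp: indicator_def set_pmf_iff subset_iff)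
  ultimately have "integrable (count_space UNIV) (\<lambda>g. pmf \<mu> g *\<^sub>R hdist z (g z))" by simp
  hence int: "integrable (measure_pmf \<mu>) (\<lambda>g. hdist z (g z))"
    unfolding measure_pmf_eq_density by (subst integrable_density) auto
  show ?thesis
  proof (rule Bochner_Integration.integrable_bound)
    show "integrable (measure_pmf \<mu>) (\<lambda>g. hdist z (g z) + 2 * hdist x z)" using int by simp
    show "AE g in measure_pmf \<mu>. norm (hdist x (g x)) \<le> norm (hdist z (g z) + 2 * hdist x z)"
      unfolding AE_measure_pmf_iff
    proof
      fix g assume "g \<in> set_pmf \<mu>"
      hence g: "g \<in> carrier hyp_isom" using s G by auto
      note m = hyp_isom_closed[OF g x] hyp_isom_closed[OF g z]
      show "norm (hdist x (g x)) \<le> norm (hdist z (g z) + 2 * hdist x z)"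
        using hdist_triangle[OF x z m(1)] hdist_triangle[OF z m(2) m(1)] hdist_isom[OF g z x]
          hdist_nonneg[OF x m(1)] by (simp add: hdist_commute[of z x])
    qed
  qed simp
qed

lemma pow_in_generate:
  assumes "g \<in> generate G S" "group G" "S \<subseteq> carrier G"
  shows "g [^]\<^bsub>G\<^esub> (n::nat) \<in> generate G S"
proof -
  interpret group G by fact
  show ?thesis by (induction n) (use assms in \<open>auto intro: generate.intros\<close>)
qed

theorem theorem1p2:
  fixes \<Gamma> :: "(real ^ 'n \<Rightarrow> real ^ 'n) set"
    and \<mu> :: "(real ^ 'n \<Rightarrow> real ^ 'n) pmf"
    and x :: "real ^ 'n"
  assumes "CARD('n) \<ge> 2"
    and "lattice_in hyp_isom hyp_isom_topology \<Gamma>"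
    and "set_pmf \<mu> \<subseteq> \<Gamma>"
    and "finite_first_moment \<Gamma> \<mu>"
    and "\<exists>g\<in>generate hyp_isom (set_pmf \<mu>). \<exists>h\<in>generate hyp_isom (set_pmf \<mu>).
           loxodromic g \<and> loxodromic h \<and> lox_axis g \<noteq> lox_axis h"
    and "x \<in> hyp_space"
  shows "statistically_hyperbolic (harmonic_measure \<mu> x)"
proof -
  note x = \<open>x \<in> hyp_space\<close>
  have G: "subgroup \<Gamma> hyp_isom" and d: "subtopology hyp_isom_topology \<Gamma> = discrete_topology \<Gamma>"
    using assms(2) by (auto simp: lattice_in_def)
  have Gc: "\<Gamma> \<subseteq> carrier hyp_isom" using G by (rule subgroup.subset)
  have fin: "finite {g \<in> \<Gamma>. hdist z (g z) \<le> R}" if "z \<in> hyp_space" for z R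
    by (rule discrete_finite_displacement[OF G d that])
  interpret hyp_walk \<mu> x
    using assms(3) Gc x by unfold_locales auto
  obtain g h where g: "g \<in> generate hyp_isom (set_pmf \<mu>)" "loxodromic g"
    and h: "h \<in> generate hyp_isom (set_pmf \<mu>)" "loxodromic h" and ne: "lox_axis g \<noteq> lox_axis h"
    using assms(5) by blast
  have genG: "generate hyp_isom (set_pmf \<mu>) \<subseteq> \<Gamma>"
    by (rule generate_subgroup_incl[OF assms(3) G])
  have gG: "g \<in> \<Gamma>" "h \<in> \<Gamma>" using g h genG by auto
  obtain n :: nat and A1 A2 B1 B2 :: "(real ^ 'n) set" where
    disj: "A1 \<inter> A2 = {}" "B1 \<inter> B2 = {}" "(A1 \<union> A2) \<inter> (B1 \<union> B2) = {}" and
    A: "\<And>p. p \<in> cball 0 1 \<Longrightarrow> p \<notin> A1 \<Longrightarrow> bext (g [^]\<^bsub>hyp_isom\<^esub> n) p \<in> A2" and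
    B: "\<And>p. p \<in> cball 0 1 \<Longrightarrow> p \<notin> B1 \<Longrightarrow> bext (h [^]\<^bsub>hyp_isom\<^esub> n) p \<in> B2"
    by (rule ping_pong[OF G fin gG(1) g(2) gG(2) h(2) ne]) (assumption, (rule that; assumption))
  have gn: "g [^]\<^bsub>hyp_isom\<^esub> n \<in> generate hyp_isom (set_pmf \<mu>)"
    "h [^]\<^bsub>hyp_isom\<^esub> n \<in> generate hyp_isom (set_pmf \<mu>)"
    using pow_in_generate[OF _ group_hyp_isom supp] g h by auto
  have gnc: "g [^]\<^bsub>hyp_isom\<^esub> n \<in> carrier hyp_isom" "h [^]\<^bsub>hyp_isom\<^esub> n \<in> carrier hyp_isom"
    using gn genG Gc by auto
  obtain \<rho> where \<rho>: "0 \<le> \<rho>" "\<rho> < 1" "\<And>f. sub_prob f \<Longrightarrow> l2_sq f < \<infinity> \<Longrightarrow> l2_sq (lazy f) \<le> ennreal \<rho> * l2_sq f"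
  proof (rule spectral_gap[OF gn disj])
    show "bext (inv\<^bsub>hyp_isom\<^esub> (inv\<^bsub>hyp_isom\<^esub> (g [^]\<^bsub>hyp_isom\<^esub> n))) p \<in> A2" if "p \<in> cball 0 1" "p \<notin> A1" for p
      using A[OF that] by (simp only: inv_inv[OF gnc(1)])
    show "bext (inv\<^bsub>hyp_isom\<^esub> (inv\<^bsub>hyp_isom\<^esub> (h [^]\<^bsub>hyp_isom\<^esub> n))) p \<in> B2" if "p \<in> cball 0 1" "p \<notin> B1" for p
      using B[OF that] by (simp only: inv_inv[OF gnc(2)])
  qed (rule that)
  obtain C where C: "C > 0" "\<And>R. finite {z \<in> (\<lambda>g. g x) ` \<Gamma>. hdist 0 z \<le> R}"
    "\<And>R. R \<ge> 0 \<Longrightarrow> real (card {z \<in> (\<lambda>g. g x) ` \<Gamma>. hdist 0 z \<le> R}) \<le> C * exp (real CARD('n) * R)"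
    by (rule orbit_growth[OF G fin[OF x] x]) (rule that)
  have orb: "pos \<omega> m \<in> (\<lambda>g. g x) ` \<Gamma>" if "\<omega> \<in> space (increments \<mu>)" for \<omega> m
  proof -
    have "walk \<omega> m \<in> \<Gamma>"
    proof (induction m)
      case 0
      show ?case using subgroup.one_closed[OF G] by simp
    next
      case (Suc m)
      have "\<omega> m \<in> \<Gamma>" using that assms(3) by (auto simp: space_increments)
      thus ?case using Suc subgroup.m_closed[OF G] by simp
    qed
    thus ?thesis by (simp add: pos_def)
  qed
  have pos: "real CARD('n) > 0" by simp
  obtain c where c: "c > 0" "AE \<omega> in increments \<mu>. \<forall>\<^sub>F m in sequentially. hdist 0 (pos \<omega> m) > c * real m"
  proof (rule linear_escape[OF \<rho> pos C(2,3)])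
    show "pos \<omega> m \<in> (\<lambda>g. g x) ` \<Gamma>" if "\<omega> \<in> space (increments \<mu>)" for \<omega> m by (rule orb[OF that])
  qed (assumption | rule that)+
  have st: "AE \<omega> in increments \<mu>. \<forall>\<^sub>F m in sequentially. hdist x (\<omega> m x) \<le> c * real m"
    by (rule sublinear_steps[OF first_moment_integrable[OF Gc assms(3,4) x] c(1)])
  have conv: "AE \<omega> in increments \<mu>. \<exists>\<xi>\<in>hyp_boundary. pos \<omega> \<longlonglongrightarrow> \<xi>"
    using AE_space c(2) st
  proof eventually_elim
    case (elim \<omega>)
    show ?case
      by (rule converges_to_boundary[OF _ c(1) elim(2,3)]) (use elim(1) in \<open>simp add: space_increments\<close>)
  qed
  show ?thesis
    by (rule nonatomic_statistically_hyperbolic[OF prob_space_harmonic sets_harmonic harmonic_nonatomic[OF conv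
      \<rho>(2,3)]])
qed

end
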